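(* For all $c_0,c_1,R>0$ there exist constants $C_5,C_6,C_7>0$ depending only on $c_0,c_1,R$ such that the following holds. Let $s\le m\le d$ be positive integers with $$d\ge(\log 6)^2m\quad\text{and}\quad 3s\le(C_2m)/\log(d/m),$$ let $\sigma>0$ and $0<h<\sqrt{m/d}$. Let $a\in\mathbb{R}^d$ with $\|a\|_{l_2^d}=1$ and $\|a\|_{l_1^d}\le R$, and let $g\colon[-1,1]\to\mathbb{R}$ be a differentiable function such that $|g(t_1)-g(t_2)|\le c_0|t_1-t_2|$ and $|g'(t_1)-g'(t_2)|\le c_1|t_1-t_2|$ for all $t_1,t_2\in[-1,1]$, and $g'(0)>0$. Let $f\colon B^d\to\mathbb{R}$, $f(x)=g(\langle a,x\rangle)$. Let $\Phi\in\mathbb{R}^{m\times d}$ be a normalized Bernoulli matrix with rows $\varphi_1,\dots,\varphi_m$, let $\tilde z_1,\dots,\tilde z_m\sim\mathcal N(0,\sigma^2)$ be independent (and independent of $\Phi$), and put $$b_j:=\frac{(f(h\varphi_j)+\tilde z_j)-f(0)}{h}\quad(j=1,\dots,m),\qquad\hat a:=\frac{\Delta_{DS}(b)}{\|\Delta_{DS}(b)\|_{l_2^d}},$$ where $\Delta_{DS}$ is the Dantzig selector for the matrix $\Phi$ with $\lambda_d=\sqrt{2\log d}$ and noise level $\sigma/h$, and $$\hat g(t):=f(t\hat a),\qquad\hat f\colon B^d\to\mathbb{R},\quad\hat f(x):=\hat g(\langle\hat a,x\rangle).$$ Put $$\mathrm{err}(a,\hat a):=\left(\min_{1\le s_*\le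 s}2C_5\log d\left(s_*\frac{\sigma^2}{h^2}+\tilde R^2s_*^{-1}\right)\right)^{1/2}+C_7\frac{h}{\sqrt s},\qquad\tilde R:=2(R+2C_6h),$$ the minimum being over integers $s_*$. Then with high probability the following holds: if $\Delta_{DS}(b)\ne0$ (so that $\hat a$ is defined), $$\|f-\hat f\|_\infty\le 2c_0\|a-\hat a\|_{l_2^d},$$ and if $g'(0)-\mathrm{err}(a,\hat a)>0$, then $\hat a$ is defined and $$2c_0\|a-\hat a\|_{l_2^d}\le\frac{4c_0\,\mathrm{err}(a,\hat a)}{g'(0)-\mathrm{err}(a,\hat a)}.$$
   Context: $B^d=\{x\in\mathbb{R}^d:\|x\|_{l_2^d}<1\}$; $\|x\|_{l_1^d}=\sum_i|x_i|$; $\|x\|_{l_2^d}$ is the Euclidean norm; $\|x\|_{l_\infty^d}=\max_i|x_i|$; $\|f-\hat f\|_\infty=\sup_{x\in B^d}|f(x)-\hat f(x)|$. A normalized Bernoulli matrix $\Phi\in\mathbb{R}^{m\times d}$ is a random matrix whose entries are independent and equal to $\pm1/\sqrt m$ with probability $1/2$ each. A matrix $\Phi\in\mathbb{R}^{m\times d}$ satisfies the restricted isometry property (RIP) of order $s$ with constant $\delta$ if $(1-\delta)\|x\|_{l_2^d}^2\le\|\Phi x\|_{l_2^m}^2\le(1+\delta)\|x\|_{l_2^d}^2$ for all $x$ with at most $s$ nonzero entries. Throughout, $C_1,C_2>0$ are fixed absolute constants such that, for all $m<d$, a normalized Bernoulli matrix $\Phi\in\mathbb{R}^{m\times d}$ satisfies,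 with probability at least $1-2e^{-C_1m}$, the RIP of order $s$ with constant $1/6$ for each positive integer $s\le(C_2m)/\log(d/m)$ (such constants are known to exist). The Dantzig selector $\Delta_{DS}(y)\in\mathbb{R}^d$ of $y\in\mathbb{R}^m$ for the matrix $\Phi$ with parameters $\lambda_d>0$ and noise level $\tau>0$ is a solution $w$ of the minimization problem $\min_{w\in\mathbb{R}^d}\|w\|_{l_1^d}$ subject to $\|\Phi^T(y-\Phi w)\|_{l_\infty^d}\le\lambda_d\tau$. "With high probability" means: with probability (with respect to the joint draw of $\Phi$ and the noise) at least $1-\rho(m)$, where $\rho$ is a function with $\rho(m)\to0$ as $m\to\infty$ that is independent of all other parameters. *)

theory Defs
  imports "HOL-Probability.Probability" "Jordan_Normal_Form.Matrix"
begin

text \<open>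
  The dimensions are quantified inside the statement (the constants must not depend on them), so
  vectors and matrices are those of Jordan_Normal_Form, with carriers. The notation and names of
  HOL-Analysis for type-indexed vectors that clash with them are switched off. Indices start at 0.
\<close>

unbundle no inner_syntax
no_notation vec_nth (infixl \<open>$\<close> 90)
hide_const (open) Finite_Cartesian_Product.vec Finite_Cartesian_Product.mat
  Finite_Cartesian_Product.row

definition l1_norm :: "real Matrix.vec \<Rightarrow> real" where
  "l1_norm x = (\<Sum>i<dim_vec x. \<bar>x $ i\<bar>)"

definition l2_norm :: "real Matrix.vec \<Rightarrow> real" where
  "l2_norm x = L2_set (\<lambda>i. x $ i) {..<dim_vec x}"

text \<open>Only used in dimension at least 1, where the maximum is over a nonempty set.\<close>

definition linf_norm :: "real Matrix.vec \<Rightarrow> real" where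
  "linf_norm x = (MAX i\<in>{..<dim_vec x}. \<bar>x $ i\<bar>)"

definition unit_ball :: "nat \<Rightarrow> real Matrix.vec set" where
  "unit_ball d = {x \<in> carrier_vec d. l2_norm x < 1}"

text \<open>A real supremum: meaningful only if the difference is bounded on the ball. In the
  statement both functions are bounded there, since the profile is Lipschitz on [-1,1].\<close>

definition sup_dist :: "nat \<Rightarrow> (real Matrix.vec \<Rightarrow> real) \<Rightarrow> (real Matrix.vec \<Rightarrow> real) \<Rightarrow> real" where
  "sup_dist d f f' = (SUP x\<in>unit_ball d. \<bar>f x - f' x\<bar>)"

definition rip :: "nat \<Rightarrow> real \<Rightarrow> real Matrix.mat \<Rightarrow> bool" where
  "rip s \<delta> \<Phi> \<longleftrightarrow>
    (\<forall>x\<in>carrier_vec (dim_col \<Phi>). card {i. i < dim_col \<Phi> \<and> x $ i \<noteq> 0} \<le> s \<longrightarrow>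
       (1 - \<delta>) * (l2_norm x)\<^sup>2 \<le> (l2_norm (\<Phi> *\<^sub>v x))\<^sup>2 \<and>
       (l2_norm (\<Phi> *\<^sub>v x))\<^sup>2 \<le> (1 + \<delta>) * (l2_norm x)\<^sup>2)"

text \<open>\<^const>\<open>Pi_pmf\<close> makes the entries independent; the 0 is its value outside the index set.\<close>

definition bernoulli_matrix :: "nat \<Rightarrow> nat \<Rightarrow> real Matrix.mat pmf" where
  "bernoulli_matrix m d =
     map_pmf (\<lambda>X. Matrix.mat m d X)
       (Pi_pmf ({..<m} \<times> {..<d}) 0 (\<lambda>_. pmf_of_set {1 / sqrt (real m), - (1 / sqrt (real m))}))"

text \<open>The RIP property is required only for \<open>(ln 6)\<^sup>2 m \<le> d\<close> (hence \<open>m < d\<close>), the range in which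
  it is used. Required for all \<open>m < d\<close> it would be unsatisfiable: for \<open>d = m + 1\<close> and large \<open>m\<close>
  the bound on \<open>s\<close> exceeds \<open>d\<close>, and RIP of order \<open>d\<close> fails because the matrix has a kernel.\<close>

definition bernoulli_rip_constants :: "real \<Rightarrow> real \<Rightarrow> bool" where
  "bernoulli_rip_constants C1 C2 \<longleftrightarrow> C1 > 0 \<and> C2 > 0 \<and>
    (\<forall>m d. 0 < m \<and> m < d \<and> (ln 6)\<^sup>2 * real m \<le> real d \<longrightarrow>
       measure_pmf.prob (bernoulli_matrix m d)
         {\<Phi>. \<forall>s>0. real s \<le> C2 * real m / ln (real d / real m) \<longrightarrow> rip s (1/6) \<Phi>}
       \<ge> 1 - 2 * exp (- C1 * real m))"

text \<open>Minimizers need not be unique; a selector is any function picking one for each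
  \<open>y\<close>.\<close>

definition dantzig_selector ::
  "real Matrix.mat \<Rightarrow> real \<Rightarrow> real \<Rightarrow> (real Matrix.vec \<Rightarrow> real Matrix.vec) \<Rightarrow> bool" where
  "dantzig_selector \<Phi> lam \<tau> D \<longleftrightarrow>
    (\<forall>y\<in>carrier_vec (dim_row \<Phi>).
       is_arg_min l1_norm
         (\<lambda>w. w \<in> carrier_vec (dim_col \<Phi>) \<and>
              linf_norm (transpose_mat \<Phi> *\<^sub>v (y - \<Phi> *\<^sub>v w)) \<le> lam * \<tau>)
         (D y))"

definition ridge :: "(real \<Rightarrow> real) \<Rightarrow> real Matrix.vec \<Rightarrow> real Matrix.vec \<Rightarrow> real" where
  "ridge g a x = g (a \<bullet> x)"

text \<open>Joint law of the matrix and of the independent noise \<open>z 0, \<dots>, z (m-1)\<close>.\<close>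

definition sample_space :: "nat \<Rightarrow> nat \<Rightarrow> real \<Rightarrow> (real Matrix.mat \<times> (nat \<Rightarrow> real)) measure" where
  "sample_space m d \<sigma> =
     measure_pmf (bernoulli_matrix m d) \<Otimes>\<^sub>M
     (\<Pi>\<^sub>M j\<in>{..<m}. density lborel (\<lambda>t. ennreal (normal_density 0 \<sigma> t)))"

text \<open>\<open>P\<close> need not be measurable (an arbitrary selector may enter it), hence the measurable
  \<open>E\<close>; for measurable \<open>P\<close> this is the usual lower bound on the probability.\<close>

definition holds_with_prob_ge :: "'w measure \<Rightarrow> real \<Rightarrow> ('w \<Rightarrow> bool) \<Rightarrow> bool" where
  "holds_with_prob_ge M p P \<longleftrightarrow>
    (\<exists>E\<in>sets M. measure M E \<ge> p \<and> (\<forall>\<omega>\<in>E. P \<omega>))"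

definition observations ::
  "(real Matrix.vec \<Rightarrow> real) \<Rightarrow> real \<Rightarrow> real Matrix.mat \<Rightarrow> (nat \<Rightarrow> real) \<Rightarrow> real Matrix.vec" where
  "observations f h \<Phi> z =
     Matrix.vec (dim_row \<Phi>)
       (\<lambda>j. ((f (h \<cdot>\<^sub>v Matrix.row \<Phi> j) + z j) - f (0\<^sub>v (dim_col \<Phi>))) / h)"

definition err ::
  "real \<Rightarrow> real \<Rightarrow> real \<Rightarrow> real \<Rightarrow> nat \<Rightarrow> nat \<Rightarrow> real \<Rightarrow> real \<Rightarrow> real" where
  "err C5 C6 C7 R s d \<sigma> h =
     sqrt (MIN k\<in>{1..s}. 2 * C5 * ln (real d) *
             (real k * (\<sigma>\<^sup>2 / h\<^sup>2) + (2 * (R + 2 * C6 * h))\<^sup>2 / real k))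
     + C7 * (h / sqrt (real s))"

end

theory Submission
  imports Defs "Jordan_Normal_Form.Determinant"
begin

text \<open>
  Dividing the increments of \<open>f\<close> by \<open>h\<close> turns the problem into linear recovery: the observations are
  \<open>b = \<Phi> (g'(0) a) + \<eta> + z/h\<close>. The linearization error \<open>\<eta>\<close> has entries of size \<open>O(h/m)\<close>, because
  the entries of \<open>\<Phi>\<close> are \<open>\<plusminus>1/\<surd>m\<close> and hence \<open>\<bar>\<langle>a,\<phi>\<^sub>j\<rangle>\<bar> \<le> R/\<surd>m\<close>. The columns of \<open>\<Phi>\<close> are unit
  vectors, so each of them correlates with \<open>z/h\<close> as a Gaussian of deviation \<open>\<sigma>/h\<close>; the Gaussian tail and
  a union bound over the \<open>d\<close> columns keep all correlations below \<open>\<surd>(2 ln d) \<sigma>/h\<close> except with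
  probability \<open>O(1/\<surd>(ln d))\<close>. This uses up the whole tolerance of the Dantzig selector, and
  since \<open>\<sigma>\<close> may be arbitrarily small nothing is left for \<open>\<eta>\<close>. The error \<open>\<eta>\<close> is therefore moved into
  the signal: if \<open>\<eta> = \<Phi> u\<close>, then \<open>x = g'(0) a + u\<close> is feasible, and it suffices that \<open>\<parallel>u\<parallel>\<^sub>1 = O(h)\<close>
  and \<open>\<parallel>u\<parallel>\<^sub>2 = O(h/\<surd>m)\<close>.

  Such a \<open>u\<close> exists, supported on the first \<open>3m\<close> columns, as soon as the smallest singular value of that
  \<open>m \<times> 3m\<close> block is bounded below (\<open>small_preimage\<close>); the block fits because \<open>(ln 6)\<^sup>2 \<ge> 3\<close>. The lower bound
  (\<open>smallest_singular_value\<close>) is the probabilistic core. A vector \<open>v\<close> is replaced by a multiple of an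
  integer vector of prescribed l1 norm on which the quadratic form of the block is hardly larger
  (\<open>maurey\<close>, sparsification by sampling, derandomized), and each integer vector is contracted only with
  probability exponentially small in \<open>m\<close>, by small ball bounds for sign sums. If the l1 and l2 norms
  of \<open>v\<close> are comparable up to the factor \<open>\<surd>m\<close>, a net of \<open>(C/\<epsilon>)\<^sup>m\<close> vectors meets failure probabilities
  \<open>(C \<epsilon>)\<close> to the power \<open>3 (5/12) m = (5/4) m\<close>; otherwise a net of \<open>C\<^sup>m\<close> vectors with \<open>C\<close> close to \<open>1\<close> is enough, and a
  failure probability per column bounded away from \<open>1\<close> suffices.

  With \<open>H = w - x\<close>, where \<open>w\<close> is the selector's value, minimality gives \<open>\<parallel>H\<parallel>\<^sub>1 \<le> 2 \<parallel>x\<parallel>\<^sub>1\<close>, and in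
  \<open>\<parallel>\<Phi> H\<parallel>\<^sub>2\<^sup>2 \<le> \<parallel>H\<parallel>\<^sub>1 \<parallel>\<Phi>\<^sup>T \<Phi> H\<parallel>\<^sub>\<infinity>\<close> feasibility bounds the last factor by twice the tolerance. The restricted isometry property, transferred from sparse to arbitrary
  vectors by the same sampling argument (\<open>rip_l1_lower_bound\<close>), bounds \<open>\<parallel>H\<parallel>\<^sub>2\<^sup>2\<close> by
  \<open>2 \<parallel>\<Phi> H\<parallel>\<^sub>2\<^sup>2 + \<parallel>H\<parallel>\<^sub>1\<^sup>2/k\<close> for every \<open>k \<le> s\<close> (\<open>dantzig_error\<close>). What remains is the
  elementary passage from \<open>g'(0) a\<close> to the direction \<open>a\<close> and from directions to ridge functions.
\<close>

section \<open>Sparsification by sampling\<close>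

text \<open>The form \<open>\<parallel>a v\<parallel>\<^sup>2 + b \<parallel>v\<parallel>\<^sup>2\<close>. One parameter \<open>b\<close> of either sign covers the three uses below: \<open>b < 0\<close> turns
  the nonnegativity on sparse vectors that RIP provides, and the contraction of peaked vectors,
  into a sign condition; \<open>b > 0\<close> controls the length of a spread vector together with its image.\<close>

definition quad :: "('j \<Rightarrow> 'i \<Rightarrow> real) \<Rightarrow> 'j set \<Rightarrow> 'i set \<Rightarrow> real \<Rightarrow> ('i \<Rightarrow> real) \<Rightarrow> real" where
  "quad a J I b v = (\<Sum>j\<in>J. (\<Sum>i\<in>I. a j i * v i)\<^sup>2) + b * (\<Sum>i\<in>I. (v i)\<^sup>2)"

lemma weighted_mean_square:
  fixes p y :: "'i \<Rightarrow> real"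
  assumes "(\<Sum>i\<in>I. p i) = 1"
  shows "(\<Sum>i\<in>I. p i * (z + y i)\<^sup>2) = (z + (\<Sum>i\<in>I. p i * y i))\<^sup>2 - (\<Sum>i\<in>I. p i * y i)\<^sup>2 + (\<Sum>i\<in>I. p i * (y i)\<^sup>2)"
proof -
  have "(\<Sum>i\<in>I. p i * (z + y i)\<^sup>2) = (\<Sum>i\<in>I. z\<^sup>2 * p i + 2 * z * (p i * y i) + p i * (y i)\<^sup>2)"
    by (intro sum.cong) (auto simp: power2_eq_square algebra_simps)
  also have "\<dots> = z\<^sup>2 + 2 * z * (\<Sum>i\<in>I. p i * y i) + (\<Sum>i\<in>I. p i * (y i)\<^sup>2)"
    by (simp add: sum.distrib sum_distrib_left[symmetric] assms)
  finally show ?thesis by (simp add: power2_eq_square algebra_simps)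
qed

text \<open>Variance identity: a random vector \<open>Y\<close> with mean \<open>x\<close> satisfies
  \<open>E Q(z + Y) = Q(z + x) + E Q(Y) - Q(x)\<close>. The excess over \<open>Q(z + x)\<close> does not depend on \<open>z\<close>, so the
  excesses of successive samples add up.\<close>

lemma quad_mean:
  assumes "finite I" "(\<Sum>l\<in>L. p l) = 1" and x: "\<And>i. i \<in> I \<Longrightarrow> x i = (\<Sum>l\<in>L. p l * Y l i)"
  shows "(\<Sum>l\<in>L. p l * quad a J I b (\<lambda>i. z i + Y l i)) =
    quad a J I b (\<lambda>i. z i + x i) - quad a J I b x + (\<Sum>l\<in>L. p l * quad a J I b (Y l))"
proof -
  have lin: "(\<Sum>i\<in>I. a j i * x i) = (\<Sum>l\<in>L. p l * (\<Sum>i\<in>I. a j i * Y l i))" for j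
    by (simp add: x sum_distrib_left sum.swap[of _ I] mult.left_commute)
  have 1: "(\<Sum>l\<in>L. p l * (\<Sum>i\<in>I. a j i * (z i + Y l i))\<^sup>2) =
     (\<Sum>i\<in>I. a j i * (z i + x i))\<^sup>2 - (\<Sum>i\<in>I. a j i * x i)\<^sup>2 + (\<Sum>l\<in>L. p l * (\<Sum>i\<in>I. a j i * Y l i)\<^sup>2)" for j
    using weighted_mean_square[OF assms(2), of "\<Sum>i\<in>I. a j i * z i" "\<lambda>l. \<Sum>i\<in>I. a j i * Y l i"]
    by (simp add: ring_distribs sum.distrib lin[symmetric])
  have 2: "(\<Sum>l\<in>L. p l * (z i + Y l i)\<^sup>2) = (z i + x i)\<^sup>2 - (x i)\<^sup>2 + (\<Sum>l\<in>L. p l * (Y l i)\<^sup>2)" if "i \<in> I" for i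
    using weighted_mean_square[OF assms(2), of "z i" "\<lambda>l. Y l i"] x[OF that] by simp
  have "(\<Sum>l\<in>L. p l * quad a J I b (\<lambda>i. z i + Y l i)) =
     (\<Sum>j\<in>J. \<Sum>l\<in>L. p l * (\<Sum>i\<in>I. a j i * (z i + Y l i))\<^sup>2) + b * (\<Sum>i\<in>I. \<Sum>l\<in>L. p l * (z i + Y l i)\<^sup>2)"
    unfolding quad_def ring_distribs sum.distrib sum_distrib_left
    by (subst (1 2) sum.swap[of _ L]) (simp add: mult.left_commute)
  also have "\<dots> = (\<Sum>j\<in>J. (\<Sum>i\<in>I. a j i * (z i + x i))\<^sup>2 - (\<Sum>i\<in>I. a j i * x i)\<^sup>2 + (\<Sum>l\<in>L. p l * (\<Sum>i\<in>I. a j i * Y l i)\<^sup>2))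
     + b * (\<Sum>i\<in>I. (z i + x i)\<^sup>2 - (x i)\<^sup>2 + (\<Sum>l\<in>L. p l * (Y l i)\<^sup>2))"
    by (simp only: 1 2 cong: sum.cong)
  also have "\<dots> = quad a J I b (\<lambda>i. z i + x i) - quad a J I b x + 
     ((\<Sum>j\<in>J. \<Sum>l\<in>L. p l * (\<Sum>i\<in>I. a j i * Y l i)\<^sup>2) + b * (\<Sum>i\<in>I. \<Sum>l\<in>L. p l * (Y l i)\<^sup>2))"
    unfolding quad_def by (simp add: sum.distrib sum_subtractf algebra_simps)
  also have "(\<Sum>j\<in>J. \<Sum>l\<in>L. p l * (\<Sum>i\<in>I. a j i * Y l i)\<^sup>2) + b * (\<Sum>i\<in>I. \<Sum>l\<in>L. p l * (Y l i)\<^sup>2) = (\<Sum>l\<in>L. p l * quad a J I b (Y l))"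
    unfolding quad_def ring_distribs sum.distrib sum_distrib_left
    by (subst (1 2) sum.swap[of _ L]) (simp add: mult.left_commute)
  finally show ?thesis .
qed

lemma quad_scale: "quad a J I b (\<lambda>i. c * v i) = c\<^sup>2 * quad a J I b v"
  by (simp add: quad_def mult.left_commute[of _ c] sum_distrib_left[symmetric] power_mult_distrib ring_distribs)

lemma quad_single:
  assumes "finite I" "l \<in> I"
  shows "quad a J I b (\<lambda>i. if i = l then 1 else 0) = (\<Sum>j\<in>J. (a j l)\<^sup>2) + b"
proof -
  have "(\<Sum>i\<in>I. (if i = l then 1 else 0 :: real)\<^sup>2) = 1"
    using assms by (simp add: if_distrib[of "\<lambda>x. x\<^sup>2"] cong: if_cong)
  then show ?thesis using assms by (simp add: quad_def if_distrib[of "\<lambda>x. _ * x"] cong: if_cong)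
qed

text \<open>Derandomized sampling: the random vector equal to \<open>M sgn(x\<^sub>l) e\<^sub>l\<close> with probability \<open>\<bar>x\<^sub>l\<bar>/M\<close> has mean \<open>x\<close>,
  so in each of \<open>k\<close> steps some outcome does no worse than the average of \<open>quad_mean\<close>. Outcomes
  with \<open>x\<^sub>l = 0\<close> are excluded: since a coordinate only ever receives the sign of \<open>x\<^sub>l\<close>, the samples never
  cancel and the l1 norm of the sum is exactly \<open>k M\<close>.\<close>

lemma greedy_sampling:
  fixes x z :: "'i \<Rightarrow> real"
  assumes I: "finite I" and M: "M = (\<Sum>i\<in>I. \<bar>x i\<bar>)" "M > 0"
    and B: "\<forall>l\<in>I. (\<Sum>j\<in>J. (a j l)\<^sup>2) + b \<le> B"
  shows "\<exists>n::'i \<Rightarrow> nat. (\<forall>i. n i > 0 \<longrightarrow> i \<in> I \<and> x i \<noteq> 0) \<and> (\<Sum>i\<in>I. n i) = k \<and>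
     quad a J I b (\<lambda>i. z i + M * sgn (x i) * real (n i))
       \<le> quad a J I b (\<lambda>i. z i + real k * x i) + real k * (M\<^sup>2 * B - quad a J I b x)"
proof (induction k arbitrary: z)
  case 0
  show ?case by (rule exI[of _ "\<lambda>_. 0"]) auto
next
  case (Suc k)
  let ?Q = "quad a J I b"
  define Y where "Y l = (\<lambda>i. M * sgn (x l) * (if i = l then 1 else 0))" for l
  define z' where "z' = (\<lambda>i. z i + real k * x i)"
  have p: "(\<Sum>l\<in>I. \<bar>x l\<bar> / M) = 1" using M by (simp add: sum_divide_distrib[symmetric])
  have mean: "x i = (\<Sum>l\<in>I. \<bar>x l\<bar> / M * Y l i)" if "i \<in> I" for i
    using that I M by (simp add: Y_def if_distrib[of "\<lambda>x. _ * x"] abs_mult_sgn mult.commute cong: if_cong)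
  have QY: "\<bar>x l\<bar> / M * ?Q (Y l) \<le> \<bar>x l\<bar> / M * (M\<^sup>2 * B)" if "l \<in> I" for l
  proof (cases "x l = 0")
    case False
    then have "(sgn (x l))\<^sup>2 = 1" by (simp add: sgn_if)
    then have "?Q (Y l) = M\<^sup>2 * ((\<Sum>j\<in>J. (a j l)\<^sup>2) + b)"
      unfolding Y_def quad_scale quad_single[OF I that] by (simp add: power_mult_distrib)
    also have "\<dots> \<le> M\<^sup>2 * B" using B that by (intro mult_left_mono) auto
    finally show ?thesis using M(2) by (intro mult_left_mono) auto
  qed simp
  \<comment> \<open>The step is taken last, at \<open>z + k x\<close>; the other \<open>k\<close> samples come from the induction hypothesis at \<open>z + Y\<close>.\<close>
  have "\<exists>l\<in>I. x l \<noteq> 0 \<and> ?Q (\<lambda>i. z' i + Y l i) \<le> ?Q (\<lambda>i. z' i + x i) + (M\<^sup>2 * B - ?Q x)" (is "\<exists>l\<in>I. _ \<and> _ \<le> ?R")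
  proof (rule ccontr)
    assume "\<not> ?thesis"
    then have gt: "?Q (\<lambda>i. z' i + Y l i) > ?R" if "l \<in> I" "x l \<noteq> 0" for l using that by force
    have "\<exists>l\<in>I. x l \<noteq> 0"
    proof (rule ccontr)
      assume "\<not> ?thesis"
      then have "M = 0" using M(1) by simp
      then show False using M(2) by simp
    qed
    then have "(\<Sum>l\<in>I. \<bar>x l\<bar> / M * ?R) < (\<Sum>l\<in>I. \<bar>x l\<bar> / M * ?Q (\<lambda>i. z' i + Y l i))"
    proof (intro sum_strict_mono_ex1 I ballI)
      show "\<bar>x l\<bar> / M * ?R \<le> \<bar>x l\<bar> / M * ?Q (\<lambda>i. z' i + Y l i)" if "l \<in> I" for l
      proof (cases "x l = 0")
        case False
        show ?thesis using gt[OF that False] M(2) by (intro mult_left_mono) auto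
      qed simp
      show "\<exists>l\<in>I. \<bar>x l\<bar> / M * ?R < \<bar>x l\<bar> / M * ?Q (\<lambda>i. z' i + Y l i)"
      proof -
        obtain l where l: "l \<in> I" "x l \<noteq> 0" using \<open>\<exists>l\<in>I. x l \<noteq> 0\<close> by blast
        have "\<bar>x l\<bar> / M * ?R < \<bar>x l\<bar> / M * ?Q (\<lambda>i. z' i + Y l i)"
          using gt[OF l] l M(2) by (intro mult_strict_left_mono) auto
        then show ?thesis using l by (intro bexI[of _ l])
      qed
    qed
    also have "\<dots> = ?Q (\<lambda>i. z' i + x i) - ?Q x + (\<Sum>l\<in>I. \<bar>x l\<bar> / M * ?Q (Y l))"
      using quad_mean[OF I p mean] .
    also have "(\<Sum>l\<in>I. \<bar>x l\<bar> / M * ?Q (Y l)) \<le> (\<Sum>l\<in>I. \<bar>x l\<bar> / M * (M\<^sup>2 * B))"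
      by (rule sum_mono) (rule QY)
    also have "\<dots> = M\<^sup>2 * B" unfolding sum_distrib_right[symmetric] p by simp
    finally show False unfolding sum_distrib_right[symmetric] p by simp
  qed
  then obtain l where l: "l \<in> I" "x l \<noteq> 0" and le: "?Q (\<lambda>i. z' i + Y l i) \<le> ?R" by blast
  from Suc[of "\<lambda>i. z i + Y l i"] obtain n where n: "\<forall>i. n i > 0 \<longrightarrow> i \<in> I \<and> x i \<noteq> 0" "(\<Sum>i\<in>I. n i) = k"
    and Q: "?Q (\<lambda>i. z i + Y l i + M * sgn (x i) * real (n i))
       \<le> ?Q (\<lambda>i. z i + Y l i + real k * x i) + real k * (M\<^sup>2 * B - ?Q x)" by blast
  show ?case
  proof (rule exI[of _ "n(l := n l + 1)"], intro conjI)
    show "\<forall>i. 0 < (n(l := n l + 1)) i \<longrightarrow> i \<in> I \<and> x i \<noteq> 0" using n(1) l by auto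
    have "(\<Sum>i\<in>I. (n(l := n l + 1)) i) = (\<Sum>i\<in>I. n i + (if i = l then 1 else 0))"
      by (intro sum.cong) auto
    then show "(\<Sum>i\<in>I. (n(l := n l + 1)) i) = Suc k"
      using n(2) l I by (simp add: sum.distrib)
    have "(\<lambda>i. z i + M * sgn (x i) * real ((n(l := n l + 1)) i)) = (\<lambda>i. z i + Y l i + M * sgn (x i) * real (n i))"
      by (auto simp: fun_eq_iff Y_def algebra_simps)
    moreover have "(\<lambda>i. z i + Y l i + real k * x i) = (\<lambda>i. z' i + Y l i)"
      and "(\<lambda>i. z' i + x i) = (\<lambda>i. z i + real (Suc k) * x i)"
      by (auto simp: fun_eq_iff z'_def algebra_simps)
    ultimately show "?Q (\<lambda>i. z i + M * sgn (x i) * real ((n(l := n l + 1)) i))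
      \<le> ?Q (\<lambda>i. z i + real (Suc k) * x i) + real (Suc k) * (M\<^sup>2 * B - ?Q x)"
      using Q le by (simp add: algebra_simps)
  qed
qed

text \<open>The normalized form of the sampling lemma: every vector of l1 norm \<open>M\<close> is approximated, as measured by the form,
  by \<open>M/k\<close> times an integer vector of l1 norm exactly \<open>k\<close>, which in particular has at most \<open>k\<close>
  nonzero entries. The price decreases like \<open>1/k\<close>.\<close>

lemma maurey:
  fixes x :: "'i \<Rightarrow> real"
  assumes I: "finite I" and M: "M = (\<Sum>i\<in>I. \<bar>x i\<bar>)" "M > 0" and k: "k > 0"
    and B: "\<forall>l\<in>I. (\<Sum>j\<in>J. (a j l)\<^sup>2) + b \<le> B"
  obtains \<kappa> :: "'i \<Rightarrow> int" where "(\<Sum>i\<in>I. \<bar>\<kappa> i\<bar>) = int k"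
    "quad a J I b (\<lambda>i. M / real k * real_of_int (\<kappa> i)) \<le> quad a J I b x + (M\<^sup>2 * B - quad a J I b x) / real k"
proof -
  from greedy_sampling[OF I M B, where k=k and z="\<lambda>_. 0"] obtain n where n: "\<forall>i. n i > 0 \<longrightarrow> i \<in> I \<and> x i \<noteq> 0" "(\<Sum>i\<in>I. n i) = k"
    and Q: "quad a J I b (\<lambda>i. M * (sgn (x i) * real (n i)))
       \<le> quad a J I b (\<lambda>i. real k * x i) + real k * (M\<^sup>2 * B - quad a J I b x)" by (auto simp: mult.assoc)
  define \<kappa> where "\<kappa> i = (if x i > 0 then int (n i) else - int (n i))" for i
  have \<kappa>: "real_of_int (\<kappa> i) = sgn (x i) * real (n i)" for i
    using n(1) by (cases "n i = 0") (auto simp: \<kappa>_def sgn_if)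
  show ?thesis
  proof (rule that[of \<kappa>])
    have "\<bar>\<kappa> i\<bar> = int (n i)" for i by (simp add: \<kappa>_def)
    then show "(\<Sum>i\<in>I. \<bar>\<kappa> i\<bar>) = int k" using n(2) by (simp flip: of_nat_sum)
    have "quad a J I b (\<lambda>i. M / real k * real_of_int (\<kappa> i)) = (1 / real k)\<^sup>2 * quad a J I b (\<lambda>i. M * (sgn (x i) * real (n i)))"
      by (subst quad_scale[symmetric]) (simp add: \<kappa>)
    also have "\<dots> \<le> (1 / real k)\<^sup>2 * (real k ^ 2 * quad a J I b x + real k * (M\<^sup>2 * B - quad a J I b x))"
      using Q unfolding quad_scale by (intro mult_left_mono) auto
    also have "\<dots> = quad a J I b x + (M\<^sup>2 * B - quad a J I b x) / real k"
      using k by (simp add: field_simps power2_eq_square)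
    finally show "quad a J I b (\<lambda>i. M / real k * real_of_int (\<kappa> i)) \<le> quad a J I b x + (M\<^sup>2 * B - quad a J I b x) / real k" .
  qed
qed

section \<open>The restricted isometry property for vectors that are not sparse\<close>

lemma l2_norm_sq: "(l2_norm v)\<^sup>2 = (\<Sum>i<dim_vec v. (v $ i)\<^sup>2)"
  by (simp add: l2_norm_def L2_set_def sum_nonneg)

lemma rip_mono: "rip s \<delta> \<Phi> \<Longrightarrow> k \<le> s \<Longrightarrow> rip k \<delta> \<Phi>"
  unfolding rip_def using order_trans by blast

lemma mat_vec_norm_sq:
  assumes "\<Phi> \<in> carrier_mat m d" "x \<in> carrier_vec d"
  shows "(l2_norm (\<Phi> *\<^sub>v x))\<^sup>2 = (\<Sum>j<m. (\<Sum>i<d. \<Phi> $$ (j,i) * x $ i)\<^sup>2)"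
  using assms by (auto simp: l2_norm_sq scalar_prod_def atLeast0LessThan intro!: sum.cong)

text \<open>RIP of order \<open>k\<close> controls all vectors up to an l1 term. The form \<open>\<parallel>\<Phi> v\<parallel>\<^sup>2 - (5/6) \<parallel>v\<parallel>\<^sup>2\<close> is nonnegative on
  \<open>k\<close>-sparse vectors; applied to the sparse vector sampled from \<open>x\<close> this gives
  \<open>(k - 1) Q(x) + \<parallel>x\<parallel>\<^sub>1\<^sup>2/3 \<ge> 0\<close>. For \<open>k = 1\<close> this is void, but then \<open>\<parallel>x\<parallel>\<^sub>2 \<le> \<parallel>x\<parallel>\<^sub>1\<close> is all that is claimed.\<close>

lemma rip_l1_lower_bound:
  assumes \<Phi>: "\<Phi> \<in> carrier_mat m d" and rip: "rip k (1/6) \<Phi>" and k: "k > 0" and x: "x \<in> carrier_vec d"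
  shows "(l2_norm x)\<^sup>2 \<le> 2 * (l2_norm (\<Phi> *\<^sub>v x))\<^sup>2 + (l1_norm x)\<^sup>2 / k"
proof -
  let ?M = "l1_norm x"
  let ?q = "quad (\<lambda>j i. \<Phi> $$ (j,i)) {..<m} {..<d} (-5/6)"
  have q: "?q (($) y) = (l2_norm (\<Phi> *\<^sub>v y))\<^sup>2 - 5/6 * (l2_norm y)\<^sup>2" if "y \<in> carrier_vec d" for y
    using mat_vec_norm_sq[OF \<Phi> that] that by (simp add: quad_def l2_norm_sq carrier_vecD)
  have dims: "dim_vec x = d" "dim_col \<Phi> = d" using x \<Phi> by auto
  have M: "?M = (\<Sum>i<d. \<bar>x $ i\<bar>)" by (simp add: l1_norm_def dims)
  have M2: "(l2_norm x)\<^sup>2 \<le> ?M\<^sup>2"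
    unfolding l2_norm_def M dims by (rule power_mono[OF L2_set_le_sum_abs]) simp
  show ?thesis
  proof (cases "k = 1 \<or> ?M = 0")
    case True
    have "?M\<^sup>2 \<le> ?M\<^sup>2 / k" using True by auto
    with M2 show ?thesis by (smt (verit) zero_le_power2)
  next
    case False
    have "?M \<ge> 0" by (simp add: l1_norm_def sum_nonneg)
    with False k have k2: "k \<ge> 2" and Mpos: "?M > 0" by linarith+
    have B: "\<forall>l\<in>{..<d}. (\<Sum>j<m. (\<Phi> $$ (j,l))\<^sup>2) + (-5/6) \<le> 1/3"
    proof
      fix l assume "l \<in> {..<d}"
      then have l: "l < d" by simp
      have "{i. i < d \<and> unit_vec d l $ i \<noteq> (0::real)} = {l}" using l by (auto split: if_splits)
      then have "(l2_norm (\<Phi> *\<^sub>v unit_vec d l))\<^sup>2 \<le> (1 + 1/6) * (l2_norm (unit_vec d l))\<^sup>2"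
        using rip k unfolding rip_def dims by auto
      moreover have "(l2_norm (unit_vec d l))\<^sup>2 = 1"
        using quad_single[of "{..<d}" l "\<lambda>_ _. 0" "{}" 1] l by (simp add: l2_norm_sq quad_def unit_vec_def)
      moreover have "(l2_norm (\<Phi> *\<^sub>v unit_vec d l))\<^sup>2 = (\<Sum>j<m. (\<Phi> $$ (j,l))\<^sup>2)"
        using quad_single[of "{..<d}" l "\<lambda>j i. \<Phi> $$ (j,i)" "{..<m}" 0] l
        by (simp add: mat_vec_norm_sq[OF \<Phi>] quad_def unit_vec_def)
      ultimately show "(\<Sum>j<m. (\<Phi> $$ (j,l))\<^sup>2) + (-5/6) \<le> 1/3" by simp
    qed
    obtain \<kappa> where \<kappa>: "(\<Sum>i<d. \<bar>\<kappa> i\<bar>) = int k"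
      and Q: "?q (\<lambda>i. ?M / real k * real_of_int (\<kappa> i)) \<le> ?q (($) x) + (?M\<^sup>2 * (1/3) - ?q (($) x)) / real k"
      by (rule maurey[OF finite_lessThan M Mpos k B]) (rule that)
    let ?w = "Matrix.vec d (\<lambda>i. ?M / real k * real_of_int (\<kappa> i))"
    have "card {i. i < d \<and> ?w $ i \<noteq> 0} \<le> (\<Sum>i<d. nat \<bar>\<kappa> i\<bar>)"
    proof -
      have "card {i. i < d \<and> ?w $ i \<noteq> 0} = (\<Sum>i\<in>{i. i < d \<and> ?w $ i \<noteq> 0}. 1)" by simp
      also have "\<dots> \<le> (\<Sum>i\<in>{i. i < d \<and> ?w $ i \<noteq> 0}. nat \<bar>\<kappa> i\<bar>)" by (intro sum_mono) auto
      also have "\<dots> \<le> (\<Sum>i<d. nat \<bar>\<kappa> i\<bar>)" by (intro sum_mono2) auto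
      finally show ?thesis .
    qed
    also have "(\<Sum>i<d. nat \<bar>\<kappa> i\<bar>) = k"
    proof -
      have "int (\<Sum>i<d. nat \<bar>\<kappa> i\<bar>) = int k" using \<kappa> by simp
      then show ?thesis by linarith
    qed
    finally have "(1 - 1/6) * (l2_norm ?w)\<^sup>2 \<le> (l2_norm (\<Phi> *\<^sub>v ?w))\<^sup>2"
      using rip unfolding rip_def dims by auto
    then have "0 \<le> ?q (($) ?w)" by (subst q) auto
    also have "?q (($) ?w) = ?q (\<lambda>i. ?M / real k * real_of_int (\<kappa> i))" by (simp add: quad_def)
    finally have "0 \<le> ?q (($) x) + (?M\<^sup>2 * (1/3) - ?q (($) x)) / real k" using Q by linarith
    then have "0 \<le> real k * ?q (($) x) + (?M\<^sup>2 * (1/3) - ?q (($) x))"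
      using k by (simp add: field_simps)
    then have "0 \<le> (real k - 1) * ?q (($) x) + ?M\<^sup>2 / 3" by (simp add: algebra_simps)
    moreover have "?M\<^sup>2 / 3 \<le> (real k - 1) * (2/3 * (?M\<^sup>2 / real k))"
    proof -
      have "real k / 2 * (2/3 * (?M\<^sup>2 / real k)) \<le> (real k - 1) * (2/3 * (?M\<^sup>2 / real k))"
        using k2 by (intro mult_right_mono) auto
      then show ?thesis using k by simp
    qed
    ultimately have "0 \<le> (real k - 1) * (?q (($) x) + 2/3 * (?M\<^sup>2 / real k))"
      unfolding ring_distribs by linarith
    then have "0 \<le> ?q (($) x) + 2/3 * (?M\<^sup>2 / real k)" using k2 by (simp add: zero_le_mult_iff)
    then have "5/6 * (l2_norm x)\<^sup>2 \<le> (l2_norm (\<Phi> *\<^sub>v x))\<^sup>2 + 2/3 * (?M\<^sup>2 / real k)"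
      unfolding q[OF x] by linarith
    moreover have "0 \<le> ?M\<^sup>2 / real k" "0 \<le> (l2_norm (\<Phi> *\<^sub>v x))\<^sup>2" by auto
    ultimately show ?thesis by linarith
  qed
qed

section \<open>Small ball bounds for sign sums\<close>

lemma cosh_le_exp_half_square: "cosh (x::real) \<le> exp (x\<^sup>2 / 2)"
proof -
  have fact_le: "2 ^ n * fact n \<le> (fact (2 * n) :: real)" for n
  proof (induction n)
    case (Suc n)
    have "2 ^ Suc n * fact (Suc n) = (2 * real n + 2) * (2 ^ n * fact n)" by (simp add: algebra_simps)
    also have "\<dots> \<le> (2 * real n + 2) * fact (2 * n)" using Suc by (intro mult_left_mono) auto
    also have "\<dots> \<le> (2 * real n + 2) * ((2 * real n + 1) * fact (2 * n))"
      by (intro mult_left_mono) (auto simp: mult_le_cancel_right1)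
    also have "\<dots> = fact (2 * Suc n)" by (simp add: algebra_simps)
    finally show ?case .
  qed simp
  have "(\<lambda>n. (if even (2 * n) then x ^ (2 * n) /\<^sub>R fact (2 * n) else 0)) sums cosh x"
    using cosh_converges[of x]
    by (subst sums_mono_reindex[where g = "\<lambda>n. 2 * n"]) (auto simp: strict_mono_def)
  then have 1: "(\<lambda>n. x ^ (2 * n) / fact (2 * n)) sums cosh x"
    by (simp only: real_scaleR_def divide_inverse_commute even_mult_iff even_numeral simp_thms if_True)
  have 2: "(\<lambda>n. (x\<^sup>2 / 2) ^ n / fact n) sums exp (x\<^sup>2 / 2)"
    using exp_converges[of "x\<^sup>2 / 2"] by (simp only: real_scaleR_def divide_inverse_commute)
  show ?thesis
  proof (rule sums_le[OF _ 1 2])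
    fix n
    have "x ^ (2 * n) / fact (2 * n) \<le> x ^ (2 * n) / (2 ^ n * fact n)"
      using fact_le by (intro divide_left_mono) auto
    then show "x ^ (2 * n) / fact (2 * n) \<le> (x\<^sup>2 / 2) ^ n / fact n"
      by (simp add: power_mult power_divide)
  qed
qed

text \<open>Averaging a Gaussian bump over the two shifts \<open>\<plusminus>w\<close> produces, up to \<open>cosh u \<le> exp(u\<^sup>2/2)\<close>, a lower bump of
  larger variance \<open>A/(1 - w\<^sup>2/A) \<ge> A + w\<^sup>2\<close>. Iterating over the coordinates of a sign sum replaces
  a Fourier-analytic small ball estimate.\<close>

lemma gaussian_step:
  fixes x w A :: real
  assumes "A > 0" "w\<^sup>2 < A"
  shows "(exp (- (x + w)\<^sup>2 / (2 * A)) + exp (- (x - w)\<^sup>2 / (2 * A))) / 2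
    \<le> exp (- (w\<^sup>2 / A) / 2) * exp (- x\<^sup>2 / (2 * (A / (1 - w\<^sup>2 / A))))"
proof -
  have "(exp (- (x + w)\<^sup>2 / (2 * A)) + exp (- (x - w)\<^sup>2 / (2 * A))) / 2 = exp (- (x\<^sup>2 + w\<^sup>2) / (2 * A)) * cosh (x * w / A)"
    using assms by (simp add: cosh_field_def ring_distribs exp_add[symmetric] power2_eq_square field_simps)
  also have "\<dots> \<le> exp (- (x\<^sup>2 + w\<^sup>2) / (2 * A)) * exp ((x * w / A)\<^sup>2 / 2)"
    by (intro mult_left_mono cosh_le_exp_half_square) auto
  also have "\<dots> = exp (- (w\<^sup>2 / A) / 2) * exp (- x\<^sup>2 / (2 * (A / (1 - w\<^sup>2 / A))))"
    unfolding exp_add[symmetric] using assms by (simp add: field_simps power2_eq_square)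
  finally show ?thesis .
qed

text \<open>The loss of height in one averaging step, expressed through the growth of the variance. The exponent would be
  \<open>1/2\<close> in the limit of small \<open>y\<close>; any exponent above \<open>1/3\<close> serves, because small ball probabilities are
  later raised to the power \<open>3m\<close> and must beat a net of size \<open>(C/\<epsilon>)\<^sup>m\<close>.\<close>

lemma exp_half_le_powr:
  fixes y :: real
  assumes "0 \<le> y" "y \<le> 1/10"
  shows "exp (- y / 2) \<le> (1 - y) powr (5/12)"
proof -
  have "2 * y\<^sup>2 \<le> y / 5" using assms mult_left_mono[of y "1/10" y] by (simp add: power2_eq_square)
  with ln_one_minus_pos_lower_bound[of y] assms have "- y / 2 \<le> 5/12 * ln (1 - y)" by simp
  then show ?thesis using assms by (simp add: powr_def)
qed

definition signs :: "'j set \<Rightarrow> ('j \<Rightarrow> real) pmf" where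
  "signs J = Pi_pmf J 0 (\<lambda>_. pmf_of_set {1, -1})"

lemma nn_integral_signs_insert:
  assumes "finite J" "j \<notin> J" and F: "\<And>r. F r \<ge> 0"
  shows "(\<integral>\<^sup>+s. ennreal (F (\<Sum>i\<in>insert j J. s i * w i)) \<partial>signs (insert j J)) =
     (\<integral>\<^sup>+s. ennreal ((F (w j + (\<Sum>i\<in>J. s i * w i)) + F (- w j + (\<Sum>i\<in>J. s i * w i))) / 2) \<partial>signs J)"
proof -
  let ?S = "\<lambda>s. \<Sum>i\<in>J. s i * w i"
  have "(\<integral>\<^sup>+s. ennreal (F (\<Sum>i\<in>insert j J. s i * w i)) \<partial>signs (insert j J)) =
    (\<integral>\<^sup>+e. \<integral>\<^sup>+s. ennreal (F (e * w j + (\<Sum>i\<in>J. (s(j:=e)) i * w i))) \<partial>signs J \<partial>pmf_of_set {1,-1::real})"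
    unfolding signs_def using assms by (simp add: Pi_pmf_insert nn_integral_pair_pmf')
  also have "\<dots> = (\<integral>\<^sup>+e. \<integral>\<^sup>+s. ennreal (F (e * w j + ?S s)) \<partial>signs J \<partial>pmf_of_set {1,-1::real})"
    using assms by (intro nn_integral_cong arg_cong[of _ _ ennreal] arg_cong[of _ _ F] arg_cong2[of _ _ _ _ "(+)"] sum.cong) auto
  also have "\<dots> = ((\<integral>\<^sup>+s. ennreal (F (w j + ?S s)) \<partial>signs J) + (\<integral>\<^sup>+s. ennreal (F (- w j + ?S s)) \<partial>signs J)) / 2"
    by (subst nn_integral_pmf_of_set) auto
  also have "\<dots> = (\<integral>\<^sup>+s. ennreal (F (w j + ?S s)) + ennreal (F (- w j + ?S s)) \<partial>signs J) / 2"
    by (subst nn_integral_add) auto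
  also have "\<dots> = (\<integral>\<^sup>+s. (ennreal (F (w j + ?S s)) + ennreal (F (- w j + ?S s))) / 2 \<partial>signs J)"
    by (simp add: nn_integral_divide)
  also have "\<dots> = (\<integral>\<^sup>+s. ennreal ((F (w j + ?S s) + F (- w j + ?S s)) / 2) \<partial>signs J)"
    using F by (intro nn_integral_cong) (simp add: ennreal_plus[symmetric] divide_ennreal[symmetric] del: ennreal_plus)
  finally show ?thesis .
qed

text \<open>By induction over the coordinates: each step multiplies the height by at most
  \<open>(1 - y)\<^bsup>5/12\<^esup>\<close> and the variance by \<open>1/(1 - y)\<close>, so the product of the heights telescopes to a power of the ratio
  of the initial to the final variance. The shift \<open>x\<close> is what allows further coordinates to be
  added afterwards.\<close>

lemma small_ball_small_coordinates:
  assumes "finite J" "A > 0" "\<And>j. j \<in> J \<Longrightarrow> (w j)\<^sup>2 \<le> A / 10"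
  shows "(\<integral>\<^sup>+s. ennreal (exp (- (x + (\<Sum>j\<in>J. s j * w j))\<^sup>2 / (2 * A))) \<partial>signs J)
      \<le> ennreal ((A / (A + (\<Sum>j\<in>J. (w j)\<^sup>2))) powr (5/12))"
  using assms
proof (induction J arbitrary: A rule: finite_induct)
  case empty
  have "exp (- x\<^sup>2 / (2 * A)) \<le> 1" using empty by (simp add: divide_nonpos_pos)
  then show ?case using empty by (simp add: signs_def)
next
  case (insert j J)
  define y where "y = (w j)\<^sup>2 / A"
  have y: "0 \<le> y" "y \<le> 1/10" using insert.prems(1) insert.prems(2)[of j] by (auto simp: y_def field_simps)
  define A' where "A' = A / (1 - y)"
  have A': "A' > 0" "A + (w j)\<^sup>2 \<le> A'" 
  proof -
    show "A' > 0" using insert.prems(1) y by (simp add: A'_def)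
    have "(1 + y) * (1 - y) \<le> 1" by (simp add: algebra_simps)
    then have "1 + y \<le> 1 / (1 - y)" using y by (simp add: field_simps)
    then have "A * (1 + y) \<le> A'" using insert.prems(1) mult_left_mono[of "1+y" "1/(1-y)" A] by (simp add: A'_def)
    then show "A + (w j)\<^sup>2 \<le> A'" using insert.prems(1) by (simp add: y_def ring_distribs)
  qed
  let ?S = "\<lambda>s. \<Sum>i\<in>J. s i * w i"
  let ?V = "\<Sum>i\<in>J. (w i)\<^sup>2"
  have V: "?V \<ge> 0" by (simp add: sum_nonneg)
  have wA: "(w j)\<^sup>2 < A" using y insert.prems(1) by (simp add: y_def field_simps)
  have IH: "(\<integral>\<^sup>+s. ennreal (exp (- (x + ?S s)\<^sup>2 / (2 * A'))) \<partial>signs J) \<le> ennreal ((A' / (A' + ?V)) powr (5/12))"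
  proof (rule insert.IH[OF A'(1)])
    fix i assume "i \<in> J"
    then have "(w i)\<^sup>2 \<le> A / 10" using insert.prems(2) by auto
    also have "\<dots> \<le> A' / 10" using A'(2) zero_le_power2[of "w j"] by linarith
    finally show "(w i)\<^sup>2 \<le> A' / 10" .
  qed
  have "(\<integral>\<^sup>+s. ennreal (exp (- (x + (\<Sum>i\<in>insert j J. s i * w i))\<^sup>2 / (2 * A))) \<partial>signs (insert j J)) =
     (\<integral>\<^sup>+s. ennreal ((exp (- ((x + ?S s) + w j)\<^sup>2 / (2 * A)) + exp (- ((x + ?S s) - w j)\<^sup>2 / (2 * A))) / 2) \<partial>signs J)"
    by (subst nn_integral_signs_insert[OF insert.hyps]) (simp_all add: algebra_simps)
  also have "\<dots> \<le> (\<integral>\<^sup>+s. ennreal (exp (- y / 2) * exp (- (x + ?S s)\<^sup>2 / (2 * A'))) \<partial>signs J)"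
    unfolding y_def A'_def
    by (intro nn_integral_mono ennreal_leI gaussian_step[OF insert.prems(1) wA])
  also have "\<dots> = ennreal (exp (- y / 2)) * (\<integral>\<^sup>+s. ennreal (exp (- (x + ?S s)\<^sup>2 / (2 * A'))) \<partial>signs J)"
    by (subst nn_integral_cmult[symmetric]) (auto simp: ennreal_mult)
  also have "\<dots> \<le> ennreal (exp (- y / 2)) * ennreal ((A' / (A' + ?V)) powr (5/12))"
    by (intro mult_left_mono IH) auto
  also have "\<dots> = ennreal (exp (- y / 2) * (A' / (A' + ?V)) powr (5/12))" by (simp add: ennreal_mult)
  also have "\<dots> \<le> ennreal ((A / (A + (\<Sum>j\<in>insert j J. (w j)\<^sup>2))) powr (5/12))"
  proof (rule ennreal_leI)
    have "exp (- y / 2) * (A' / (A' + ?V)) powr (5/12) \<le> (1 - y) powr (5/12) * (A' / (A' + ?V)) powr (5/12)"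
      by (intro mult_right_mono exp_half_le_powr y) auto
    also have "\<dots> = ((1 - y) * (A' / (A' + ?V))) powr (5/12)"
      by (rule powr_mult[symmetric])
    also have "(1 - y) * (A' / (A' + ?V)) = A / (A' + ?V)" using y by (simp add: A'_def)
    also have "(A / (A' + ?V)) powr (5/12) \<le> (A / (A + (\<Sum>j\<in>insert j J. (w j)\<^sup>2))) powr (5/12)"
      using A' V insert.prems(1) insert.hyps
      by (intro powr_mono2 divide_left_mono) (auto intro!: mult_pos_pos add_pos_nonneg add_nonneg_nonneg)
    finally show "exp (- y / 2) * (A' / (A' + ?V)) powr (5/12) \<le> (A / (A + (\<Sum>j\<in>insert j J. (w j)\<^sup>2))) powr (5/12)" .
  qed
  finally show ?case .
qed

text \<open>A bound uniform in the shift survives adding independent summands, by conditioning on them.\<close>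

lemma small_ball_superset:
  assumes "finite J" "finite K" "K \<inter> J = {}" and F: "\<And>r. F r \<ge> 0"
    and bound: "\<And>x. (\<integral>\<^sup>+s. ennreal (F (x + (\<Sum>j\<in>J. s j * w j))) \<partial>signs J) \<le> ennreal q" and q: "q \<ge> 0"
  shows "(\<integral>\<^sup>+s. ennreal (F (x + (\<Sum>j\<in>K \<union> J. s j * w j))) \<partial>signs (K \<union> J)) \<le> ennreal q"
  using assms(2,3)
proof (induction K arbitrary: x rule: finite_induct)
  case empty
  show ?case using bound by simp
next
  case (insert k K)
  let ?S = "\<lambda>s. \<Sum>j\<in>K \<union> J. s j * w j"
  have fin: "finite (K \<union> J)" and k: "k \<notin> K \<union> J" using insert assms(1) by auto
  have IH: "(\<integral>\<^sup>+s. ennreal (F (y + ?S s)) \<partial>signs (K \<union> J)) \<le> ennreal q" for y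
    using insert.IH insert.prems by auto
  have "(\<integral>\<^sup>+s. ennreal (F (x + (\<Sum>j\<in>insert k (K \<union> J). s j * w j))) \<partial>signs (insert k (K \<union> J))) =
     (\<integral>\<^sup>+s. ennreal ((F (x + (w k + ?S s)) + F (x + (- w k + ?S s))) / 2) \<partial>signs (K \<union> J))"
    by (rule nn_integral_signs_insert[OF fin k, where F = "\<lambda>r. F (x + r)"]) (rule F)
  also have "\<dots> = (\<integral>\<^sup>+s. (ennreal (F ((x + w k) + ?S s)) + ennreal (F ((x - w k) + ?S s))) / 2 \<partial>signs (K \<union> J))"
    using F by (intro nn_integral_cong) (simp add: ennreal_plus[symmetric] divide_ennreal[symmetric] algebra_simps del: ennreal_plus)
  also have "\<dots> = ((\<integral>\<^sup>+s. ennreal (F ((x + w k) + ?S s)) \<partial>signs (K \<union> J)) + (\<integral>\<^sup>+s. ennreal (F ((x - w k) + ?S s)) \<partial>signs (K \<union> J))) / 2"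
    by (simp add: nn_integral_divide nn_integral_add)
  also have "\<dots> \<le> (ennreal q + ennreal q) / 2"
    by (intro divide_right_mono_ennreal add_mono IH)
  also have "\<dots> = ennreal q" using q divide_ennreal[of "2 * q" 2] by (simp add: ennreal_plus[symmetric] del: ennreal_plus)
  finally show ?case by simp
qed

lemma small_ball_spread:
  assumes J: "finite J" "J0 \<subseteq> J" and A: "A > 0" and w: "\<And>j. j \<in> J0 \<Longrightarrow> (w j)\<^sup>2 \<le> A / 10"
  shows "(\<integral>\<^sup>+s. ennreal (exp (- (\<Sum>j\<in>J. s j * w j)\<^sup>2 / (2 * A))) \<partial>signs J)
      \<le> ennreal ((A / (A + (\<Sum>j\<in>J0. (w j)\<^sup>2))) powr (5/12))"
proof -
  have J0: "finite J0" using J finite_subset by blast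
  have Un: "(J - J0) \<union> J0 = J" using J by auto
  have "(\<integral>\<^sup>+s. ennreal (exp (- (0 + (\<Sum>j\<in>(J - J0) \<union> J0. s j * w j))\<^sup>2 / (2 * A))) \<partial>signs ((J - J0) \<union> J0))
      \<le> ennreal ((A / (A + (\<Sum>j\<in>J0. (w j)\<^sup>2))) powr (5/12))"
    using J J0 small_ball_small_coordinates[OF J0 A w]
    by (intro small_ball_superset[where F = "\<lambda>r. exp (- r\<^sup>2 / (2 * A))" and J = J0 and K = "J - J0"
          and w = w and q = "(A / (A + (\<Sum>j\<in>J0. (w j)\<^sup>2))) powr (5/12)" and x = 0]) auto
  then show ?thesis unfolding Un by simp
qed

text \<open>A single coordinate with \<open>w\<^sup>2 > A/10\<close> already helps: of the two points \<open>x \<plusminus> w\<close>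
  at least one lies at distance \<open>\<ge> \<bar>w\<bar>\<close> from the origin, so the average is at most
  \<open>(1 + exp(-1/20))/2 \<le> 41/42\<close>.\<close>

lemma small_ball_large_coordinate:
  assumes J: "finite J" "j \<in> J" and A: "A > 0" and w: "(w j)\<^sup>2 > A / 10"
  shows "(\<integral>\<^sup>+s. ennreal (exp (- (\<Sum>j\<in>J. s j * w j)\<^sup>2 / (2 * A))) \<partial>signs J) \<le> ennreal (41/42)"
proof -
  have one: "(\<integral>\<^sup>+s. ennreal (exp (- (x + (\<Sum>j\<in>{j}. s j * w j))\<^sup>2 / (2 * A))) \<partial>signs {j}) \<le> ennreal (41/42)" for x
  proof -
    have e: "exp (- r\<^sup>2 / (2 * A)) \<le> 20/21" if "r\<^sup>2 > A / 10" for r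
    proof -
      have "1 + 1/20 \<le> exp (1/20 :: real)" by (rule exp_ge_add_one_self)
      then have "exp (- 1/20 :: real) \<le> 20/21" by (simp add: exp_minus field_simps)
      moreover have "- r\<^sup>2 / (2 * A) \<le> - 1/20" using that A by (simp add: field_simps)
      ultimately show ?thesis by (meson exp_le_cancel_iff order_trans)
    qed
    have e1: "exp (- r\<^sup>2 / (2 * A)) \<le> 1" for r using A by (simp add: divide_nonpos_pos)
    have "(x + w j)\<^sup>2 > A / 10 \<or> (x - w j)\<^sup>2 > A / 10"
    proof (rule ccontr)
      assume "\<not> ?thesis"
      then have "(x + w j)\<^sup>2 + (x - w j)\<^sup>2 \<le> 2 * (A / 10)" by linarith
      moreover have "(x + w j)\<^sup>2 + (x - w j)\<^sup>2 = 2 * x\<^sup>2 + 2 * (w j)\<^sup>2" by (simp add: power2_eq_square algebra_simps)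
      ultimately show False using w zero_le_power2[of x] by linarith
    qed
    then have "(exp (- (x + w j)\<^sup>2 / (2 * A)) + exp (- (x - w j)\<^sup>2 / (2 * A))) / 2 \<le> 41/42"
    proof
      assume "A / 10 < (x + w j)\<^sup>2"
      from add_mono[OF e[OF this] e1[of "x - w j"]] show ?thesis by simp
    next
      assume "A / 10 < (x - w j)\<^sup>2"
      from add_mono[OF e1[of "x + w j"] e[OF this]] show ?thesis by simp
    qed
    moreover have "(\<integral>\<^sup>+s. ennreal (exp (- (x + (\<Sum>j\<in>{j}. s j * w j))\<^sup>2 / (2 * A))) \<partial>signs {j}) =
       ennreal ((exp (- (x + w j)\<^sup>2 / (2 * A)) + exp (- (x - w j)\<^sup>2 / (2 * A))) / 2)"
      using nn_integral_signs_insert[of "{}" j "\<lambda>r. exp (- (x + r)\<^sup>2 / (2 * A))" w] by (simp add: signs_def)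
    ultimately show ?thesis by (simp add: ennreal_leI)
  qed
  have Un: "(J - {j}) \<union> {j} = J" using J by auto
  have "(\<integral>\<^sup>+s. ennreal (exp (- (0 + (\<Sum>j\<in>(J - {j}) \<union> {j}. s j * w j))\<^sup>2 / (2 * A))) \<partial>signs ((J - {j}) \<union> {j}))
      \<le> ennreal (41/42)"
    using J one
    by (intro small_ball_superset[where F = "\<lambda>r. exp (- r\<^sup>2 / (2 * A))" and J = "{j}" and K = "J - {j}"
          and w = w and q = "41/42" and x = 0]) simp_all
  then show ?thesis unfolding Un by simp
qed

text \<open>For every vector of length at least \<open>\<surd>A\<close>: either some coordinate is large, or all are small and
  carry enough mass.\<close>

lemma small_ball_any:
  assumes J: "finite J" and A: "A > 0" "A \<le> (\<Sum>j\<in>J. (w j)\<^sup>2)"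
  shows "(\<integral>\<^sup>+s. ennreal (exp (- (\<Sum>j\<in>J. s j * w j)\<^sup>2 / (2 * A))) \<partial>signs J) \<le> ennreal (41/42)"
proof (cases "\<exists>j\<in>J. (w j)\<^sup>2 > A / 10")
  case True
  then obtain j where j: "j \<in> J" "A / 10 < (w j)\<^sup>2" by blast
  show ?thesis by (rule small_ball_large_coordinate[where w = w, OF J j(1) A(1) j(2)])
next
  case False
  then have "(\<integral>\<^sup>+s. ennreal (exp (- (\<Sum>j\<in>J. s j * w j)\<^sup>2 / (2 * A))) \<partial>signs J) \<le> ennreal ((A / (A + (\<Sum>j\<in>J. (w j)\<^sup>2))) powr (5/12))"
    by (intro small_ball_spread[OF J order.refl A(1)]) (auto simp: not_less)
  also have "\<dots> \<le> ennreal ((1/2) powr (5/12))"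
    using A by (intro ennreal_leI powr_mono2) (auto simp: field_simps)
  also have "\<dots> \<le> ennreal (41/42)"
  proof (rule ennreal_leI)
    have "(1/2 :: real) powr (5/12) \<le> (1/2) powr (1/4)" by (intro powr_mono') auto
    also have "\<dots> \<le> ((41/42)^4) powr (1/4)" by (intro powr_mono2) (auto simp: power_divide)
    also have "((41/42 :: real)^4) powr (1/4) = ((41/42) powr real 4) powr (1/4)" by (subst powr_realpow) auto
    also have "\<dots> = 41/42" unfolding powr_powr by simp
    finally show "(1/2 :: real) powr (5/12) \<le> 41/42" .
  qed
  finally show ?thesis .
qed

lemma nn_integral_signs_columns:
  assumes "finite J" "finite I" and F: "\<And>i f g. i \<in> I \<Longrightarrow> (\<And>j. j \<in> J \<Longrightarrow> f j = g j) \<Longrightarrow> F i f = F i g"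
  shows "(\<integral>\<^sup>+X. (\<Prod>i\<in>I. F i (\<lambda>j. X (j, i))) \<partial>signs (J \<times> I)) = (\<Prod>i\<in>I. \<integral>\<^sup>+s. F i s \<partial>signs J)"
  using assms(2,3)
proof (induction I rule: finite_induct)
  case empty
  then show ?case by simp
next
  case (insert i I)
  let ?R = "signs (J \<times> I)" and ?C = "signs (J \<times> {i})"
  have IH: "(\<integral>\<^sup>+X. (\<Prod>i\<in>I. F i (\<lambda>j. X (j, i))) \<partial>?R) = (\<Prod>i\<in>I. \<integral>\<^sup>+s. F i s \<partial>signs J)"
    by (rule insert.IH, rule insert.prems) auto
  have eq: "J \<times> insert i I = (J \<times> {i}) \<union> (J \<times> I)" by auto
  have split: "signs (J \<times> insert i I) = map_pmf (\<lambda>(f,g) x. if x \<in> J \<times> {i} then f x else g x) (pair_pmf ?C ?R)"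
    unfolding signs_def eq using assms(1) insert.hyps by (intro Pi_pmf_union) auto
  have "(\<integral>\<^sup>+X. (\<Prod>i'\<in>insert i I. F i' (\<lambda>j. X (j, i'))) \<partial>signs (J \<times> insert i I)) =
     (\<integral>\<^sup>+f. \<integral>\<^sup>+g. F i (\<lambda>j. f (j, i)) * (\<Prod>i'\<in>I. F i' (\<lambda>j. g (j, i'))) \<partial>?R \<partial>?C)"
    unfolding split nn_integral_map_pmf nn_integral_pair_pmf'
  proof (intro nn_integral_cong)
    fix f g :: "'a \<times> 'b \<Rightarrow> real"
    let ?h = "\<lambda>x. if x \<in> J \<times> {i} then f x else g x"
    have "F i (\<lambda>j. ?h (j, i)) = F i (\<lambda>j. f (j, i))" by (rule insert.prems) auto
    moreover have "F i' (\<lambda>j. ?h (j, i')) = F i' (\<lambda>j. g (j, i'))" if "i' \<in> I" for i'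
      using that insert.hyps by (intro insert.prems) auto
    ultimately show "(\<Prod>i'\<in>insert i I. F i' (\<lambda>j. (case (f, g) of (f, g) \<Rightarrow> \<lambda>x. if x \<in> J \<times> {i} then f x else g x) (j, i'))) = F i (\<lambda>j. f (j, i)) * (\<Prod>i'\<in>I. F i' (\<lambda>j. g (j, i')))"
      using insert.hyps by simp
  qed
  also have "\<dots> = (\<integral>\<^sup>+f. F i (\<lambda>j. f (j, i)) \<partial>?C) * (\<Prod>i'\<in>I. \<integral>\<^sup>+s. F i' s \<partial>signs J)"
    by (simp add: nn_integral_cmult nn_integral_multc IH)
  also have "(\<integral>\<^sup>+f. F i (\<lambda>j. f (j, i)) \<partial>?C) = (\<integral>\<^sup>+s. F i s \<partial>signs J)"
  proof -
    have "signs J = map_pmf (\<lambda>g. g \<circ> (\<lambda>j. (j, i))) (signs (J \<times> {i}))"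
      unfolding signs_def using assms(1) by (intro Pi_pmf_bij_betw) (auto simp: bij_betw_def inj_on_def)
    then show ?thesis by (simp add: comp_def)
  qed
  finally show ?case using insert.hyps by simp
qed

section \<open>Nets of integer vectors\<close>

text \<open>Extensional functions make the net finite and let sums over it factor into
  products over coordinates.\<close>

definition l1_sphere :: "'i set \<Rightarrow> nat \<Rightarrow> ('i \<Rightarrow> int) set" where
  "l1_sphere I k = {\<kappa> \<in> PiE I (\<lambda>_. {- int k..int k}). (\<Sum>i\<in>I. \<bar>\<kappa> i\<bar>) = int k}"

lemma finite_l1_sphere: "finite I \<Longrightarrow> finite (l1_sphere I k)"
  unfolding l1_sphere_def by (intro finite_subset[OF Collect_restrict] finite_PiE) auto

lemma restrict_in_l1_sphere:
  assumes "finite I" "(\<Sum>i\<in>I. \<bar>\<kappa> i\<bar>) = int k"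
  shows "restrict \<kappa> I \<in> l1_sphere I k"
proof -
  have "\<bar>\<kappa> i\<bar> \<le> int k" if "i \<in> I" for i
    using member_le_sum[of i I "\<lambda>i. \<bar>\<kappa> i\<bar>"] that assms by auto
  then have "\<kappa> i \<in> {- int k..int k}" if "i \<in> I" for i using that by force
  then show ?thesis using assms(2) by (auto simp: l1_sphere_def)
qed

lemma sum_power_abs_le:
  fixes x :: real
  assumes "0 < x" "x < 1"
  shows "(\<Sum>z\<in>{- int k..int k}. x ^ nat \<bar>z\<bar>) \<le> (1 + x) / (1 - x)"
proof -
  have "(\<Sum>z\<in>{- int k..int k}. x ^ nat \<bar>z\<bar>) = (1 + x - 2 * x ^ Suc k) / (1 - x)"
  proof (induction k)
    case 0
    then show ?case using assms by simp
  next
    case (Suc k)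
    have "{- int (Suc k)..int (Suc k)} = insert (- int (Suc k)) (insert (int (Suc k)) {- int k..int k})" by auto
    then have "(\<Sum>z\<in>{- int (Suc k)..int (Suc k)}. x ^ nat \<bar>z\<bar>) = 2 * x ^ Suc k + (\<Sum>z\<in>{- int k..int k}. x ^ nat \<bar>z\<bar>)"
      by (simp add: nat_add_distrib)
    then show ?case unfolding Suc using assms by (simp add: field_simps)
  qed
  also have "\<dots> \<le> (1 + x) / (1 - x)" using assms by (intro divide_right_mono) auto
  finally show ?thesis .
qed

text \<open>Generating function bound: weigh \<open>\<kappa>\<close> by \<open>x\<close> to the power \<open>\<parallel>\<kappa>\<parallel>\<^sub>1\<close> and sum over a box, where the sum factors. Taking
  \<open>x\<close> near \<open>1\<close> is efficient for large \<open>k/m\<close>, a small \<open>x\<close> for small \<open>k/m\<close>; both are used.\<close>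

lemma card_l1_sphere:
  fixes x :: real
  assumes "finite I" "0 < x" "x < 1"
  shows "real (card (l1_sphere I k)) * x ^ k \<le> ((1 + x) / (1 - x)) ^ card I"
proof -
  have "real (card (l1_sphere I k)) * x ^ k = (\<Sum>\<kappa>\<in>l1_sphere I k. x ^ k)" by simp
  also have "\<dots> = (\<Sum>\<kappa>\<in>l1_sphere I k. \<Prod>i\<in>I. x ^ nat \<bar>\<kappa> i\<bar>)"
  proof (rule sum.cong)
    fix \<kappa> assume "\<kappa> \<in> l1_sphere I k"
    then have "int (\<Sum>i\<in>I. nat \<bar>\<kappa> i\<bar>) = int k" by (simp add: l1_sphere_def)
    then have "(\<Sum>i\<in>I. nat \<bar>\<kappa> i\<bar>) = k" by linarith
    then show "x ^ k = (\<Prod>i\<in>I. x ^ nat \<bar>\<kappa> i\<bar>)" by (simp add: power_sum[symmetric])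
  qed simp
  also have "\<dots> \<le> (\<Sum>\<kappa>\<in>PiE I (\<lambda>_. {- int k..int k}). \<Prod>i\<in>I. x ^ nat \<bar>\<kappa> i\<bar>)"
    using assms by (intro sum_mono2 finite_PiE prod_nonneg) (auto simp: l1_sphere_def)
  also have "\<dots> = (\<Prod>i\<in>I. \<Sum>z\<in>{- int k..int k}. x ^ nat \<bar>z\<bar>)"
    using assms(1) by (intro prod_sum_PiE[symmetric]) auto
  also have "\<dots> \<le> (\<Prod>i\<in>I. (1 + x) / (1 - x))"
    using assms by (intro prod_mono conjI sum_nonneg sum_power_abs_le) auto
  finally show ?thesis by simp
qed

text \<open>The exponential moment method: on the event, the product over the columns in \<open>I0\<close> of
  \<open>exp(-S\<^sub>i\<^sup>2/(2A))\<close> is at least \<open>exp(-L/(2A))\<close>, and by independence its mean is at most \<open>q\<close> to the number of columns.\<close>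

lemma chernoff_columns:
  fixes w :: "'j \<Rightarrow> real"
  assumes "finite J" "finite I" "I0 \<subseteq> I" "A > 0" "q \<ge> 0"
    and q: "(\<integral>\<^sup>+s. ennreal (exp (- (\<Sum>j\<in>J. s j * w j)\<^sup>2 / (2 * A))) \<partial>signs J) \<le> ennreal q"
  shows "measure_pmf.prob (signs (J \<times> I)) {X. (\<Sum>i\<in>I0. (\<Sum>j\<in>J. X (j, i) * w j)\<^sup>2) \<le> L}
    \<le> exp (L / (2 * A)) * q ^ card I0"
proof -
  let ?S = "\<lambda>s. \<Sum>j\<in>J. s j * w j"
  let ?E = "{X. (\<Sum>i\<in>I0. (?S (\<lambda>j. X (j, i)))\<^sup>2) \<le> L}"
  define F where "F i s = (if i \<in> I0 then ennreal (exp (- (?S s)\<^sup>2 / (2 * A))) else 1)" for i s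
  have fin0: "finite I0" using assms finite_subset by blast
  have prodF: "(\<Prod>i\<in>I. F i (\<lambda>j. X (j, i))) = ennreal (exp (- (\<Sum>i\<in>I0. (?S (\<lambda>j. X (j, i)))\<^sup>2) / (2 * A)))" for X
  proof -
    have "(\<Prod>i\<in>I. F i (\<lambda>j. X (j, i))) = (\<Prod>i\<in>I0. ennreal (exp (- (?S (\<lambda>j. X (j, i)))\<^sup>2 / (2 * A))))"
      using assms(2,3) by (intro prod.mono_neutral_cong_right) (auto simp: F_def)
    also have "\<dots> = ennreal (\<Prod>i\<in>I0. exp (- (?S (\<lambda>j. X (j, i)))\<^sup>2 / (2 * A)))"
      by (rule prod_ennreal) auto
    also have "(\<Prod>i\<in>I0. exp (- (?S (\<lambda>j. X (j, i)))\<^sup>2 / (2 * A))) = exp (- (\<Sum>i\<in>I0. (?S (\<lambda>j. X (j, i)))\<^sup>2) / (2 * A))"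
      by (simp add: exp_sum[OF fin0, symmetric] sum_negf sum_divide_distrib)
    finally show ?thesis .
  qed
  have "emeasure (signs (J \<times> I)) ?E = (\<integral>\<^sup>+X. indicator ?E X \<partial>signs (J \<times> I))" by simp
  also have "\<dots> \<le> (\<integral>\<^sup>+X. ennreal (exp (L / (2 * A))) * (\<Prod>i\<in>I. F i (\<lambda>j. X (j, i))) \<partial>signs (J \<times> I))"
  proof (rule nn_integral_mono)
    fix X :: "'j \<times> 'a \<Rightarrow> real"
    have "1 \<le> exp (L / (2 * A)) * exp (- (\<Sum>i\<in>I0. (?S (\<lambda>j. X (j, i)))\<^sup>2) / (2 * A))" if "X \<in> ?E"
      unfolding exp_add[symmetric] add_divide_distrib[symmetric] using that assms(4) by simp
    then show "indicator ?E X \<le> ennreal (exp (L / (2 * A))) * (\<Prod>i\<in>I. F i (\<lambda>j. X (j, i)))"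
      unfolding prodF by (auto simp: indicator_def ennreal_mult[symmetric] simp flip: ennreal_1 intro!: ennreal_leI)
  qed
  also have "\<dots> = ennreal (exp (L / (2 * A))) * (\<Prod>i\<in>I. \<integral>\<^sup>+s. F i s \<partial>signs J)"
  proof -
    have F: "F i f = F i g" if "\<And>j. j \<in> J \<Longrightarrow> f j = g j" for i f g
      unfolding F_def using that by (simp cong: sum.cong)
    show ?thesis by (subst nn_integral_signs_columns[OF assms(1,2), of F, symmetric]) (rule F, assumption, simp add: nn_integral_cmult)
  qed
  also have "(\<Prod>i\<in>I. \<integral>\<^sup>+s. F i s \<partial>signs J) = (\<Prod>i\<in>I0. \<integral>\<^sup>+s. ennreal (exp (- (?S s)\<^sup>2 / (2 * A))) \<partial>signs J)"
    using assms(2,3) by (intro prod.mono_neutral_cong_right) (auto simp: F_def)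
  also have "\<dots> \<le> ennreal q ^ card I0"
    using power_mono[OF q, of "card I0"] by simp
  also have "ennreal (exp (L / (2 * A))) * ennreal q ^ card I0 = ennreal (exp (L / (2 * A)) * q ^ card I0)"
    using assms(5) by (simp add: ennreal_power ennreal_mult)
  finally have "emeasure (signs (J \<times> I)) ?E \<le> ennreal (exp (L / (2 * A)) * q ^ card I0)"
    by (simp add: mult_left_mono)
  then show ?thesis using assms(5) by (simp add: measure_pmf.emeasure_eq_measure)
qed

lemma prob_union_le:
  assumes "finite N" "\<And>\<kappa>. \<kappa> \<in> N \<Longrightarrow> measure_pmf.prob p (E \<kappa>) \<le> b"
  shows "measure_pmf.prob p (\<Union>\<kappa>\<in>N. E \<kappa>) \<le> real (card N) * b"
proof -
  have "measure_pmf.prob p (\<Union>\<kappa>\<in>N. E \<kappa>) \<le> (\<Sum>\<kappa>\<in>N. measure_pmf.prob p (E \<kappa>))"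
    by (intro measure_pmf.finite_measure_subadditive_finite assms(1)) auto
  also have "\<dots> \<le> (\<Sum>\<kappa>\<in>N. b)" by (intro sum_mono assms(2))
  finally show ?thesis by simp
qed

lemma signs_support:
  assumes "finite J" "X \<in> set_pmf (signs J)" "j \<in> J"
  shows "X j = 1 \<or> X j = -1"
proof -
  have "X j \<in> set_pmf (pmf_of_set {1, -1::real})"
    using assms unfolding signs_def by (auto simp: set_Pi_pmf PiE_dflt_def)
  then show ?thesis by simp
qed

text \<open>Squared length of the image of \<open>v\<close> under the transpose of the \<open>m \<times> 3m\<close> block of signs.\<close>

definition energy :: "nat \<Rightarrow> (nat \<times> nat \<Rightarrow> real) \<Rightarrow> (nat \<Rightarrow> real) \<Rightarrow> real" where
  "energy m X v = (\<Sum>i<3*m. (\<Sum>j<m. X (j, i) * v j)\<^sup>2)"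

lemma energy_scale: "energy m X (\<lambda>j. c * v j) = c\<^sup>2 * energy m X v"
  by (simp add: energy_def mult.left_commute[of _ c] sum_distrib_left[symmetric] power_mult_distrib)

text \<open>Sampling for the sign block. The normalization \<open>\<parallel>v\<parallel>\<^sub>1 = \<surd>m\<close> makes the l2 norm at least \<open>1\<close>,
  with equality for flat vectors.\<close>

lemma maurey_energy:
  fixes v :: "nat \<Rightarrow> real"
  assumes X: "\<forall>j<m. \<forall>i<3*m. X (j, i) = 1 \<or> X (j, i) = -1"
    and v: "(\<Sum>j<m. \<bar>v j\<bar>) = sqrt m" and m: "m > 0" and k: "k > 0"
  obtains \<kappa> where "\<kappa> \<in> l1_sphere {..<m} k"
    "energy m X (\<lambda>j. sqrt m / k * of_int (\<kappa> j)) + b * (\<Sum>j<m. (sqrt m / k * of_int (\<kappa> j))\<^sup>2)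
      \<le> (1 - 1 / k) * (energy m X v + b * (\<Sum>j<m. (v j)\<^sup>2)) + m * (3 * m + b) / k"
proof -
  have Q: "quad (\<lambda>i j. X (j, i)) {..<3*m} {..<m} b u = energy m X u + b * (\<Sum>j<m. (u j)\<^sup>2)" for u
    by (simp add: quad_def energy_def)
  have B: "\<forall>j\<in>{..<m}. (\<Sum>i<3*m. (X (j, i))\<^sup>2) + b \<le> 3 * m + b"
  proof
    fix j assume "j \<in> {..<m}"
    then have "(\<Sum>i<3*m. (X (j, i))\<^sup>2) = (\<Sum>i<3*m. 1)"
      using X by (intro sum.cong) (auto simp: power2_eq_1_iff)
    then show "(\<Sum>i<3*m. (X (j, i))\<^sup>2) + b \<le> 3 * m + b" by simp
  qed
  have sq: "(sqrt (real m))\<^sup>2 = real m" by simp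
  obtain \<kappa> where \<kappa>: "(\<Sum>j<m. \<bar>\<kappa> j\<bar>) = int k"
    and le: "quad (\<lambda>i j. X (j, i)) {..<3*m} {..<m} b (\<lambda>j. sqrt m / real k * real_of_int (\<kappa> j))
      \<le> quad (\<lambda>i j. X (j, i)) {..<3*m} {..<m} b v + ((sqrt m)\<^sup>2 * (3 * m + b) - quad (\<lambda>i j. X (j, i)) {..<3*m} {..<m} b v) / real k"
    by (rule maurey[OF finite_lessThan v[symmetric] _ k B]) (use m in simp, rule that)
  show ?thesis
  proof (rule that[of "restrict \<kappa> {..<m}"], goal_cases)
    case 1
    show ?case by (rule restrict_in_l1_sphere[OF finite_lessThan \<kappa>])
  next
    case 2
    have 1: "energy m X (\<lambda>j. sqrt m / k * of_int (restrict \<kappa> {..<m} j)) = energy m X (\<lambda>j. sqrt m / k * of_int (\<kappa> j))"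
      by (simp add: energy_def)
    have 2: "(\<Sum>j<m. (sqrt m / k * of_int (restrict \<kappa> {..<m} j))\<^sup>2) = (\<Sum>j<m. (sqrt m / k * of_int (\<kappa> j))\<^sup>2)"
      by simp
    have 3: "E + (C - E) / k = (1 - 1 / k) * E + C / k" for E C :: real
      by (simp add: algebra_simps diff_divide_distrib)
    show ?case
      using le[unfolded Q sq 3] unfolding 1 2 by simp
  qed
qed

text \<open>Union bound over a net of integer vectors. The threshold of \<open>\<kappa>\<close> is a fixed multiple \<open>l\<close> of the variance parameter
  \<open>A \<kappa>\<close> of its small ball bound, so all vectors pay the same factor \<open>exp(l/2)\<close>.\<close>

lemma prob_net_le:
  fixes N :: "(nat \<Rightarrow> int) set"
  assumes N: "N \<subseteq> l1_sphere {..<m} k" and d: "3 * m \<le> d" and x: "0 < x" "x < 1" and q: "q \<ge> 0"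
    and A: "\<And>\<kappa>. \<kappa> \<in> N \<Longrightarrow> A \<kappa> > 0"
    and small: "\<And>\<kappa>. \<kappa> \<in> N \<Longrightarrow>
       (\<integral>\<^sup>+s. ennreal (exp (- (\<Sum>j<m. s j * (c * of_int (\<kappa> j)))\<^sup>2 / (2 * A \<kappa>))) \<partial>signs {..<m}) \<le> ennreal q"
  shows "measure_pmf.prob (signs ({..<m} \<times> {..<d})) {X. \<exists>\<kappa>\<in>N. energy m X (\<lambda>j. c * of_int (\<kappa> j)) \<le> l * A \<kappa>}
    \<le> ((1 + x) / (1 - x) * exp (l / (2 * m)) * q ^ 3) ^ m / x ^ k"
proof (cases "m = 0")
  case True
  then have "exp (l / (2 * real m)) = 1" by simp
  show ?thesis
  proof -
    have "measure_pmf.prob (signs ({..<m} \<times> {..<d})) {X. \<exists>\<kappa>\<in>N. energy m X (\<lambda>j. c * of_int (\<kappa> j)) \<le> l * A \<kappa>} \<le> 1" by simp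
    also have "1 \<le> 1 / x ^ k" using x by (simp add: power_le_one)
    finally show ?thesis using True by simp
  qed
next
  case False
  let ?p = "signs ({..<m} \<times> {..<d})"
  have fin: "finite N" by (rule finite_subset[OF N finite_l1_sphere]) simp
  have "{X. \<exists>\<kappa>\<in>N. energy m X (\<lambda>j. c * of_int (\<kappa> j)) \<le> l * A \<kappa>} = (\<Union>\<kappa>\<in>N. {X. energy m X (\<lambda>j. c * of_int (\<kappa> j)) \<le> l * A \<kappa>})" by auto
  also have "measure_pmf.prob ?p \<dots> \<le> real (card N) * (exp (l / 2) * q ^ (3 * m))"
  proof (rule prob_union_le[OF fin])
    fix \<kappa> assume \<kappa>: "\<kappa> \<in> N"
    have "measure_pmf.prob ?p {X. energy m X (\<lambda>j. c * of_int (\<kappa> j)) \<le> l * A \<kappa>} \<le> exp (l * A \<kappa> / (2 * A \<kappa>)) * q ^ card {..<3*m}"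
      unfolding energy_def using d by (intro chernoff_columns[OF _ _ _ A[OF \<kappa>] q small[OF \<kappa>]]) auto
    then show "measure_pmf.prob ?p {X. energy m X (\<lambda>j. c * of_int (\<kappa> j)) \<le> l * A \<kappa>} \<le> exp (l / 2) * q ^ (3 * m)"
      using A[OF \<kappa>] by simp
  qed
  also have "\<dots> \<le> real (card (l1_sphere {..<m} k)) * (exp (l / 2) * q ^ (3 * m))"
    using q by (intro mult_right_mono) (auto intro!: card_mono finite_l1_sphere N)
  also have "\<dots> \<le> ((1 + x) / (1 - x)) ^ m / x ^ k * (exp (l / 2) * q ^ (3 * m))"
    using card_l1_sphere[of "{..<m}" x k] x q by (intro mult_right_mono) (auto simp: field_simps)
  also have "\<dots> = ((1 + x) / (1 - x) * exp (l / (2 * m)) * q ^ 3) ^ m / x ^ k"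
  proof -
    have "exp (l / (2 * m)) ^ m = exp (l / 2)" using False by (simp add: exp_of_nat_mult[symmetric])
    moreover have "Z ^ m / x ^ k * (E ^ m * q ^ (3 * m)) = (Z * E * q ^ 3) ^ m / x ^ k" for Z E
      by (simp add: power_mult_distrib power_mult)
    ultimately show ?thesis by metis
  qed
  finally show ?thesis .
qed

section \<open>The smallest singular value of a rectangular sign matrix\<close>

text \<open>If the l1 norm is as large as \<open>\<surd>m\<close> while the l2 norm stays bounded, coordinates above a threshold \<open>t\<close> carry l1 mass at
  most \<open>S/t\<close>, so the remaining ones keep half of the l1 norm and, by Cauchy-Schwarz, l2 mass at least \<open>1/4\<close>.\<close>

lemma spread_mass:
  fixes w :: "nat \<Rightarrow> real"
  assumes w: "(\<Sum>j<m. \<bar>w j\<bar>) = sqrt m" "(\<Sum>j<m. (w j)\<^sup>2) \<le> S" and t: "t > 0" "2 * S / t \<le> sqrt m" and m: "m > 0"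
  shows "1/4 \<le> (\<Sum>j\<in>{j. j < m \<and> (w j)\<^sup>2 \<le> t\<^sup>2}. (w j)\<^sup>2)"
proof -
  let ?J = "{j. j < m \<and> (w j)\<^sup>2 \<le> t\<^sup>2}"
  have "(\<Sum>j\<in>{..<m} - ?J. \<bar>w j\<bar>) \<le> (\<Sum>j\<in>{..<m} - ?J. (w j)\<^sup>2 / t)"
  proof (rule sum_mono)
    fix j assume "j \<in> {..<m} - ?J"
    then have "t\<^sup>2 \<le> \<bar>w j\<bar>\<^sup>2" by auto
    then have "t \<le> \<bar>w j\<bar>" by (rule power2_le_imp_le) simp
    then have "\<bar>w j\<bar> * t \<le> \<bar>w j\<bar> * \<bar>w j\<bar>" by (intro mult_left_mono) auto
    then show "\<bar>w j\<bar> \<le> (w j)\<^sup>2 / t" using t by (simp add: field_simps power2_eq_square)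
  qed
  also have "\<dots> \<le> (\<Sum>j<m. (w j)\<^sup>2 / t)" using t by (intro sum_mono2) auto
  also have "\<dots> \<le> S / t" using w(2) t by (simp add: sum_divide_distrib[symmetric] divide_right_mono)
  also have "\<dots> = (2 * S / t) / 2" by simp
  also have "\<dots> \<le> sqrt m / 2" by (intro divide_right_mono t(2)) simp
  finally have out: "(\<Sum>j\<in>{..<m} - ?J. \<bar>w j\<bar>) \<le> sqrt m / 2" .
  have "(\<Sum>j<m. \<bar>w j\<bar>) = (\<Sum>j\<in>{..<m} - ?J. \<bar>w j\<bar>) + (\<Sum>j\<in>?J. \<bar>w j\<bar>)"
    by (intro sum.subset_diff) auto
  then have "sqrt m / 2 \<le> (\<Sum>j\<in>?J. \<bar>w j\<bar>)" using out w(1) by linarith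
  then have "(sqrt m / 2)\<^sup>2 \<le> (\<Sum>j\<in>?J. \<bar>w j\<bar> * 1)\<^sup>2" by (intro power_mono) auto
  also have "\<dots> \<le> (\<Sum>j\<in>?J. \<bar>w j\<bar>\<^sup>2) * (\<Sum>j\<in>?J. 1\<^sup>2)" by (rule Cauchy_Schwarz_ineq_sum)
  also have "\<dots> \<le> (\<Sum>j\<in>?J. (w j)\<^sup>2) * m"
  proof -
    have "card ?J \<le> card {..<m}" by (intro card_mono) auto
    then show ?thesis by (simp add: mult_left_mono sum_nonneg)
  qed
  finally show ?thesis using m by (simp add: power_divide field_simps)
qed

text \<open>Spread vectors: sampling with \<open>k \<approx> m/\<epsilon>\<close> keeps the length bounded and the image at most \<open>6 \<epsilon> m\<close>, if the
  image of \<open>v\<close> was at most \<open>\<epsilon> m\<close>. The sampled vector still has l1 norm \<open>\<surd>m\<close>, so by \<open>spread_mass\<close> its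
  small ball probability at variance \<open>\<epsilon>\<close> is at most \<open>(4 \<epsilon>)\<^bsup>5/12\<^esup>\<close> per column. With \<open>3m\<close> columns this contributes
  \<open>(4 \<epsilon>)\<^bsup>(5/4) m\<^esup>\<close>, against at most \<open>(4 e\<^sup>2/\<epsilon>)\<^sup>m\<close> net vectors and a factor \<open>e\<^bsup>3m\<^esup>\<close> from the moment
  method: a positive power of \<open>\<epsilon>\<close> is left over.\<close>

lemma spread_vectors_not_contracted:
  assumes D: "D \<ge> 1"
  shows "\<exists>\<epsilon>>0. \<exists>m0. \<forall>m\<ge>m0. \<forall>d\<ge>3*m. 
    measure_pmf.prob (signs ({..<m} \<times> {..<d}))
      {X. (\<forall>j<m. \<forall>i<d. X (j, i) = 1 \<or> X (j, i) = -1) \<and> 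
        (\<exists>v. (\<Sum>j<m. \<bar>v j\<bar>) = sqrt m \<and> (\<Sum>j<m. (v j)\<^sup>2) \<le> D \<and> energy m X v \<le> \<epsilon> * m)} \<le> (1/2) ^ m"
proof -
  \<comment> \<open>With \<open>\<epsilon> = \<eta>\<^sup>4\<close> the total is \<open>(32 e\<^sup>5 \<eta>)\<^sup>m\<close>, and this \<open>\<eta>\<close> makes its base \<open>1/2\<close>.\<close>
  define \<eta> :: real where "\<eta> = 1 / (64 * exp 5)"
  define \<epsilon> where "\<epsilon> = \<eta> ^ 4"
  define q where "q = (4 * \<epsilon>) powr (5/12)"
  \<comment> \<open>Makes \<open>x\<close> to the power \<open>-k\<close> at most \<open>e\<^bsup>2m\<^esup>\<close>, since \<open>k \<le> 2m/\<epsilon>\<close>.\<close>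
  define x where "x = exp (- \<epsilon>)"
  have "exp 5 \<ge> (1::real)" by simp
  then have "64 * exp 5 \<ge> (1::real)" by linarith
  then have \<eta>: "\<eta> > 0" "\<eta> \<le> 1" by (auto simp: \<eta>_def)
  then have \<epsilon>: "\<epsilon> > 0" "\<epsilon> \<le> 1" by (auto simp: \<epsilon>_def power_le_one)
  have q0: "q \<ge> 0" by (simp add: q_def)
  have q3: "q ^ 3 \<le> 8 * \<eta> ^ 5"
  proof -
    have "q ^ 3 = q powr real 3" using \<epsilon> by (intro powr_realpow[symmetric]) (simp add: q_def)
    also have "\<dots> = (4 * \<epsilon>) powr (5/4)" unfolding q_def powr_powr by simp
    also have "\<epsilon> = \<eta> powr real 4" unfolding \<epsilon>_def using \<eta> by (intro powr_realpow[symmetric])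
    also have "(4 * \<eta> powr real 4) powr (5/4) = 4 powr (5/4) * (\<eta> powr real 4) powr (5/4)"
      by (rule powr_mult)
    also have "(\<eta> powr real 4) powr (5/4) = \<eta> powr real 5" unfolding powr_powr by simp
    also have "\<dots> = \<eta> ^ 5" using \<eta> by (rule_tac powr_realpow) simp
    also have "(4::real) powr (5/4) \<le> 4 powr (3/2)" by (intro powr_mono) auto
    also have "(4::real) powr (3/2) = (2 powr 2) powr (3/2)" by simp
    also have "\<dots> = 2 powr real 3" unfolding powr_powr by simp
    also have "\<dots> = 8" by (subst powr_realpow) auto
    finally show ?thesis using \<eta> by simp
  qed
  have x: "0 < x" "x < 1" using \<epsilon> by (auto simp: x_def)
  have x2: "(1 + x) / (1 - x) \<le> 4 / \<epsilon>"
  proof -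
    have "1 + \<epsilon> \<le> exp \<epsilon>" by (rule exp_ge_add_one_self)
    then have "x \<le> 1 / (1 + \<epsilon>)" using \<epsilon> by (simp add: x_def exp_minus divide_inverse le_imp_inverse_le)
    also have "\<dots> \<le> 1 - \<epsilon> / 2"
    proof -
      have "\<epsilon> * \<epsilon> \<le> \<epsilon> * 1" using \<epsilon> by (intro mult_left_mono) auto
      then show ?thesis using \<epsilon> by (simp add: field_simps)
    qed
    finally have "\<epsilon> / 2 \<le> 1 - x" by simp
    then have "(1 + x) / (1 - x) \<le> 2 / (\<epsilon> / 2)" using x \<epsilon> by (intro frac_le) auto
    then show ?thesis by simp
  qed
  define t where "t = sqrt (\<epsilon> / 10)"
  have t: "t > 0" "t\<^sup>2 = \<epsilon> / 10" using \<epsilon> by (auto simp: t_def)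
  define m0 where "m0 = nat \<lceil>(12 * D / t)\<^sup>2\<rceil> + 1"
  show ?thesis
  proof (rule exI[of _ \<epsilon>], intro conjI exI[of _ m0] allI impI)
    show "\<epsilon> > 0" by (fact \<epsilon>)
    fix m d assume m: "m0 \<le> m" and d: "3 * m \<le> d"
    have mpos: "m > 0" using m by (simp add: m0_def)
    have msq: "12 * D / t \<le> sqrt m"
    proof (rule real_le_rsqrt)
      show "(12 * D / t)\<^sup>2 \<le> real m" using m unfolding m0_def by linarith
    qed
    define k where "k = nat \<lceil>m / \<epsilon>\<rceil>"
    have me: "1 \<le> m / \<epsilon>" using mpos \<epsilon> by (simp add: field_simps)
    have k: "m / \<epsilon> \<le> k" "k \<le> 2 * (m / \<epsilon>)" "k > 0"
      using me unfolding k_def by linarith+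
    define c where "c = sqrt m / k"
    define N where "N = {\<kappa> \<in> l1_sphere {..<m} k. (\<Sum>j<m. (c * of_int (\<kappa> j))\<^sup>2) \<le> 6 * D}"
    let ?p = "signs ({..<m} \<times> {..<d})"
    let ?E = "{X. (\<forall>j<m. \<forall>i<d. X (j, i) = 1 \<or> X (j, i) = -1) \<and> 
        (\<exists>v. (\<Sum>j<m. \<bar>v j\<bar>) = sqrt m \<and> (\<Sum>j<m. (v j)\<^sup>2) \<le> D \<and> energy m X v \<le> \<epsilon> * m)}"
    have "?E \<subseteq> {X. \<exists>\<kappa>\<in>N. energy m X (\<lambda>j. c * of_int (\<kappa> j)) \<le> (6 * m) * \<epsilon>}"
    proof safe
      fix X v assume X: "\<forall>j<m. \<forall>i<d. X (j, i) = 1 \<or> X (j, i) = -1"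
        and v: "(\<Sum>j<m. \<bar>v j\<bar>) = sqrt m" "(\<Sum>j<m. (v j)\<^sup>2) \<le> D" "energy m X v \<le> \<epsilon> * m"
      have X': "\<forall>j<m. \<forall>i<3*m. X (j, i) = 1 \<or> X (j, i) = -1" using X d by auto
      \<comment> \<open>With this weight \<open>b \<parallel>v\<parallel>\<^sup>2 \<le> \<epsilon> m\<close>, so one inequality for the form bounds the image and the length.\<close>
      define b where "b = \<epsilon> * m / D"
      have b: "b > 0" "b \<le> m"
        using \<epsilon> mpos D mult_mono[of \<epsilon> 1 "real m" "real m"] mult_mono[of m m 1 D] by (auto simp: b_def field_simps)
      obtain \<kappa> where \<kappa>: "\<kappa> \<in> l1_sphere {..<m} k"
        and le: "energy m X (\<lambda>j. sqrt m / k * of_int (\<kappa> j)) + b * (\<Sum>j<m. (sqrt m / k * of_int (\<kappa> j))\<^sup>2)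
          \<le> (1 - 1 / k) * (energy m X v + b * (\<Sum>j<m. (v j)\<^sup>2)) + m * (3 * real m + b) / k"
        by (rule maurey_energy[where b = b and X = X and v = v and m = m and k = k, OF X' v(1) mpos k(3)]) (rule that)
      let ?W = "\<Sum>j<m. (c * of_int (\<kappa> j))\<^sup>2"
      have e0: "energy m X u \<ge> 0" for u by (simp add: energy_def sum_nonneg)
      have "b * (\<Sum>j<m. (v j)\<^sup>2) \<le> b * D" using v b by (intro mult_left_mono) auto
      also have "\<dots> = \<epsilon> * m" using D by (simp add: b_def)
      finally have 1: "energy m X v + b * (\<Sum>j<m. (v j)\<^sup>2) \<le> 2 * \<epsilon> * m" using v by simp
      have 0: "0 \<le> energy m X v + b * (\<Sum>j<m. (v j)\<^sup>2)" using e0 b by (simp add: sum_nonneg)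
      have shrink: "(1 - 1 / k) * (energy m X v + b * (\<Sum>j<m. (v j)\<^sup>2)) \<le> 1 * (energy m X v + b * (\<Sum>j<m. (v j)\<^sup>2))"
        using 0 by (intro mult_right_mono) auto
      have "m * (3 * real m + b) / k \<le> m * (4 * m) / (m / \<epsilon>)"
        using b k \<epsilon> mpos by (intro frac_le mult_left_mono) auto
      then have var: "m * (3 * real m + b) / k \<le> 4 * \<epsilon> * m" using mpos by (simp add: field_simps)
      have arith: "x \<le> 1 * E + 4 * e * n \<Longrightarrow> E \<le> 2 * e * n \<Longrightarrow> x \<le> 6 * e * n" for x E e n :: real
        by linarith
      have tot: "energy m X (\<lambda>j. c * of_int (\<kappa> j)) + b * ?W \<le> 6 * \<epsilon> * m"
        unfolding c_def by (rule arith[OF order_trans[OF le add_mono[OF shrink var]] 1])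
      have W0: "?W \<ge> 0" by (simp add: sum_nonneg)
      have "b * ?W \<le> 6 * \<epsilon> * m" using tot e0[of "\<lambda>j. c * of_int (\<kappa> j)"] by linarith
      also have "\<dots> = b * (6 * D)" using D by (simp add: b_def)
      finally have "?W \<le> 6 * D" using b by simp
      moreover have "energy m X (\<lambda>j. c * of_int (\<kappa> j)) + 0 \<le> energy m X (\<lambda>j. c * of_int (\<kappa> j)) + b * ?W"
        using W0 b(1) by (intro add_left_mono mult_nonneg_nonneg) auto
      from order_trans[OF this tot] have "energy m X (\<lambda>j. c * of_int (\<kappa> j)) \<le> 6 * m * \<epsilon>" by (simp add: mult_ac)
      ultimately show "\<exists>\<kappa>\<in>N. energy m X (\<lambda>j. c * of_int (\<kappa> j)) \<le> (6 * m) * \<epsilon>"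
        using \<kappa> by (auto simp: N_def)
    qed
    then have "measure_pmf.prob ?p ?E \<le> measure_pmf.prob ?p {X. \<exists>\<kappa>\<in>N. energy m X (\<lambda>j. c * of_int (\<kappa> j)) \<le> (6 * m) * \<epsilon>}"
      by (intro measure_pmf.finite_measure_mono) auto
    also have "\<dots> \<le> ((1 + x) / (1 - x) * exp ((6 * m) / (2 * m)) * q ^ 3) ^ m / x ^ k"
    proof (rule prob_net_le[where A = "\<lambda>_. \<epsilon>"])
      show "N \<subseteq> l1_sphere {..<m} k" by (auto simp: N_def)
      fix \<kappa> assume \<kappa>: "\<kappa> \<in> N"
      let ?w = "\<lambda>j. c * real_of_int (\<kappa> j)"
      let ?J = "{j. j < m \<and> (?w j)\<^sup>2 \<le> t\<^sup>2}"
      have "real_of_int (\<Sum>j<m. \<bar>\<kappa> j\<bar>) = real_of_int (int k)" using \<kappa> by (simp add: N_def l1_sphere_def)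
      then have "(\<Sum>j<m. \<bar>?w j\<bar>) = c * k"
        using k mpos by (simp add: abs_mult c_def sum_distrib_left[symmetric] sum_divide_distrib[symmetric])
      then have l1: "(\<Sum>j<m. \<bar>?w j\<bar>) = sqrt m" using k by (simp add: c_def)
      have mass: "1/4 \<le> (\<Sum>j\<in>?J. (?w j)\<^sup>2)"
        using \<kappa> msq by (intro spread_mass[OF l1 _ t(1) _ mpos, where S = "6 * D"]) (auto simp: N_def)
      have "(\<integral>\<^sup>+s. ennreal (exp (- (\<Sum>j<m. s j * ?w j)\<^sup>2 / (2 * \<epsilon>))) \<partial>signs {..<m})
        \<le> ennreal ((\<epsilon> / (\<epsilon> + (\<Sum>j\<in>?J. (?w j)\<^sup>2))) powr (5/12))"
        using small_ball_spread[of "{..<m}" ?J \<epsilon> ?w, OF finite_lessThan _ \<epsilon>(1)] unfolding t(2) by auto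
      also have "\<dots> \<le> ennreal q"
      proof (unfold q_def, intro ennreal_leI powr_mono2)
        have "\<epsilon> / (\<epsilon> + (\<Sum>j\<in>?J. (?w j)\<^sup>2)) \<le> \<epsilon> / (1/4)" using mass \<epsilon> by (intro divide_left_mono) auto
        then show "\<epsilon> / (\<epsilon> + (\<Sum>j\<in>?J. (?w j)\<^sup>2)) \<le> 4 * \<epsilon>" by simp
        show "0 \<le> \<epsilon> / (\<epsilon> + (\<Sum>j\<in>?J. (?w j)\<^sup>2))" using mass \<epsilon> by (intro divide_nonneg_nonneg) auto
      qed auto
      finally show "(\<integral>\<^sup>+s. ennreal (exp (- (\<Sum>j<m. s j * ?w j)\<^sup>2 / (2 * \<epsilon>))) \<partial>signs {..<m}) \<le> ennreal q" .
    qed (use d x q0 \<epsilon> in auto)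
    also have "\<dots> \<le> (4 / \<epsilon> * exp 3 * (8 * \<eta> ^ 5)) ^ m * exp 2 ^ m"
    proof -
      have "1 / x ^ k = exp (\<epsilon> * k)" by (simp add: x_def exp_minus inverse_eq_divide power_divide exp_of_nat_mult mult.commute flip: exp_of_nat_mult)
      also have "\<dots> \<le> exp (2 * m)"
        using k(2) \<epsilon> by (simp add: field_simps)
      also have "\<dots> = exp 2 ^ m" by (simp add: exp_of_nat_mult[symmetric] mult.commute)
      finally have "1 / x ^ k \<le> exp 2 ^ m" .
      moreover have "((1 + x) / (1 - x) * exp ((6 * m) / (2 * m)) * q ^ 3) ^ m \<le> (4 / \<epsilon> * exp 3 * (8 * \<eta> ^ 5)) ^ m"
        using x2 q3 x \<epsilon> q0 mpos by (intro power_mono mult_mono) auto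
      ultimately have "((1 + x) / (1 - x) * exp ((6 * m) / (2 * m)) * q ^ 3) ^ m * (1 / x ^ k) \<le> (4 / \<epsilon> * exp 3 * (8 * \<eta> ^ 5)) ^ m * exp 2 ^ m"
        using x \<epsilon> \<eta> by (intro mult_mono) auto
      then show ?thesis by simp
    qed
    also have "\<dots> = (1/2) ^ m"
    proof -
      have "4 / \<epsilon> * exp 3 * (8 * \<eta> ^ 5) * exp 2 = 32 * (\<eta> ^ 5 / \<eta> ^ 4) * (exp 3 * exp 2)" by (simp add: \<epsilon>_def)
      also have "\<dots> = 32 * \<eta> * exp 5" using \<eta> by (simp add: exp_add[symmetric] field_simps power_numeral_reduce)
      also have "\<dots> = 1/2" by (simp add: \<eta>_def)
      finally show ?thesis by (simp only: power_mult_distrib[symmetric])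
    qed
    finally show "measure_pmf.prob ?p ?E \<le> (1/2) ^ m" .
  qed
qed

text \<open>Peaked vectors: if \<open>\<parallel>v\<parallel>\<^sub>2\<^sup>2\<close> is a large constant while \<open>\<parallel>v\<parallel>\<^sub>1 = \<surd>m\<close>, the sampling error
  \<open>3m\<^sup>2/k\<close> is already negligible against \<open>m \<parallel>v\<parallel>\<^sub>2\<^sup>2\<close> for \<open>k \<approx> m/2000\<close>. Such integer vectors number only \<open>1.03\<^sup>m\<close>,
  less than \<open>(41/42)\<close> to the power \<open>-3m\<close>. The inequality \<open>\<parallel>A \<kappa>\<parallel>\<^sup>2 \<le> (m/50) \<parallel>\<kappa>\<parallel>\<^sup>2\<close> that is transferred to
  the sampled vector is homogeneous, so its scaling factor drops out.\<close>

lemma peaked_vectors_not_contracted: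
  fixes m d :: nat
  assumes m: "m \<ge> 4000" and d: "d \<ge> 3 * m"
  shows "measure_pmf.prob (signs ({..<m} \<times> {..<d}))
      {X. (\<forall>j<m. \<forall>i<d. X (j, i) = 1 \<or> X (j, i) = -1) \<and> 
        (\<exists>v. (\<Sum>j<m. \<bar>v j\<bar>) = sqrt m \<and> 800000 \<le> (\<Sum>j<m. (v j)\<^sup>2) \<and> energy m X v \<le> m / 200 * (\<Sum>j<m. (v j)\<^sup>2))} \<le> (97/100) ^ m"
proof -
  define k where "k = nat \<lceil>m / 2000\<rceil>"
  have k: "m / 2000 \<le> k" "1000 * k \<le> m" "k \<ge> 2" using m unfolding k_def by linarith+
  define c where "c = sqrt m / k"
  have cpos: "c > 0" using m k by (simp add: c_def)
  let ?p = "signs ({..<m} \<times> {..<d})"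
  let ?E = "{X. (\<forall>j<m. \<forall>i<d. X (j, i) = 1 \<or> X (j, i) = -1) \<and> 
        (\<exists>v. (\<Sum>j<m. \<bar>v j\<bar>) = sqrt m \<and> 800000 \<le> (\<Sum>j<m. (v j)\<^sup>2) \<and> energy m X v \<le> m / 200 * (\<Sum>j<m. (v j)\<^sup>2))}"
  let ?A = "\<lambda>\<kappa>. \<Sum>j<m. (real_of_int (\<kappa> j))\<^sup>2"
  have "?E \<subseteq> {X. \<exists>\<kappa>\<in>l1_sphere {..<m} k. energy m X (\<lambda>j. 1 * of_int (\<kappa> j)) \<le> m / 50 * ?A \<kappa>}"
  proof safe
    fix X v assume X: "\<forall>j<m. \<forall>i<d. X (j, i) = 1 \<or> X (j, i) = -1"
      and v: "(\<Sum>j<m. \<bar>v j\<bar>) = sqrt m" "800000 \<le> (\<Sum>j<m. (v j)\<^sup>2)" "energy m X v \<le> m / 200 * (\<Sum>j<m. (v j)\<^sup>2)"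
    have X': "\<forall>j<m. \<forall>i<3*m. X (j, i) = 1 \<or> X (j, i) = -1" using X d by auto
    have mpos: "m > 0" and kpos: "k > 0" using m k by auto
    let ?V = "\<Sum>j<m. (v j)\<^sup>2"
    obtain \<kappa> where \<kappa>: "\<kappa> \<in> l1_sphere {..<m} k"
      and le: "energy m X (\<lambda>j. sqrt m / k * of_int (\<kappa> j)) + (- (m / 50)) * (\<Sum>j<m. (sqrt m / k * of_int (\<kappa> j))\<^sup>2)
          \<le> (1 - 1 / k) * (energy m X v + (- (m / 50)) * ?V) + m * (3 * real m + (- (m / 50))) / k"
      by (rule maurey_energy[where b = "- (m / 50)" and X = X and v = v and m = m and k = k, OF X' v(1) mpos kpos]) (rule that)
    have "real m * 800000 \<le> m * ?V" using v by (intro mult_left_mono) auto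
    then have neg: "energy m X v + (- (m / 50)) * ?V \<le> - (12000 * real m)" using v(3) by (simp add: field_simps)
    have "(1 - 1 / k) * (energy m X v + (- (m / 50)) * ?V) \<le> 1/2 * (energy m X v + (- (m / 50)) * ?V)"
      using neg k(3) by (intro mult_right_mono_neg) (auto simp: field_simps)
    also have "\<dots> \<le> 1/2 * (- (12000 * real m))" by (intro mult_left_mono neg) simp
    finally have 1: "(1 - 1 / k) * (energy m X v + (- (m / 50)) * ?V) \<le> - (6000 * real m)" by simp
    have "m * (3 * real m + (- (m / 50))) / k \<le> m * (3 * m) / (m / 2000)"
      using k mpos by (intro frac_le mult_left_mono) auto
    then have 2: "m * (3 * real m + (- (m / 50))) / k \<le> 6000 * real m" using mpos by simp
    have "energy m X (\<lambda>j. c * of_int (\<kappa> j)) \<le> m / 50 * (\<Sum>j<m. (c * of_int (\<kappa> j))\<^sup>2)"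
      using order_trans[OF le add_mono[OF 1 2]] unfolding c_def by linarith
    then have "c\<^sup>2 * energy m X (\<lambda>j. of_int (\<kappa> j)) \<le> c\<^sup>2 * (m / 50 * ?A \<kappa>)"
      by (simp add: energy_scale power_mult_distrib sum_distrib_left[symmetric] mult.left_commute)
    then have "energy m X (\<lambda>j. of_int (\<kappa> j)) \<le> m / 50 * ?A \<kappa>"
      using cpos by (simp only: mult_le_cancel_left_pos zero_less_power)
    then show "\<exists>\<kappa>\<in>l1_sphere {..<m} k. energy m X (\<lambda>j. 1 * of_int (\<kappa> j)) \<le> m / 50 * ?A \<kappa>"
      using \<kappa> by (intro bexI[of _ \<kappa>]) simp_all
  qed
  then have "measure_pmf.prob ?p ?E \<le> measure_pmf.prob ?p {X. \<exists>\<kappa>\<in>l1_sphere {..<m} k. energy m X (\<lambda>j. 1 * of_int (\<kappa> j)) \<le> m / 50 * ?A \<kappa>}"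
    by (intro measure_pmf.finite_measure_mono) auto
  also have "\<dots> \<le> ((1 + 1/128) / (1 - 1/128) * exp ((m / 50) / (2 * m)) * (41/42) ^ 3) ^ m / (1/128) ^ k"
  proof (rule prob_net_le[where A = ?A])
    fix \<kappa> assume \<kappa>: "\<kappa> \<in> l1_sphere {..<m} k"
    have "\<exists>j<m. \<kappa> j \<noteq> 0"
    proof (rule ccontr)
      assume "\<not> ?thesis"
      then have "(\<Sum>j<m. \<bar>\<kappa> j\<bar>) = 0" by simp
      then show False using \<kappa> k(3) by (simp add: l1_sphere_def)
    qed
    then obtain j where "j < m" "\<kappa> j \<noteq> 0" by blast
    then show A: "?A \<kappa> > 0" by (intro sum_pos2[of _ j]) auto
    show "(\<integral>\<^sup>+s. ennreal (exp (- (\<Sum>j<m. s j * (1 * of_int (\<kappa> j)))\<^sup>2 / (2 * ?A \<kappa>))) \<partial>signs {..<m}) \<le> ennreal (41/42)"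
      using small_ball_any[of "{..<m}" "?A \<kappa>" "\<lambda>j. of_int (\<kappa> j)"] A by simp
  qed (use d in auto)
  also have "\<dots> \<le> (129/127 * (100/99) * (41/42) ^ 3) ^ m * (101/100) ^ m"
  proof -
    have "1 + (- 1/100) \<le> exp (- 1/100 :: real)" by (rule exp_ge_add_one_self)
    then have "exp (1/100 :: real) \<le> 100/99" by (simp add: exp_minus field_simps)
    then have 1: "((1 + 1/128) / (1 - 1/128) * exp ((m / 50) / (2 * m)) * (41/42) ^ 3) ^ m \<le> (129/127 * (100/99) * (41/42) ^ 3 :: real) ^ m"
      using m by (intro power_mono mult_mono) auto
    \<comment> \<open>Since \<open>1000 k \<le> m\<close>, the factor \<open>128\<^sup>k\<close> costs at most \<open>1.01\<^sup>m\<close>.\<close>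
    have "1 + 100 * (1/100) \<le> (1 + 1/100 :: real) ^ 100" using Bernoulli_inequality[of "1/100" 100] by simp
    then have "(2::real) ^ 7 \<le> ((101/100) ^ 100) ^ 7" by (intro power_mono) auto
    then have "(128::real) \<le> (101/100) ^ 700" by (simp flip: power_mult)
    then have "(128::real) ^ k \<le> ((101/100) ^ 700) ^ k" by (intro power_mono) auto
    also have "\<dots> = (101/100) ^ (700 * k)" by (simp add: power_mult)
    also have "\<dots> \<le> (101/100) ^ m" using k by (intro power_increasing) auto
    finally have "(128::real) ^ k \<le> (101/100) ^ m" .
    with 1 have "((1 + 1/128) / (1 - 1/128) * exp ((m / 50) / (2 * m)) * (41/42) ^ 3) ^ m * 128 ^ k \<le> (129/127 * (100/99) * (41/42) ^ 3 :: real) ^ m * (101/100) ^ m"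
      by (intro mult_mono) auto
    then show ?thesis by (simp add: power_divide)
  qed
  also have "\<dots> = (129/127 * (100/99) * (41/42) ^ 3 * (101/100)) ^ m" by (simp only: power_mult_distrib)
  also have "\<dots> \<le> (97/100) ^ m" by (intro power_mono) (auto simp: power3_eq_cube)
  finally show ?thesis .
qed

text \<open>The smallest singular value of an \<open>m \<times> 3m\<close> sign matrix is at least \<open>\<surd>(c m)\<close>, up to exponentially small probability:
  after scaling to \<open>\<parallel>v\<parallel>\<^sub>1 = \<surd>m\<close> the two preceding cases are complementary.\<close>

lemma smallest_singular_value:
  "\<exists>c>0. \<exists>m0. \<forall>m\<ge>m0. \<forall>d\<ge>3*m.
    measure_pmf.prob (signs ({..<m} \<times> {..<d})) {X. (\<forall>j<m. \<forall>i<d. X (j, i) = 1 \<or> X (j, i) = -1) \<and>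
      (\<exists>v. energy m X v < c * m * (\<Sum>j<m. (v j)\<^sup>2))} \<le> (1/2) ^ m + (97/100) ^ m"
proof -
  obtain \<epsilon> m1 where \<epsilon>: "\<epsilon> > 0" and spread: "\<forall>m\<ge>m1. \<forall>d\<ge>3*m. 
    measure_pmf.prob (signs ({..<m} \<times> {..<d}))
      {X. (\<forall>j<m. \<forall>i<d. X (j, i) = 1 \<or> X (j, i) = -1) \<and> 
        (\<exists>v. (\<Sum>j<m. \<bar>v j\<bar>) = sqrt m \<and> (\<Sum>j<m. (v j)\<^sup>2) \<le> 800000 \<and> energy m X v \<le> \<epsilon> * m)} \<le> (1/2) ^ m"
    using spread_vectors_not_contracted[of 800000] by auto
  \<comment> \<open>The first bound is for spread vectors, whose squared length is at most \<open>800000\<close>.\<close>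
  define c where "c = min (\<epsilon> / 800000) (1/200)"
  have c: "c > 0" "c * 800000 \<le> \<epsilon>" "c \<le> 1/200" using \<epsilon> by (auto simp: c_def min_def)
  show ?thesis
  proof (rule exI[of _ c], intro conjI exI[of _ "max m1 4000"] allI impI)
    show "c > 0" by (fact c)
    fix m d assume m: "max m1 4000 \<le> m" and d: "3 * m \<le> d"
    let ?p = "signs ({..<m} \<times> {..<d})"
    let ?S = "{X. \<forall>j<m. \<forall>i<d. X (j, i) = 1 \<or> X (j, i) = -1}"
    let ?E1 = "{X. (\<forall>j<m. \<forall>i<d. X (j, i) = 1 \<or> X (j, i) = -1) \<and> 
        (\<exists>v. (\<Sum>j<m. \<bar>v j\<bar>) = sqrt m \<and> (\<Sum>j<m. (v j)\<^sup>2) \<le> 800000 \<and> energy m X v \<le> \<epsilon> * m)}"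
    let ?E2 = "{X. (\<forall>j<m. \<forall>i<d. X (j, i) = 1 \<or> X (j, i) = -1) \<and> 
        (\<exists>v. (\<Sum>j<m. \<bar>v j\<bar>) = sqrt m \<and> 800000 \<le> (\<Sum>j<m. (v j)\<^sup>2) \<and> energy m X v \<le> m / 200 * (\<Sum>j<m. (v j)\<^sup>2))}"
    let ?E = "{X. (\<forall>j<m. \<forall>i<d. X (j, i) = 1 \<or> X (j, i) = -1) \<and>
      (\<exists>v. energy m X v < c * m * (\<Sum>j<m. (v j)\<^sup>2))}"
    have "?E \<subseteq> ?E1 \<union> ?E2"
    proof
      fix X assume "X \<in> ?E"
      then obtain u where X: "X \<in> ?S" and u: "energy m X u < c * m * (\<Sum>j<m. (u j)\<^sup>2)" by blast
      have e0: "energy m X u \<ge> 0" by (simp add: energy_def sum_nonneg)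
      define M where "M = (\<Sum>j<m. \<bar>u j\<bar>)"
      have "M \<noteq> 0"
      proof
        assume "M = 0"
        then have "\<forall>j\<in>{..<m}. \<bar>u j\<bar> = 0" unfolding M_def by (subst (asm) sum_nonneg_eq_0_iff) auto
        then have "(\<Sum>j<m. (u j)\<^sup>2) = 0" by simp
        with u e0 show False by simp
      qed
      then have M: "M > 0" by (simp add: M_def sum_nonneg less_le)
      define v where "v = (\<lambda>j. sqrt m / M * u j)"
      have s: "(sqrt m / M)\<^sup>2 > 0" using M m by simp
      have l1: "(\<Sum>j<m. \<bar>v j\<bar>) = sqrt m"
      proof -
        have "(\<Sum>j<m. \<bar>v j\<bar>) = (\<Sum>j<m. sqrt m / M * \<bar>u j\<bar>)" using M by (simp add: v_def abs_mult)
        also have "\<dots> = sqrt m / M * M" unfolding sum_distrib_left[symmetric] M_def[symmetric] ..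
        finally have "(\<Sum>j<m. \<bar>v j\<bar>) = sqrt m / M * M" .
        then show ?thesis using M by simp
      qed
      have V: "(\<Sum>j<m. (v j)\<^sup>2) = (sqrt m / M)\<^sup>2 * (\<Sum>j<m. (u j)\<^sup>2)"
        unfolding v_def power_mult_distrib sum_distrib_left ..
      have "(sqrt m / M)\<^sup>2 * energy m X u < (sqrt m / M)\<^sup>2 * (c * m * (\<Sum>j<m. (u j)\<^sup>2))"
        by (rule mult_strict_left_mono[OF u s])
      then have v: "energy m X v < c * m * (\<Sum>j<m. (v j)\<^sup>2)"
        unfolding V unfolding v_def energy_scale by (simp only: mult.left_commute mult.assoc)
      have V0: "0 \<le> (\<Sum>j<m. (v j)\<^sup>2)" by (simp add: sum_nonneg)
      show "X \<in> ?E1 \<union> ?E2"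
      proof (cases "(\<Sum>j<m. (v j)\<^sup>2) \<le> 800000")
        case True
        have "c * m * (\<Sum>j<m. (v j)\<^sup>2) \<le> c * m * 800000" using True c by (intro mult_left_mono) auto
        also have "\<dots> = (c * 800000) * m" by simp
        also have "\<dots> \<le> \<epsilon> * m" by (intro mult_right_mono c) simp
        finally have "energy m X v \<le> \<epsilon> * m" using v by linarith
        then have "X \<in> ?E1" using X l1 True by (intro CollectI conjI exI[of _ v]) simp_all
        then show ?thesis ..
      next
        case False
        have "c * m * (\<Sum>j<m. (v j)\<^sup>2) \<le> 1/200 * m * (\<Sum>j<m. (v j)\<^sup>2)" using V0 c by (intro mult_right_mono) auto
        then have "energy m X v \<le> m / 200 * (\<Sum>j<m. (v j)\<^sup>2)" using v by simp
        then have "X \<in> ?E2" using X l1 False by (intro CollectI conjI exI[of _ v]) simp_all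
        then show ?thesis ..
      qed
    qed
    then have "measure_pmf.prob ?p ?E \<le> measure_pmf.prob ?p (?E1 \<union> ?E2)"
      by (intro measure_pmf.finite_measure_mono) auto
    also have "\<dots> \<le> measure_pmf.prob ?p ?E1 + measure_pmf.prob ?p ?E2"
      by (intro measure_Un_le) auto
    also have "\<dots> \<le> (1/2) ^ m + (97/100) ^ m"
    proof (rule add_mono)
      show "measure_pmf.prob ?p ?E1 \<le> (1/2) ^ m" using spread m d by simp
      show "measure_pmf.prob ?p ?E2 \<le> (97/100) ^ m" using m d by (intro peaked_vectors_not_contracted) auto
    qed
    finally show "measure_pmf.prob ?p ?E \<le> (1/2) ^ m + (97/100) ^ m" .
  qed
qed

section \<open>Normalized Bernoulli matrices\<close>

lemma bernoulli_matrix_signs: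
  assumes "m > 0"
  shows "bernoulli_matrix m d = map_pmf (\<lambda>X. Matrix.mat m d (\<lambda>x. X x / sqrt m)) (signs ({..<m} \<times> {..<d}))"
proof -
  have "pmf_of_set {1 / sqrt m, - (1 / sqrt m)} = map_pmf (\<lambda>x. x / sqrt m) (pmf_of_set {1, -1})"
    using assms by (subst map_pmf_of_set_inj) (auto simp: inj_on_def)
  then have "Pi_pmf ({..<m} \<times> {..<d}) 0 (\<lambda>_. pmf_of_set {1 / sqrt m, - (1 / sqrt m)}) =
     map_pmf (\<lambda>h. (\<lambda>x. x / sqrt m) \<circ> h) (signs ({..<m} \<times> {..<d}))"
    unfolding signs_def by (simp only:) (intro Pi_pmf_map, auto)
  then show ?thesis unfolding bernoulli_matrix_def by (simp add: pmf.map_comp comp_def)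
qed

lemma bernoulli_matrix_entry:
  assumes "m > 0" "\<Phi> \<in> set_pmf (bernoulli_matrix m d)"
  shows "\<Phi> \<in> carrier_mat m d" "j < m \<Longrightarrow> i < d \<Longrightarrow> \<bar>\<Phi> $$ (j, i)\<bar> = 1 / sqrt m"
proof -
  obtain X where X: "X \<in> set_pmf (signs ({..<m} \<times> {..<d}))" "\<Phi> = Matrix.mat m d (\<lambda>x. X x / sqrt m)"
    using assms by (auto simp: bernoulli_matrix_signs)
  show "\<Phi> \<in> carrier_mat m d" using X by simp
  show "\<bar>\<Phi> $$ (j, i)\<bar> = 1 / sqrt m" if "j < m" "i < d"
    using signs_support[OF _ X(1), of "(j, i)"] that by (auto simp: X(2))
qed

lemma finite_set_bernoulli_matrix:
  assumes "m > 0" shows "finite (set_pmf (bernoulli_matrix m d))"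
proof -
  have "set_pmf (signs ({..<m} \<times> {..<d})) \<subseteq> PiE_dflt ({..<m} \<times> {..<d}) 0 (\<lambda>_. {1, -1})"
    unfolding signs_def by (subst set_Pi_pmf) auto
  then have "finite (set_pmf (signs ({..<m} \<times> {..<d})))" by (rule finite_subset) (intro finite_PiE_dflt, auto)
  then show ?thesis by (simp add: bernoulli_matrix_signs[OF assms])
qed

text \<open>The smallest singular value of the block of the first \<open>3m\<close> columns is at least \<open>\<surd>c\<close>.\<close>

definition leading_columns_bounded_below :: "real \<Rightarrow> real Matrix.mat \<Rightarrow> nat \<Rightarrow> bool" where
  "leading_columns_bounded_below c \<Phi> m \<longleftrightarrow>
    (\<forall>v::nat \<Rightarrow> real. c * (\<Sum>j<m. (v j)\<^sup>2) \<le> (\<Sum>i<3*m. (\<Sum>j<m. \<Phi> $$ (j, i) * v j)\<^sup>2))"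

lemma bernoulli_leading_columns_bounded_below:
  "\<exists>c>0. \<exists>m0. \<forall>m\<ge>m0. \<forall>d\<ge>3*m.
    measure_pmf.prob (bernoulli_matrix m d) {\<Phi>. \<not> leading_columns_bounded_below c \<Phi> m} \<le> (1/2) ^ m + (97/100) ^ m"
proof -
  obtain c m0 where c: "c > 0" and P: "\<forall>m\<ge>m0. \<forall>d\<ge>3*m.
    measure_pmf.prob (signs ({..<m} \<times> {..<d})) {X. (\<forall>j<m. \<forall>i<d. X (j, i) = 1 \<or> X (j, i) = -1) \<and>
      (\<exists>v. energy m X v < c * m * (\<Sum>j<m. (v j)\<^sup>2))} \<le> (1/2) ^ m + (97/100) ^ m"
    using smallest_singular_value by auto
  show ?thesis
  proof (rule exI[of _ c], intro conjI exI[of _ "max m0 1"] allI impI)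
    show "c > 0" by (fact c)
    fix m d assume m: "max m0 1 \<le> m" and d: "3 * m \<le> d"
    then have mpos: "m > 0" by simp
    let ?p = "signs ({..<m} \<times> {..<d})"
    have "measure_pmf.prob (bernoulli_matrix m d) {\<Phi>. \<not> leading_columns_bounded_below c \<Phi> m} =
      measure_pmf.prob ?p {X. \<not> leading_columns_bounded_below c (Matrix.mat m d (\<lambda>x. X x / sqrt m)) m}"
      by (simp add: bernoulli_matrix_signs[OF mpos] vimage_def)
    also have "\<dots> \<le> measure_pmf.prob ?p {X. (\<forall>j<m. \<forall>i<d. X (j, i) = 1 \<or> X (j, i) = -1) \<and>
      (\<exists>v. energy m X v < c * m * (\<Sum>j<m. (v j)\<^sup>2))}"
    proof (rule measure_pmf.finite_measure_mono_AE)
      show "AE X in ?p. X \<in> {X. \<not> leading_columns_bounded_below c (Matrix.mat m d (\<lambda>x. X x / sqrt m)) m} \<longrightarrow>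
         X \<in> {X. (\<forall>j<m. \<forall>i<d. X (j, i) = 1 \<or> X (j, i) = -1) \<and> (\<exists>v. energy m X v < c * m * (\<Sum>j<m. (v j)\<^sup>2))}"
      proof (rule AE_pmfI, safe)
        fix X assume X: "X \<in> set_pmf ?p" and nb: "\<not> leading_columns_bounded_below c (Matrix.mat m d (\<lambda>x. X x / sqrt m)) m"
        show "X (j, i) = 1" if "j < m" "i < d" "X (j, i) \<noteq> -1" for j i
          using signs_support[OF _ X, of "(j, i)"] that by auto
        have eq: "m * (\<Sum>i<3*m. (\<Sum>j<m. Matrix.mat m d (\<lambda>x. X x / sqrt m) $$ (j, i) * v j)\<^sup>2) = energy m X v" for v
        proof -
          have "(\<Sum>j<m. Matrix.mat m d (\<lambda>x. X x / sqrt m) $$ (j, i) * v j) = (\<Sum>j<m. X (j, i) * v j) / sqrt m" if "i < 3 * m" for i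
            using that d by (simp add: sum_divide_distrib)
          then have "(\<Sum>i<3*m. (\<Sum>j<m. Matrix.mat m d (\<lambda>x. X x / sqrt m) $$ (j, i) * v j)\<^sup>2) = (\<Sum>i<3*m. (\<Sum>j<m. X (j, i) * v j)\<^sup>2 / m)"
            by (intro sum.cong) (auto simp: power_divide)
          then show ?thesis using mpos by (simp add: energy_def sum_divide_distrib[symmetric])
        qed
        from nb obtain v where "(\<Sum>i<3*m. (\<Sum>j<m. Matrix.mat m d (\<lambda>x. X x / sqrt m) $$ (j, i) * v j)\<^sup>2) < c * (\<Sum>j<m. (v j)\<^sup>2)"
          unfolding leading_columns_bounded_below_def by (auto simp: not_le)
        then have "m * (\<Sum>i<3*m. (\<Sum>j<m. Matrix.mat m d (\<lambda>x. X x / sqrt m) $$ (j, i) * v j)\<^sup>2) < m * (c * (\<Sum>j<m. (v j)\<^sup>2))"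
          using mpos by (intro mult_strict_left_mono) auto
        then have "energy m X v < c * m * (\<Sum>j<m. (v j)\<^sup>2)" unfolding eq by (simp only: mult_ac)
        then show "\<exists>v. energy m X v < c * m * (\<Sum>j<m. (v j)\<^sup>2)" by (rule exI[of _ v])
      qed
    qed auto
    also have "\<dots> \<le> (1/2) ^ m + (97/100) ^ m" using P m d by simp
    finally show "measure_pmf.prob (bernoulli_matrix m d) {\<Phi>. \<not> leading_columns_bounded_below c \<Phi> m} \<le> (1/2) ^ m + (97/100) ^ m" .
  qed
qed

section \<open>Norms and preimages of vectors\<close>

lemma l2_norm_eq: "x \<in> carrier_vec n \<Longrightarrow> l2_norm x = L2_set (($) x) {..<n}"
  by (auto simp: l2_norm_def)

lemma l1_norm_eq: "x \<in> carrier_vec n \<Longrightarrow> l1_norm x = (\<Sum>i<n. \<bar>x $ i\<bar>)"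
  by (auto simp: l1_norm_def)

lemma l2_norm_nonneg [simp]: "0 \<le> l2_norm x" by (simp add: l2_norm_def)
lemma l1_norm_nonneg [simp]: "0 \<le> l1_norm x" by (simp add: l1_norm_def sum_nonneg)

lemma l2_norm_add:
  assumes "x \<in> carrier_vec n" "y \<in> carrier_vec n" shows "l2_norm (x + y) \<le> l2_norm x + l2_norm y"
proof -
  have "l2_norm (x + y) = L2_set (\<lambda>i. x $ i + y $ i) {..<n}"
    using assms by (auto simp: l2_norm_eq[of _ n] intro!: L2_set_cong)
  then show ?thesis using assms by (simp add: l2_norm_eq[of _ n] L2_set_triangle_ineq)
qed

lemma l1_norm_add:
  assumes "x \<in> carrier_vec n" "y \<in> carrier_vec n" shows "l1_norm (x + y) \<le> l1_norm x + l1_norm y"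
proof -
  have "l1_norm (x + y) = (\<Sum>i<n. \<bar>x $ i + y $ i\<bar>)" using assms by (simp add: l1_norm_eq[of _ n])
  also have "\<dots> \<le> (\<Sum>i<n. \<bar>x $ i\<bar> + \<bar>y $ i\<bar>)" by (intro sum_mono) (rule abs_triangle_ineq)
  finally show ?thesis using assms by (simp add: l1_norm_eq[of _ n] sum.distrib)
qed

lemma l2_norm_smult: "l2_norm (c \<cdot>\<^sub>v x) = \<bar>c\<bar> * l2_norm x"
proof -
  have "(l2_norm (c \<cdot>\<^sub>v x))\<^sup>2 = (\<bar>c\<bar> * l2_norm x)\<^sup>2"
    by (simp add: l2_norm_sq power_mult_distrib sum_distrib_left)
  then show ?thesis by (simp add: power2_eq_iff_nonneg)
qed

lemma l1_norm_smult: "l1_norm (c \<cdot>\<^sub>v x) = \<bar>c\<bar> * l1_norm x"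
  by (simp add: l1_norm_def abs_mult sum_distrib_left)

lemma l2_norm_diff_commute:
  assumes "x \<in> carrier_vec n" "y \<in> carrier_vec n" shows "l2_norm (x - y) = l2_norm (y - x)"
proof -
  have "y - x = (-1) \<cdot>\<^sub>v (x - y)" using assms by auto
  then show ?thesis by (simp add: l2_norm_smult)
qed

lemma l2_norm_diff_triangle:
  assumes "x \<in> carrier_vec n" "y \<in> carrier_vec n" "z \<in> carrier_vec n"
  shows "l2_norm (x - z) \<le> l2_norm (x - y) + l2_norm (y - z)"
proof -
  have "x - z = (x - y) + (y - z)" using assms by auto
  then show ?thesis using assms l2_norm_add[of "x - y" n "y - z"] by simp
qed

lemma l2_norm_eq_0:
  assumes "x \<in> carrier_vec n" shows "l2_norm x = 0 \<longleftrightarrow> x = 0\<^sub>v n"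
  using assms by (auto simp: l2_norm_eq[of _ n] L2_set_eq_0_iff)

lemma scalar_prod_sum:
  assumes "x \<in> carrier_vec n" "y \<in> carrier_vec n" shows "x \<bullet> y = (\<Sum>i<n. x $ i * y $ i)"
  using assms by (simp add: scalar_prod_def atLeast0LessThan)

lemma scalar_prod_le_l2:
  assumes "x \<in> carrier_vec n" "y \<in> carrier_vec n" shows "\<bar>x \<bullet> y\<bar> \<le> l2_norm x * l2_norm y"
proof -
  have "\<bar>x \<bullet> y\<bar> \<le> (\<Sum>i<n. \<bar>x $ i\<bar> * \<bar>y $ i\<bar>)"
    unfolding scalar_prod_sum[OF assms] using sum_abs[of "\<lambda>i. x $ i * y $ i" "{..<n}"] by (simp add: abs_mult)
  also have "\<dots> \<le> l2_norm x * l2_norm y" using assms by (simp add: l2_norm_eq[of _ n] L2_set_mult_ineq)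
  finally show ?thesis .
qed

lemma scalar_prod_self: "x \<bullet> x = (l2_norm x)\<^sup>2"
  unfolding l2_norm_sq by (simp add: scalar_prod_def atLeast0LessThan power2_eq_square)

text \<open>A lower bound for \<open>\<parallel>P\<^sup>T v\<parallel>\<close> makes the Gram matrix \<open>P P\<^sup>T\<close> injective, hence invertible.\<close>

lemma gram_solvable:
  fixes P :: "nat \<Rightarrow> nat \<Rightarrow> real" and \<eta> :: "nat \<Rightarrow> real"
  assumes c: "c > 0" and lower: "\<And>v. c * (\<Sum>j<m. (v j)\<^sup>2) \<le> (\<Sum>i<n. (\<Sum>j<m. P j i * v j)\<^sup>2)"
  obtains v where "\<And>j. j < m \<Longrightarrow> (\<Sum>i<n. P j i * (\<Sum>l<m. P l i * v l)) = \<eta> j"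
proof -
  define G where "G = Matrix.mat m m (\<lambda>(j, l). \<Sum>i<n. P j i * P l i)"
  have G: "G \<in> carrier_mat m m" by (simp add: G_def)
  have Gv: "(G *\<^sub>v x) $ j = (\<Sum>i<n. P j i * (\<Sum>l<m. P l i * x $ l))" if "x \<in> carrier_vec m" "j < m" for x j
  proof -
    have "(G *\<^sub>v x) $ j = (\<Sum>l<m. (\<Sum>i<n. P j i * P l i) * x $ l)"
      using that by (simp add: G_def scalar_prod_def atLeast0LessThan)
    also have "\<dots> = (\<Sum>i<n. P j i * (\<Sum>l<m. P l i * x $ l))"
      unfolding sum_distrib_left sum_distrib_right by (subst sum.swap) (simp add: mult.assoc)
    finally show ?thesis .
  qed
  have "det G \<noteq> 0"
  proof
    assume "det G = 0"
    then obtain x where x: "x \<in> carrier_vec m" "x \<noteq> 0\<^sub>v m" "G *\<^sub>v x = 0\<^sub>v m"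
      using det_0_iff_vec_prod_zero[OF G] by blast
    have "(\<Sum>i<n. (\<Sum>j<m. P j i * x $ j)\<^sup>2) = (\<Sum>i<n. \<Sum>j<m. x $ j * (P j i * (\<Sum>l<m. P l i * x $ l)))"
      by (intro sum.cong refl) (simp add: power2_eq_square sum_distrib_right mult_ac)
    also have "\<dots> = (\<Sum>j<m. x $ j * (G *\<^sub>v x) $ j)"
      by (subst sum.swap) (simp add: Gv[OF x(1)] sum_distrib_left)
    also have "\<dots> = 0" unfolding x(3) by simp
    finally have "c * (\<Sum>j<m. (x $ j)\<^sup>2) \<le> 0" using lower[of "($) x"] by simp
    then have "(\<Sum>j<m. (x $ j)\<^sup>2) \<le> 0" using c by (simp add: mult_le_0_iff)
    then have "(\<Sum>j<m. (x $ j)\<^sup>2) = 0" by (intro antisym sum_nonneg) auto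
    then have "\<forall>j<m. x $ j = 0" by (subst (asm) sum_nonneg_eq_0_iff) auto
    then have "x = 0\<^sub>v m" using x(1) by auto
    with x(2) show False by simp
  qed
  then have "G \<in> Units (ring_mat TYPE(real) m ())" by (rule det_non_zero_imp_unit[OF G])
  then obtain B where B: "B \<in> carrier_mat m m" "G * B = 1\<^sub>m m"
    unfolding Units_def by (auto simp: ring_mat_simps)
  define x where "x = B *\<^sub>v Matrix.vec m \<eta>"
  have x: "x \<in> carrier_vec m" using B by (simp add: x_def)
  have "G *\<^sub>v x = (G * B) *\<^sub>v Matrix.vec m \<eta>" unfolding x_def using G B(1) by (subst assoc_mult_mat_vec) auto
  also have "\<dots> = Matrix.vec m \<eta>" by (simp add: B(2))
  finally have "(G *\<^sub>v x) $ j = \<eta> j" if "j < m" for j using that by simp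
  then show ?thesis using Gv[OF x] by (intro that[of "($) x"]) auto
qed

text \<open>The minimum norm solution \<open>u = P\<^sup>T (P P\<^sup>T)\<^sup>-\<^sup>1 \<eta>\<close>, with \<open>P\<close> the block of the first \<open>3m\<close> columns and \<open>u\<close> extended by \<open>0\<close>. Its length is at
  most \<open>\<parallel>\<eta>\<parallel>/\<surd>c\<close>, and being supported on \<open>3m\<close> coordinates costs only a factor \<open>\<surd>(3m)\<close> in the l1 norm; with all \<open>d\<close>
  columns that factor would grow with \<open>d/m\<close>.\<close>

lemma small_preimage:
  assumes \<Phi>: "\<Phi> \<in> carrier_mat m d" "3 * m \<le> d" and c: "c > 0" and lower: "leading_columns_bounded_below c \<Phi> m"
  obtains u where "u \<in> carrier_vec d" "\<Phi> *\<^sub>v u = Matrix.vec m \<eta>"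
    "c * (l2_norm u)\<^sup>2 \<le> (\<Sum>j<m. (\<eta> j)\<^sup>2)" "(l1_norm u)\<^sup>2 \<le> 3 * real m * (l2_norm u)\<^sup>2"
proof -
  let ?P = "\<lambda>j i. \<Phi> $$ (j, i)"
  obtain v where v: "\<And>j. j < m \<Longrightarrow> (\<Sum>i<3*m. ?P j i * (\<Sum>l<m. ?P l i * v l)) = \<eta> j"
    using gram_solvable[OF c, of m ?P "3*m" \<eta>] lower unfolding leading_columns_bounded_below_def by blast
  define y where "y i = (\<Sum>l<m. ?P l i * v l)" for i
  define u where "u = Matrix.vec d (\<lambda>i. if i < 3 * m then y i else 0)"
  have u: "u \<in> carrier_vec d" by (simp add: u_def)
  have restrict: "(\<Sum>i<d. F i (u $ i)) = (\<Sum>i<3*m. F i (y i))" if "\<And>i. F i 0 = 0" for F :: "nat \<Rightarrow> real \<Rightarrow> real"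
    using \<Phi>(2) that by (intro sum.mono_neutral_cong_right) (auto simp: u_def)
  have l2: "(l2_norm u)\<^sup>2 = (\<Sum>i<3*m. (y i)\<^sup>2)"
    using restrict[of "\<lambda>i x. x\<^sup>2"] u by (simp add: l2_norm_sq)
  show ?thesis
  proof (rule that[OF u])
    show "\<Phi> *\<^sub>v u = Matrix.vec m \<eta>"
    proof (rule eq_vecI)
      fix j assume "j < dim_vec (Matrix.vec m \<eta>)"
      then have j: "j < m" by simp
      have "(\<Phi> *\<^sub>v u) $ j = (\<Sum>i<d. ?P j i * u $ i)"
        using j \<Phi>(1) u by (simp add: scalar_prod_def atLeast0LessThan)
      also have "\<dots> = (\<Sum>i<3*m. ?P j i * y i)" by (rule restrict) simp
      also have "\<dots> = \<eta> j" using v[OF j] by (simp add: y_def)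
      finally show "(\<Phi> *\<^sub>v u) $ j = Matrix.vec m \<eta> $ j" using j by simp
    qed (use \<Phi>(1) in auto)
    let ?V = "\<Sum>j<m. (v j)\<^sup>2" and ?N = "\<Sum>j<m. (\<eta> j)\<^sup>2" and ?U = "(l2_norm u)\<^sup>2"
    have cV: "c * ?V \<le> ?U" using lower unfolding leading_columns_bounded_below_def l2 y_def by blast
    have "?U = (\<Sum>i<3*m. \<Sum>j<m. v j * (?P j i * y i))"
      unfolding l2 by (intro sum.cong refl) (simp add: power2_eq_square y_def[abs_def] sum_distrib_right sum_distrib_left mult_ac)
    also have "\<dots> = (\<Sum>j<m. v j * \<eta> j)"
      by (subst sum.swap) (auto simp: sum_distrib_left[symmetric] y_def v intro!: sum.cong)
    finally have "?U\<^sup>2 \<le> ?V * ?N" using Cauchy_Schwarz_ineq_sum[of v \<eta> "{..<m}"] by simp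
    then have "c * ?U\<^sup>2 \<le> c * ?V * ?N" using c by simp
    also have "\<dots> \<le> ?U * ?N" using cV by (intro mult_right_mono sum_nonneg) auto
    finally have "?U * (c * ?U) \<le> ?U * ?N" by (simp add: power2_eq_square mult_ac)
    then show "c * ?U \<le> ?N" by (cases "?U = 0") (auto simp: sum_nonneg)
    have "l1_norm u = (\<Sum>i<3*m. \<bar>y i\<bar>)" using restrict[of "\<lambda>i x. \<bar>x\<bar>"] u by (simp add: l1_norm_eq)
    then have "(l1_norm u)\<^sup>2 = (\<Sum>i<3*m. \<bar>y i\<bar> * 1)\<^sup>2" by simp
    also have "\<dots> \<le> (\<Sum>i<3*m. \<bar>y i\<bar>\<^sup>2) * (\<Sum>i<3*m. 1\<^sup>2)" by (rule Cauchy_Schwarz_ineq_sum)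
    finally show "(l1_norm u)\<^sup>2 \<le> 3 * real m * (l2_norm u)\<^sup>2" by (simp add: l2 mult_ac)
  qed
qed

section \<open>The Dantzig selector\<close>

lemma linf_norm_le:
  assumes "v \<in> carrier_vec n" "n > 0"
  shows "linf_norm v \<le> b \<longleftrightarrow> (\<forall>i<n. \<bar>v $ i\<bar> \<le> b)"
  using assms by (auto simp: linf_norm_def lessThan_empty_iff)

text \<open>Since \<open>x\<close> is feasible, the difference \<open>H = w - x\<close> has \<open>\<parallel>H\<parallel>\<^sub>1 \<le> 2 \<parallel>x\<parallel>\<^sub>1\<close> and \<open>\<parallel>\<Phi>\<^sup>T \<Phi> H\<parallel>\<^sub>\<infinity>\<close> at most twice the tolerance,
  whence \<open>\<parallel>\<Phi> H\<parallel>\<^sup>2\<close> is bounded by the product of the two. The arithmetic-geometric mean inequality, balanced by \<open>k\<close>, splits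
  that product, and \<open>rip_l1_lower_bound\<close> returns from \<open>\<Phi> H\<close> to \<open>H\<close>.\<close>

lemma dantzig_error:
  assumes \<Phi>: "\<Phi> \<in> carrier_mat m d" and rip: "rip k (1/6) \<Phi>" and k: "k > 0" and d: "d > 0"
    and D: "dantzig_selector \<Phi> lam \<tau> D" and pos: "lam * \<tau> \<ge> 0"
    and x: "x \<in> carrier_vec d" and e: "e \<in> carrier_vec m"
    and noise: "\<And>i. i < d \<Longrightarrow> \<bar>(transpose_mat \<Phi> *\<^sub>v e) $ i\<bar> \<le> lam * \<tau>"
  shows "D (\<Phi> *\<^sub>v x + e) \<in> carrier_vec d"
    and "(l2_norm (D (\<Phi> *\<^sub>v x + e) - x))\<^sup>2 \<le> 2 * real k * (lam * \<tau>)\<^sup>2 + 12 * (l1_norm x)\<^sup>2 / k"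
proof -
  let ?y = "\<Phi> *\<^sub>v x + e" and ?T = "transpose_mat \<Phi>"
  define w where "w = D ?y"
  have y: "?y \<in> carrier_vec m" using \<Phi> x e by simp
  have T: "?T \<in> carrier_mat d m" using \<Phi> by simp
  let ?F = "\<lambda>w. w \<in> carrier_vec (dim_col \<Phi>) \<and> linf_norm (?T *\<^sub>v (?y - \<Phi> *\<^sub>v w)) \<le> lam * \<tau>"
  have min: "is_arg_min l1_norm ?F w" using D y \<Phi> unfolding dantzig_selector_def w_def by auto
  have F: "?F v \<longleftrightarrow> v \<in> carrier_vec d \<and> (\<forall>i<d. \<bar>(?T *\<^sub>v (?y - \<Phi> *\<^sub>v v)) $ i\<bar> \<le> lam * \<tau>)" for v
  proof (cases "v \<in> carrier_vec d")
    case True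
    have "?y - \<Phi> *\<^sub>v v \<in> carrier_vec m" using y mult_mat_vec_carrier[OF \<Phi> True] by (rule minus_carrier_vec)
    then have "?T *\<^sub>v (?y - \<Phi> *\<^sub>v v) \<in> carrier_vec d" by (rule mult_mat_vec_carrier[OF T])
    from linf_norm_le[OF this d] show ?thesis using True \<Phi> by simp
  qed (use \<Phi> in auto)
  have "?F w" using min unfolding is_arg_min_def by (rule conjunct1)
  then have "w \<in> carrier_vec d \<and> (\<forall>i<d. \<bar>(?T *\<^sub>v (?y - \<Phi> *\<^sub>v w)) $ i\<bar> \<le> lam * \<tau>)" unfolding F .
  then have w: "w \<in> carrier_vec d" and wF: "\<And>i. i < d \<Longrightarrow> \<bar>(?T *\<^sub>v (?y - \<Phi> *\<^sub>v w)) $ i\<bar> \<le> lam * \<tau>"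
    by simp_all
  have "?y - \<Phi> *\<^sub>v x = e" using \<Phi> x e by auto
  then have "?F x" unfolding F using x noise by simp
  then have le: "l1_norm w \<le> l1_norm x" using min unfolding is_arg_min_def not_less[symmetric] by (metis (no_types))
  show "D ?y \<in> carrier_vec d" using w by (simp add: w_def)
  define H where "H = w - x"
  have H: "H \<in> carrier_vec d" using w x by (simp add: H_def)
  let ?M = "2 * l1_norm x"
  have "H = w + (-1) \<cdot>\<^sub>v x" using w x by (auto simp: H_def)
  then have M: "l1_norm H \<le> ?M" using l1_norm_add[of w d "(-1) \<cdot>\<^sub>v x"] w x le by (simp add: l1_norm_smult)
  have PH: "\<Phi> *\<^sub>v H = e - (?y - \<Phi> *\<^sub>v w)"
    unfolding H_def using \<Phi> x e w by (auto simp: mult_minus_distrib_mat_vec[OF \<Phi>])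
  have corr: "\<bar>(?T *\<^sub>v (\<Phi> *\<^sub>v H)) $ i\<bar> \<le> 2 * (lam * \<tau>)" if i: "i < d" for i
  proof -
    have "?T *\<^sub>v (\<Phi> *\<^sub>v H) = ?T *\<^sub>v e - ?T *\<^sub>v (?y - \<Phi> *\<^sub>v w)"
      unfolding PH using e y \<Phi> w by (intro mult_minus_distrib_mat_vec[OF T]) auto
    then have "(?T *\<^sub>v (\<Phi> *\<^sub>v H)) $ i = (?T *\<^sub>v e) $ i - (?T *\<^sub>v (?y - \<Phi> *\<^sub>v w)) $ i"
      using i T by auto
    then show ?thesis using noise[OF i] wF[OF i] by linarith
  qed
  have "(l2_norm (\<Phi> *\<^sub>v H))\<^sup>2 = (\<Phi> *\<^sub>v H) \<bullet> (\<Phi> *\<^sub>v H)" by (simp add: scalar_prod_self)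
  also have "\<dots> = H \<bullet> (?T *\<^sub>v (\<Phi> *\<^sub>v H))"
  proof -
    have "?T *\<^sub>v (\<Phi> *\<^sub>v H) \<in> carrier_vec d" using T \<Phi> H by simp
    then have "H \<bullet> (?T *\<^sub>v (\<Phi> *\<^sub>v H)) = (?T *\<^sub>v (\<Phi> *\<^sub>v H)) \<bullet> H" by (rule comm_scalar_prod[OF H])
    also have "\<dots> = (\<Phi> *\<^sub>v H) \<bullet> (\<Phi> *\<^sub>v H)"
      by (rule transpose_vec_mult_scalar[OF \<Phi> H mult_mat_vec_carrier[OF \<Phi> H]])
    finally show ?thesis ..
  qed
  also have "\<dots> \<le> (\<Sum>i<d. \<bar>H $ i\<bar> * (2 * (lam * \<tau>)))"
  proof -
    have "H $ i * (?T *\<^sub>v (\<Phi> *\<^sub>v H)) $ i \<le> \<bar>H $ i\<bar> * (2 * (lam * \<tau>))" if "i < d" for i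
    proof -
      have "H $ i * (?T *\<^sub>v (\<Phi> *\<^sub>v H)) $ i \<le> \<bar>H $ i\<bar> * \<bar>(?T *\<^sub>v (\<Phi> *\<^sub>v H)) $ i\<bar>"
        by (metis abs_ge_self abs_mult)
      also have "\<dots> \<le> \<bar>H $ i\<bar> * (2 * (lam * \<tau>))" by (intro mult_left_mono corr that) auto
      finally show ?thesis .
    qed
    moreover have "?T *\<^sub>v (\<Phi> *\<^sub>v H) \<in> carrier_vec d" using T \<Phi> H by simp
    ultimately show ?thesis unfolding scalar_prod_sum[OF H \<open>?T *\<^sub>v (\<Phi> *\<^sub>v H) \<in> carrier_vec d\<close>] by (intro sum_mono) auto
  qed
  also have "\<dots> = l1_norm H * (2 * (lam * \<tau>))" using H by (simp add: l1_norm_eq sum_distrib_right)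
  also have "\<dots> \<le> ?M * (2 * (lam * \<tau>))" using M pos by (intro mult_right_mono) auto
  finally have PH2: "(l2_norm (\<Phi> *\<^sub>v H))\<^sup>2 \<le> 2 * ?M * (lam * \<tau>)" by simp
  have amgm: "2 * ?M * (lam * \<tau>) \<le> ?M\<^sup>2 / k + k * (lam * \<tau>)\<^sup>2"
  proof -
    have "0 \<le> (?M - k * (lam * \<tau>))\<^sup>2 / k" by simp
    also have "\<dots> = ?M\<^sup>2 / k + k * (lam * \<tau>)\<^sup>2 - 2 * ?M * (lam * \<tau>)"
      using k by (simp add: power2_diff field_simps) (simp add: power2_eq_square)
    finally show ?thesis by linarith
  qed
  have "(l2_norm H)\<^sup>2 \<le> 2 * (l2_norm (\<Phi> *\<^sub>v H))\<^sup>2 + (l1_norm H)\<^sup>2 / k"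
    by (rule rip_l1_lower_bound[OF \<Phi> rip k H])
  also have "(l1_norm H)\<^sup>2 / k \<le> ?M\<^sup>2 / k" using M by (intro divide_right_mono power_mono) auto
  finally have "(l2_norm H)\<^sup>2 \<le> 2 * real k * (lam * \<tau>)\<^sup>2 + 3 * (?M\<^sup>2 / k)" using PH2 amgm by linarith
  then show "(l2_norm (D ?y - x))\<^sup>2 \<le> 2 * real k * (lam * \<tau>)\<^sup>2 + 12 * (l1_norm x)\<^sup>2 / k"
    by (simp add: H_def w_def power_mult_distrib)
qed

section \<open>Differentiable profiles with Lipschitz derivative\<close>

lemma first_order_taylor_remainder:
  fixes g g' :: "real \<Rightarrow> real"
  assumes deriv: "\<forall>t\<in>{-1..1}. (g has_real_derivative g' t) (at t within {-1..1})"
    and lip: "\<forall>t1\<in>{-1..1}. \<forall>t2\<in>{-1..1}. \<bar>g' t1 - g' t2\<bar> \<le> c1 * \<bar>t1 - t2\<bar>" and c1: "c1 \<ge> 0" and y: "\<bar>y\<bar> \<le> 1"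
  shows "\<bar>g y - g 0 - g' 0 * y\<bar> \<le> c1 * y\<^sup>2"
proof -
  define r where "r t = g t - g' 0 * t" for t
  have "norm (r y - r 0) \<le> (c1 * \<bar>y\<bar>) * norm (y - 0)"
  proof (rule field_differentiable_bound[where S = "{- \<bar>y\<bar>..\<bar>y\<bar>}" and f' = "\<lambda>t. g' t - g' 0"])
    fix t assume t: "t \<in> {- \<bar>y\<bar>..\<bar>y\<bar>}"
    then have t1: "t \<in> {-1..1}" using y by auto
    have sub: "{- \<bar>y\<bar>..\<bar>y\<bar>} \<subseteq> {-1..1}" using y by auto
    have "(g has_real_derivative g' t) (at t within {- \<bar>y\<bar>..\<bar>y\<bar>})"
      using deriv t1 by (intro DERIV_subset[OF _ sub]) blast
    moreover have "((\<lambda>t. g' 0 * t) has_real_derivative g' 0) (at t within {- \<bar>y\<bar>..\<bar>y\<bar>})"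
      by (rule DERIV_cmult_Id)
    ultimately show "(r has_field_derivative g' t - g' 0) (at t within {- \<bar>y\<bar>..\<bar>y\<bar>})"
      unfolding r_def[abs_def] by (rule DERIV_diff)
    have "(0::real) \<in> {-1..1}" by simp
    then have "\<bar>g' t - g' 0\<bar> \<le> c1 * \<bar>t - 0\<bar>" using lip t1 by blast
    also have "\<dots> \<le> c1 * \<bar>y\<bar>" using t c1 by (intro mult_left_mono) auto
    finally show "norm (g' t - g' 0) \<le> c1 * \<bar>y\<bar>" by simp
  qed auto
  also have "(c1 * \<bar>y\<bar>) * norm (y - 0) = c1 * y\<^sup>2" by (simp add: power2_eq_square mult.assoc)
  finally have "\<bar>r y - r 0\<bar> \<le> c1 * y\<^sup>2" by simp
  moreover have "r y - r 0 = g y - g 0 - g' 0 * y" by (simp add: r_def)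
  ultimately show ?thesis by simp
qed

lemma derivative_le_lipschitz:
  fixes g :: "real \<Rightarrow> real"
  assumes deriv: "(g has_real_derivative D) (at 0 within {-1..1})"
    and lip: "\<forall>t1\<in>{-1..1}. \<forall>t2\<in>{-1..1}. \<bar>g t1 - g t2\<bar> \<le> c * \<bar>t1 - t2\<bar>"
  shows "D \<le> c"
proof -
  have "((\<lambda>y. (g y - g 0) / (y - 0)) \<longlongrightarrow> D) (at 0 within {-1..1})"
    using deriv by (simp add: has_field_derivative_iff)
  moreover have "at (0::real) within {-1..1} = at 0" by (rule at_within_interior) (simp add: interior_atLeastAtMost_real)
  ultimately have lim: "((\<lambda>y. (g y - g 0) / (y - 0)) \<longlongrightarrow> D) (at 0)" by simp
  have "eventually (\<lambda>y. (g y - g 0) / (y - 0) \<le> c) (at (0::real))"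
    unfolding eventually_at
  proof (rule exI[of _ 1], intro conjI ballI impI)
    fix y :: real assume y: "y \<noteq> 0 \<and> dist y 0 < 1"
    then have "y \<in> {-1..1}" "(0::real) \<in> {-1..1}" by (auto simp: dist_real_def)
    then have "\<bar>g y - g 0\<bar> \<le> c * \<bar>y - 0\<bar>" using lip by blast
    then have "\<bar>(g y - g 0) / (y - 0)\<bar> \<le> c" using y by (simp add: abs_divide divide_le_eq)
    then show "(g y - g 0) / (y - 0) \<le> c" by linarith
  qed simp
  then show ?thesis using tendsto_upperbound[OF lim] by simp
qed

section \<open>Gaussian noise\<close>

text \<open>Mills' bound. The factor \<open>1/x\<close> is essential: at \<open>x = \<surd>(2 ln d)\<close> the density alone is of order \<open>1/d\<close>, which a union
  bound over \<open>d\<close> events would not make small.\<close>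

lemma std_normal_tail:
  assumes x: "x > 0"
  shows "(\<integral>\<^sup>+t. ennreal (std_normal_density t) * indicator {x<..} t \<partial>lborel) \<le> ennreal (std_normal_density x / x)"
proof -
  have "(\<integral>\<^sup>+t. ennreal (std_normal_density t) * indicator {x<..} t \<partial>lborel)
    \<le> (\<integral>\<^sup>+t. ennreal (t / x * std_normal_density t) * indicator {x..} t \<partial>lborel)"
  proof (rule nn_integral_mono)
    fix t :: real
    have "1 * std_normal_density t \<le> t / x * std_normal_density t" if "x < t"
      using that x by (intro mult_right_mono) auto
    then show "ennreal (std_normal_density t) * indicator {x<..} t \<le> ennreal (t / x * std_normal_density t) * indicator {x..} t"
      by (auto simp: indicator_def intro!: ennreal_leI)
  qed
  also have "\<dots> = ennreal (0 - (- std_normal_density x / x))"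
  proof (rule nn_integral_FTC_atLeast[where F = "\<lambda>t. - std_normal_density t / x"])
    show "(\<lambda>t. t / x * std_normal_density t) \<in> borel_measurable borel" by simp
    show "((\<lambda>t. - std_normal_density t / x) has_real_derivative t / x * std_normal_density t) (at t)" for t
      unfolding std_normal_density_def using x by (auto intro!: derivative_eq_intros simp: field_simps)
    show "0 \<le> t / x * std_normal_density t" if "x \<le> t" for t using that x by simp
    show "((\<lambda>t. - std_normal_density t / x) \<longlongrightarrow> 0) at_top"
    proof -
      have "filterlim (\<lambda>t::real. t\<^sup>2 / 2) at_top at_top" by real_asymp
      then have "((\<lambda>t::real. exp (- (t\<^sup>2 / 2))) \<longlongrightarrow> 0) at_top"
        by (intro filterlim_compose[OF exp_at_bot]) (simp add: filterlim_uminus_at_bot)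
      then have "((\<lambda>t::real. - (1 / sqrt (2 * pi) * exp (- (t\<^sup>2 / 2))) / x) \<longlongrightarrow> - (1 / sqrt (2 * pi) * 0) / x) at_top"
        using x by (intro tendsto_intros) auto
      then show ?thesis by (simp add: std_normal_density_def)
    qed
  qed
  finally show ?thesis by simp
qed

lemma (in prob_space) normal_tail:
  assumes X: "distributed M lborel X (normal_density 0 \<sigma>)" and \<sigma>: "\<sigma> > 0" and x: "x > 0"
  shows "prob {\<omega> \<in> space M. X \<omega> > x * \<sigma>} \<le> std_normal_density x / x"
proof -
  have std: "distributed M lborel (\<lambda>\<omega>. (X \<omega> - 0) / \<sigma>) std_normal_density"
    using X normal_standard_normal_convert[OF \<sigma>, of X 0] by simp
  have eq: "{\<omega> \<in> space M. X \<omega> > x * \<sigma>} = (\<lambda>\<omega>. (X \<omega> - 0) / \<sigma>) -` {x<..} \<inter> space M"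
    using \<sigma> by (auto simp: field_simps)
  have "emeasure M {\<omega> \<in> space M. X \<omega> > x * \<sigma>} = (\<integral>\<^sup>+t. ennreal (std_normal_density t) * indicator {x<..} t \<partial>lborel)"
    unfolding eq by (rule distributed_emeasure[OF std]) simp
  also have "\<dots> \<le> ennreal (std_normal_density x / x)" by (rule std_normal_tail[OF x])
  finally show ?thesis using x by (simp add: emeasure_eq_measure)
qed

definition noise :: "nat \<Rightarrow> real \<Rightarrow> (nat \<Rightarrow> real) measure" where
  "noise m \<sigma> = (\<Pi>\<^sub>M j\<in>{..<m}. density lborel (\<lambda>t. ennreal (normal_density 0 \<sigma> t)))"

lemma prob_space_noise: "\<sigma> > 0 \<Longrightarrow> prob_space (noise m \<sigma>)"
  unfolding noise_def by (intro prob_space_PiM prob_space_normal_density)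

lemma measurable_noise_coordinate: "j < m \<Longrightarrow> (\<lambda>z. z j) \<in> borel_measurable (noise m \<sigma>)"
proof -
  assume j: "j < m"
  have "(\<lambda>z. z j) \<in> measurable (noise m \<sigma>) (density lborel (\<lambda>t. ennreal (normal_density 0 \<sigma> t)))"
    unfolding noise_def using j by (intro measurable_component_singleton) auto
  then show ?thesis by simp
qed

lemma noise_coordinate_distr:
  assumes "\<sigma> > 0" "j < m"
  shows "distr (noise m \<sigma>) borel (\<lambda>z. z j) = density lborel (\<lambda>t. ennreal (normal_density 0 \<sigma> t))"
proof -
  let ?N = "density lborel (\<lambda>t. ennreal (normal_density 0 \<sigma> t))"
  have "distr (noise m \<sigma>) borel (\<lambda>z. z j) = distr (noise m \<sigma>) ?N (\<lambda>z. z j)"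
    by (rule distr_cong) simp_all
  also have "\<dots> = ?N" unfolding noise_def
    using assms by (intro distr_PiM_component[where M = "\<lambda>_. ?N"] prob_space_normal_density) auto
  finally show ?thesis .
qed

lemma noise_indep:
  assumes \<sigma>: "\<sigma> > 0" and m: "m > 0"
  shows "prob_space.indep_vars (noise m \<sigma>) (\<lambda>_. borel) (\<lambda>j z. z j) {..<m}"
proof -
  interpret prob_space "noise m \<sigma>" by (rule prob_space_noise[OF \<sigma>])
  let ?N = "density lborel (\<lambda>t. ennreal (normal_density 0 \<sigma> t))"
  have "distr (noise m \<sigma>) (\<Pi>\<^sub>M j\<in>{..<m}. borel) (\<lambda>z. \<lambda>j\<in>{..<m}. z j) = distr (noise m \<sigma>) (noise m \<sigma>) (\<lambda>z. z)"
  proof (rule distr_cong)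
    show "sets (\<Pi>\<^sub>M j\<in>{..<m}. borel) = sets (noise m \<sigma>)"
      unfolding noise_def by (intro sets_PiM_cong) auto
    show "(\<lambda>j\<in>{..<m}. z j) = z" if "z \<in> space (noise m \<sigma>)" for z
      using that by (auto simp: noise_def space_PiM PiE_def extensional_restrict)
  qed simp
  also have "\<dots> = noise m \<sigma>" by (rule distr_id)
  also have "\<dots> = (\<Pi>\<^sub>M j\<in>{..<m}. distr (noise m \<sigma>) borel (\<lambda>z. z j))"
    unfolding noise_def[of m \<sigma>] by (intro PiM_cong refl) (simp add: noise_coordinate_distr[OF \<sigma>] flip: noise_def)
  finally show ?thesis
    using m by (subst indep_vars_iff_distr_eq_PiM') (auto intro: measurable_noise_coordinate)
qed

text \<open>A column of entries \<open>\<plusminus>1/\<surd>m\<close> is a unit vector, so its correlation with the noise has the law of a single coordinate.\<close>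

lemma noise_column:
  assumes \<sigma>: "\<sigma> > 0" and m: "m > 0" and a: "\<And>j. j < m \<Longrightarrow> \<bar>a j\<bar> = 1 / sqrt m"
  shows "distributed (noise m \<sigma>) lborel (\<lambda>z. \<Sum>j<m. a j * z j) (normal_density 0 \<sigma>)"
proof -
  interpret prob_space "noise m \<sigma>" by (rule prob_space_noise[OF \<sigma>])
  have coord: "distributed (noise m \<sigma>) lborel (\<lambda>z. z j) (normal_density 0 \<sigma>)" if "j < m" for j
    unfolding distributed_def using noise_coordinate_distr[OF \<sigma> that] measurable_noise_coordinate[OF that, of \<sigma>]
    by (auto simp: measurable_lborel1 cong: distr_cong)
  have a0: "a j \<noteq> 0" if "j < m" for j using a[OF that] m by auto
  have scaled: "distributed (noise m \<sigma>) lborel (\<lambda>z. a j * z j) (normal_density 0 (\<sigma> / sqrt m))" if "j < m" for j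
    using normal_density_affine[OF coord[OF that] \<sigma> a0[OF that], of 0] a[OF that] by simp
  have "indep_vars (\<lambda>_. borel) (\<lambda>j. (\<lambda>t. a j * t) \<circ> (\<lambda>z. z j)) {..<m}"
    by (rule indep_vars_compose[OF noise_indep[OF \<sigma> m]]) auto
  then have ind: "indep_vars (\<lambda>_. borel) (\<lambda>j z. a j * z j) {..<m}" by (simp add: comp_def)
  have "distributed (noise m \<sigma>) lborel (\<lambda>z. \<Sum>j\<in>{..<m}. a j * z j)
     (normal_density (\<Sum>j\<in>{..<m}. 0) (sqrt (\<Sum>j\<in>{..<m}. (\<sigma> / sqrt m)\<^sup>2)))"
    using m \<sigma> scaled by (intro sum_indep_normal ind) auto
  moreover have "sqrt (\<Sum>j\<in>{..<m}. (\<sigma> / sqrt m)\<^sup>2) = \<sigma>" using m \<sigma> by (simp add: power_divide)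
  ultimately show ?thesis by simp
qed

text \<open>Union bound over \<open>2d\<close> one-sided tails, each at most \<open>1/(2 d \<surd>(ln d))\<close>.\<close>

lemma noise_correlation_bound:
  fixes m d :: nat
  assumes \<sigma>: "\<sigma> > 0" and m: "m > 0" and d: "d \<ge> 2" and a: "\<And>j i. j < m \<Longrightarrow> i < d \<Longrightarrow> \<bar>a j i\<bar> = 1 / sqrt m"
  shows "{z \<in> space (noise m \<sigma>). \<forall>i<d. \<bar>\<Sum>j<m. a j i * z j\<bar> \<le> sqrt (2 * ln d) * \<sigma>} \<in> sets (noise m \<sigma>)"
    and "measure (noise m \<sigma>) {z \<in> space (noise m \<sigma>). \<forall>i<d. \<bar>\<Sum>j<m. a j i * z j\<bar> \<le> sqrt (2 * ln d) * \<sigma>} \<ge> 1 - 1 / sqrt (ln d)"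
proof -
  interpret prob_space "noise m \<sigma>" by (rule prob_space_noise[OF \<sigma>])
  let ?x = "sqrt (2 * ln d)"
  let ?S = "\<lambda>i z. \<Sum>j<m. a j i * z j"
  have S[measurable]: "?S i \<in> borel_measurable (noise m \<sigma>)" for i
    by (intro borel_measurable_sum borel_measurable_times borel_measurable_const measurable_noise_coordinate) auto
  have lnd: "ln d > 0" using d by simp
  then have x: "?x > 0" by simp
  let ?G = "{z \<in> space (noise m \<sigma>). \<forall>i<d. \<bar>?S i z\<bar> \<le> ?x * \<sigma>}"
  let ?B = "\<lambda>i. {z \<in> space (noise m \<sigma>). ?S i z > ?x * \<sigma>}" and ?B' = "\<lambda>i. {z \<in> space (noise m \<sigma>). (\<Sum>j<m. - a j i * z j) > ?x * \<sigma>}"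
  show G: "?G \<in> sets (noise m \<sigma>)"
  proof -
    have "{z \<in> space (noise m \<sigma>). \<bar>?S i z\<bar> \<le> ?x * \<sigma>} \<in> sets (noise m \<sigma>)" for i
      by (intro borel_measurable_le borel_measurable_abs S borel_measurable_const)
    then have "{z \<in> space (noise m \<sigma>). \<forall>i\<in>{..<d}. \<bar>?S i z\<bar> \<le> ?x * \<sigma>} \<in> sets (noise m \<sigma>)"
      by (intro sets.sets_Collect_finite_All) auto
    then show ?thesis by (simp add: Ball_def)
  qed
  have tail: "std_normal_density ?x / ?x \<le> 1 / (2 * (d * sqrt (ln d)))"
  proof -
    have "std_normal_density ?x = 1 / (sqrt (2 * pi) * d)"
      using lnd d by (simp add: std_normal_density_def exp_minus field_simps)
    then have "std_normal_density ?x / ?x = 1 / (d * sqrt (ln d) * (sqrt (2 * pi) * sqrt 2))"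
      by (simp add: real_sqrt_mult mult_ac)
    also have "\<dots> \<le> 1 / (d * sqrt (ln d) * (sqrt 2 * sqrt 2))"
      using lnd d pi_gt3 by (intro divide_left_mono mult_left_mono mult_right_mono real_sqrt_le_mono mult_pos_pos) auto
    finally show ?thesis by (simp add: mult_ac)
  qed
  have B: "prob (?B i) \<le> 1 / (2 * (d * sqrt (ln d)))" "prob (?B' i) \<le> 1 / (2 * (d * sqrt (ln d)))" if "i < d" for i
    using normal_tail[OF noise_column[OF \<sigma> m, of "\<lambda>j. a j i"] \<sigma> x]
      normal_tail[OF noise_column[OF \<sigma> m, of "\<lambda>j. - a j i"] \<sigma> x] a that tail by force+
  have sets: "?B i \<in> sets (noise m \<sigma>)" "?B' i \<in> sets (noise m \<sigma>)" for i
  proof -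
    show "?B i \<in> sets (noise m \<sigma>)" by measurable
    have "?B' i = {z \<in> space (noise m \<sigma>). - ?S i z > ?x * \<sigma>}" by (simp add: sum_negf)
    also have "\<dots> \<in> sets (noise m \<sigma>)" by measurable
    finally show "?B' i \<in> sets (noise m \<sigma>)" .
  qed
  have "space (noise m \<sigma>) - ?G \<subseteq> (\<Union>i<d. ?B i \<union> ?B' i)"
    by (auto simp: sum_negf abs_le_iff not_le)
  then have "prob (space (noise m \<sigma>) - ?G) \<le> prob (\<Union>i<d. ?B i \<union> ?B' i)"
    using sets by (intro finite_measure_mono) auto
  also have "\<dots> \<le> (\<Sum>i<d. prob (?B i \<union> ?B' i))"
    using sets by (intro finite_measure_subadditive_finite) auto
  also have "\<dots> \<le> (\<Sum>i<d. 1 / (2 * (d * sqrt (ln d))) + 1 / (2 * (d * sqrt (ln d))))"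
  proof (rule sum_mono)
    fix i assume "i \<in> {..<d}"
    then have "i < d" by simp
    then show "prob (?B i \<union> ?B' i) \<le> 1 / (2 * (d * sqrt (ln d))) + 1 / (2 * (d * sqrt (ln d)))"
      by (intro order_trans[OF measure_Un_le[OF sets(1) sets(2)]] add_mono B)
  qed
  also have "\<dots> = 1 / sqrt (ln d)" using d by simp
  finally show "prob ?G \<ge> 1 - 1 / sqrt (ln d)" using prob_compl[OF G] by simp
qed

section \<open>Ridge functions\<close>

text \<open>Writing \<open>n = \<parallel>a - b\<parallel>\<close>, the arguments of \<open>g\<close> differ by \<open>\<langle>a - b, x\<rangle> + \<langle>b, x\<rangle> (1 - \<langle>a, b\<rangle>)\<close>. For unit
  vectors \<open>1 - \<langle>a, b\<rangle> = n\<^sup>2/2 \<le> n\<close>, so each term contributes at most \<open>n\<close>.\<close>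

lemma sup_dist_ridge_le:
  assumes a: "a \<in> carrier_vec d" "l2_norm a = 1" and b: "b \<in> carrier_vec d" "l2_norm b = 1"
    and lip: "\<forall>t1\<in>{-1..1}. \<forall>t2\<in>{-1..1}. \<bar>g t1 - g t2\<bar> \<le> c * \<bar>t1 - t2\<bar>" and c: "c \<ge> 0"
  shows "sup_dist d (ridge g a) (ridge (\<lambda>t. ridge g a (t \<cdot>\<^sub>v b)) b) \<le> 2 * c * l2_norm (a - b)"
  unfolding sup_dist_def
proof (rule cSUP_least)
  have "l2_norm (0\<^sub>v d) = 0" using l2_norm_eq_0[of "0\<^sub>v d" d] by simp
  then have "0\<^sub>v d \<in> unit_ball d" by (simp add: unit_ball_def)
  then show "unit_ball d \<noteq> {}" by blast
  fix x assume "x \<in> unit_ball d"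
  then have x: "x \<in> carrier_vec d" "l2_norm x < 1" by (auto simp: unit_ball_def)
  let ?n = "l2_norm (a - b)"
  have ab: "a - b \<in> carrier_vec d" using a b by simp
  have rhs: "ridge (\<lambda>t. ridge g a (t \<cdot>\<^sub>v b)) b x = g ((b \<bullet> x) * (a \<bullet> b))"
    using a b by (simp add: ridge_def)
  have bx: "\<bar>b \<bullet> x\<bar> \<le> 1" and ax: "\<bar>a \<bullet> x\<bar> \<le> 1" and abs_ab: "\<bar>a \<bullet> b\<bar> \<le> 1"
    using scalar_prod_le_l2[OF b(1) x(1)] scalar_prod_le_l2[OF a(1) x(1)] scalar_prod_le_l2[OF a(1) b(1)] a b x by auto
  have lhs: "ridge g a x = g (a \<bullet> x)" by (simp add: ridge_def)
  have "\<bar>(b \<bullet> x) * (a \<bullet> b)\<bar> \<le> 1" using mult_mono[OF bx abs_ab] by (simp add: abs_mult)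
  then have "a \<bullet> x \<in> {-1..1}" "(b \<bullet> x) * (a \<bullet> b) \<in> {-1..1}" using ax by (auto simp: abs_le_iff)
  then have "\<bar>ridge g a x - ridge (\<lambda>t. ridge g a (t \<cdot>\<^sub>v b)) b x\<bar> \<le> c * \<bar>a \<bullet> x - (b \<bullet> x) * (a \<bullet> b)\<bar>"
    using lip unfolding lhs rhs by blast
  also have "\<dots> \<le> c * (2 * ?n)"
  proof (rule mult_left_mono[OF _ c])
    have "\<bar>(a - b) \<bullet> x\<bar> \<le> ?n * l2_norm x" by (rule scalar_prod_le_l2[OF ab x(1)])
    also have "\<dots> \<le> ?n * 1" using x by (intro mult_left_mono) auto
    finally have 1: "\<bar>a \<bullet> x - b \<bullet> x\<bar> \<le> ?n" using minus_scalar_prod_distrib[OF a(1) b(1) x(1)] by simp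
    have "?n\<^sup>2 = 2 - 2 * (a \<bullet> b)"
    proof -
      have "?n\<^sup>2 = (a - b) \<bullet> (a - b)" by (simp add: scalar_prod_self)
      also have "\<dots> = (\<Sum>i<d. a $ i * a $ i + b $ i * b $ i - 2 * (a $ i * b $ i))"
        unfolding scalar_prod_sum[OF ab ab] using a b by (intro sum.cong) (auto simp: algebra_simps)
      also have "\<dots> = a \<bullet> a + b \<bullet> b - 2 * (a \<bullet> b)"
        unfolding scalar_prod_sum[OF a(1) a(1)] scalar_prod_sum[OF b(1) b(1)] scalar_prod_sum[OF a(1) b(1)]
        by (simp add: sum.distrib sum_subtractf sum_distrib_left)
      finally show ?thesis using a(2) b(2) by (simp add: scalar_prod_self)
    qed
    moreover have "?n \<le> 2"
      using l2_norm_diff_triangle[OF a(1) zero_carrier_vec b(1)] a b l2_norm_diff_commute[OF zero_carrier_vec b(1)] by simp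
    then have "?n * ?n \<le> ?n * 2" by (intro mult_left_mono) auto
    ultimately have "1 - a \<bullet> b \<le> ?n" by (simp add: power2_eq_square)
    moreover have "\<bar>b \<bullet> x\<bar> * (1 - a \<bullet> b) \<le> 1 * (1 - a \<bullet> b)" using bx abs_ab by (intro mult_right_mono) auto
    ultimately have "\<bar>(b \<bullet> x) * (1 - a \<bullet> b)\<bar> \<le> ?n" using abs_ab by (simp add: abs_mult)
    then have 2: "\<bar>b \<bullet> x - (b \<bullet> x) * (a \<bullet> b)\<bar> \<le> ?n" by (simp add: algebra_simps)
    show "\<bar>a \<bullet> x - (b \<bullet> x) * (a \<bullet> b)\<bar> \<le> 2 * ?n" using 1 2 by linarith
  qed
  finally show "\<bar>ridge g a x - ridge (\<lambda>t. ridge g a (t \<cdot>\<^sub>v b)) b x\<bar> \<le> 2 * c * ?n" by (simp add: mult_ac)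
qed

text \<open>Normalization moves \<open>w\<close> by \<open>\<bar>\<parallel>w\<parallel> - \<gamma>\<bar> \<le> e\<close> relative to \<open>\<parallel>w\<parallel> \<ge> \<gamma> - e\<close>, which doubles the relative error.\<close>

lemma normalized_direction_error:
  assumes a: "a \<in> carrier_vec d" "l2_norm a = 1" and w: "w \<in> carrier_vec d"
    and close: "l2_norm (w - \<gamma> \<cdot>\<^sub>v a) \<le> e" and gap: "\<gamma> - e > 0"
  shows "w \<noteq> 0\<^sub>v d" and "l2_norm (a - (1 / l2_norm w) \<cdot>\<^sub>v w) \<le> 2 * e / (\<gamma> - e)"
proof -
  let ?n = "l2_norm w"
  have e: "e \<ge> 0" using close l2_norm_nonneg order_trans by blast
  have ga: "\<gamma> \<cdot>\<^sub>v a \<in> carrier_vec d" using a by simp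
  have nga: "l2_norm (\<gamma> \<cdot>\<^sub>v a) = \<gamma>" using gap e a by (simp add: l2_norm_smult)
  have "\<gamma> \<cdot>\<^sub>v a = w + (\<gamma> \<cdot>\<^sub>v a - w)" using w ga by auto
  then have up: "\<gamma> \<le> ?n + e"
    using l2_norm_add[of w d "\<gamma> \<cdot>\<^sub>v a - w"] w ga close nga l2_norm_diff_commute[OF w ga] by simp
  have "w = \<gamma> \<cdot>\<^sub>v a + (w - \<gamma> \<cdot>\<^sub>v a)" using w ga by auto
  then have low: "?n \<le> \<gamma> + e"
    using l2_norm_add[of "\<gamma> \<cdot>\<^sub>v a" d "w - \<gamma> \<cdot>\<^sub>v a"] w ga close nga by simp
  have n: "?n > 0" using up gap by linarith
  then show "w \<noteq> 0\<^sub>v d" using l2_norm_eq_0[OF w] by auto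
  have split: "a - (1 / ?n) \<cdot>\<^sub>v w = (1 - \<gamma> / ?n) \<cdot>\<^sub>v a + (1 / ?n) \<cdot>\<^sub>v (\<gamma> \<cdot>\<^sub>v a - w)"
    using a w n by (auto simp: algebra_simps diff_divide_distrib)
  have "l2_norm (a - (1 / ?n) \<cdot>\<^sub>v w) \<le> \<bar>1 - \<gamma> / ?n\<bar> + (1 / ?n) * l2_norm (\<gamma> \<cdot>\<^sub>v a - w)"
    unfolding split using l2_norm_add[of "(1 - \<gamma> / ?n) \<cdot>\<^sub>v a" d "(1 / ?n) \<cdot>\<^sub>v (\<gamma> \<cdot>\<^sub>v a - w)"] a w n by (simp add: l2_norm_smult)
  also have "\<dots> \<le> e / ?n + (1 / ?n) * e"
  proof (rule add_mono)
    have "1 - \<gamma> / ?n = (?n - \<gamma>) / ?n" using n by (simp add: field_simps)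
    then have "\<bar>1 - \<gamma> / ?n\<bar> = \<bar>?n - \<gamma>\<bar> / ?n" using n by (simp add: abs_divide)
    also have "\<dots> \<le> e / ?n" using up low n by (intro divide_right_mono) auto
    finally show "\<bar>1 - \<gamma> / ?n\<bar> \<le> e / ?n" .
    show "(1 / ?n) * l2_norm (\<gamma> \<cdot>\<^sub>v a - w) \<le> (1 / ?n) * e"
      using close n l2_norm_diff_commute[OF w ga] by (intro mult_left_mono) auto
  qed
  also have "\<dots> = 2 * e / ?n" by simp
  also have "\<dots> \<le> 2 * e / (\<gamma> - e)" using up gap e n by (intro divide_left_mono) auto
  finally show "l2_norm (a - (1 / ?n) \<cdot>\<^sub>v w) \<le> 2 * e / (\<gamma> - e)" .
qed

text \<open>The Taylor remainder of \<open>g\<close> at \<open>h \<langle>a, \<phi>\<^sub>j\<rangle>\<close>. Two bounds for \<open>\<bar>\<langle>a, \<phi>\<^sub>j\<rangle>\<bar>\<close> play different roles: \<open>\<surd>(d/m)\<close>, by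
  Cauchy-Schwarz, keeps the argument in \<open>[-1,1]\<close> because \<open>h < \<surd>(m/d)\<close>, and \<open>R/\<surd>m\<close>, from the l1 norm of \<open>a\<close>, makes the remainder
  small.\<close>

lemma linearized_observations:
  fixes g g' :: "real \<Rightarrow> real"
  assumes \<Phi>: "\<Phi> \<in> carrier_mat m d" and entries: "\<And>j i. j < m \<Longrightarrow> i < d \<Longrightarrow> \<bar>\<Phi> $$ (j, i)\<bar> = 1 / sqrt m"
    and m: "m > 0" and d: "d > 0" and h: "0 < h" "h < sqrt (m / d)"
    and a: "a \<in> carrier_vec d" "l2_norm a = 1" "l1_norm a \<le> R"
    and deriv: "\<forall>t\<in>{-1..1}. (g has_real_derivative g' t) (at t within {-1..1})"
    and lip: "\<forall>t1\<in>{-1..1}. \<forall>t2\<in>{-1..1}. \<bar>g' t1 - g' t2\<bar> \<le> c1 * \<bar>t1 - t2\<bar>" and c1: "c1 \<ge> 0"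
  obtains \<eta> where "observations (ridge g a) h \<Phi> z = \<Phi> *\<^sub>v (g' 0 \<cdot>\<^sub>v a) + Matrix.vec m \<eta> + Matrix.vec m (\<lambda>j. z j / h)"
    "(\<Sum>j<m. (\<eta> j)\<^sup>2) \<le> (c1 * R\<^sup>2 * h)\<^sup>2 / m"
proof -
  define t where "t j = Matrix.row \<Phi> j \<bullet> a" for j
  define \<eta> where "\<eta> j = (g (h * t j) - g 0 - g' 0 * (h * t j)) / h" for j
  have row: "Matrix.row \<Phi> j \<in> carrier_vec d" if "j < m" for j using \<Phi> that by (intro row_carrier_vec) auto
  have R: "R \<ge> 0" using a(3) l1_norm_nonneg order_trans by blast
  have t1: "\<bar>t j\<bar> \<le> R / sqrt m" if j: "j < m" for j
  proof -
    have "\<bar>t j\<bar> \<le> (\<Sum>i<d. \<bar>Matrix.row \<Phi> j $ i * a $ i\<bar>)"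
      unfolding t_def scalar_prod_sum[OF row[OF j] a(1)] by (rule sum_abs)
    also have "\<dots> = (\<Sum>i<d. 1 / sqrt m * \<bar>a $ i\<bar>)"
      using j \<Phi> entries[OF j] by (intro sum.cong) (auto simp: abs_mult)
    also have "\<dots> = l1_norm a / sqrt m" using a(1) by (simp add: l1_norm_eq sum_divide_distrib)
    also have "\<dots> \<le> R / sqrt m" using a(3) by (intro divide_right_mono) auto
    finally show ?thesis .
  qed
  have t2: "\<bar>h * t j\<bar> \<le> 1" if j: "j < m" for j
  proof -
    have "(l2_norm (Matrix.row \<Phi> j))\<^sup>2 = (\<Sum>i<d. (1 / sqrt m)\<^sup>2)"
    proof -
      have "(Matrix.row \<Phi> j $ i)\<^sup>2 = (1 / sqrt m)\<^sup>2" if "i < d" for i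
      proof -
        have "(Matrix.row \<Phi> j $ i)\<^sup>2 = \<bar>\<Phi> $$ (j, i)\<bar>\<^sup>2" using j \<Phi> that by simp
        then show ?thesis unfolding entries[OF j that] .
      qed
      then show ?thesis unfolding l2_norm_sq using \<Phi> by simp
    qed
    then have "(l2_norm (Matrix.row \<Phi> j))\<^sup>2 = d / m" using m by (simp add: power_divide)
    then have "l2_norm (Matrix.row \<Phi> j) = sqrt (d / m)" by (metis l2_norm_nonneg real_sqrt_unique)
    then have "\<bar>t j\<bar> \<le> sqrt (d / m)" using scalar_prod_le_l2[OF row[OF j] a(1)] a(2) by (simp add: t_def)
    then have "h * \<bar>t j\<bar> \<le> sqrt (m / d) * sqrt (d / m)" using h by (intro mult_mono) auto
    also have "\<dots> = 1" using m d by (simp add: real_sqrt_mult[symmetric])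
    finally show ?thesis using h by (simp add: abs_mult)
  qed
  have \<eta>: "\<bar>\<eta> j\<bar> \<le> c1 * R\<^sup>2 * h / m" if j: "j < m" for j
  proof -
    have "\<bar>g (h * t j) - g 0 - g' 0 * (h * t j)\<bar> \<le> c1 * (h * t j)\<^sup>2"
      by (rule first_order_taylor_remainder[OF deriv lip c1 t2[OF j]])
    also have "(h * t j)\<^sup>2 \<le> h\<^sup>2 * (R / sqrt m)\<^sup>2"
    proof -
      have "(t j)\<^sup>2 \<le> (R / sqrt m)\<^sup>2" using power_mono[OF t1[OF j], of 2] by simp
      then show ?thesis by (simp add: power_mult_distrib mult_left_mono)
    qed
    finally have "\<bar>g (h * t j) - g 0 - g' 0 * (h * t j)\<bar> \<le> c1 * (h\<^sup>2 * (R / sqrt m)\<^sup>2)"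
      using c1 by (simp add: mult_left_mono)
    then have "\<bar>\<eta> j\<bar> \<le> c1 * (h\<^sup>2 * (R / sqrt m)\<^sup>2) / h"
      unfolding \<eta>_def using h by (simp add: abs_divide divide_right_mono)
    also have "\<dots> = c1 * R\<^sup>2 * h / m" using h m by (simp add: power_divide power2_eq_square)
    finally show ?thesis .
  qed
  show ?thesis
  proof (rule that[of \<eta>])
    show "observations (ridge g a) h \<Phi> z = \<Phi> *\<^sub>v (g' 0 \<cdot>\<^sub>v a) + Matrix.vec m \<eta> + Matrix.vec m (\<lambda>j. z j / h)"
    proof (rule eq_vecI)
      fix j assume "j < dim_vec (\<Phi> *\<^sub>v (g' 0 \<cdot>\<^sub>v a) + Matrix.vec m \<eta> + Matrix.vec m (\<lambda>j. z j / h))"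
      then have j: "j < m" by simp
      have f1: "ridge g a (h \<cdot>\<^sub>v Matrix.row \<Phi> j) = g (h * t j)"
        using a(1) row[OF j] by (simp add: ridge_def t_def comm_scalar_prod[OF a(1) row[OF j]])
      have f0: "ridge g a (0\<^sub>v d) = g 0" using a(1) by (simp add: ridge_def)
      have "(\<Phi> *\<^sub>v (g' 0 \<cdot>\<^sub>v a)) $ j = g' 0 * t j"
        using j \<Phi> a(1) row[OF j] by (simp add: t_def)
      then show "observations (ridge g a) h \<Phi> z $ j = (\<Phi> *\<^sub>v (g' 0 \<cdot>\<^sub>v a) + Matrix.vec m \<eta> + Matrix.vec m (\<lambda>j. z j / h)) $ j"
        using j \<Phi> h by (simp add: observations_def f1 f0 \<eta>_def field_simps)
    qed (use \<Phi> in \<open>simp add: observations_def\<close>)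
    have "(\<Sum>j<m. (\<eta> j)\<^sup>2) \<le> (\<Sum>j<m. (c1 * R\<^sup>2 * h / m)\<^sup>2)"
    proof (rule sum_mono)
      fix j assume "j \<in> {..<m}"
      then have "\<bar>\<eta> j\<bar>\<^sup>2 \<le> (c1 * R\<^sup>2 * h / m)\<^sup>2" by (intro power_mono \<eta>) auto
      then show "(\<eta> j)\<^sup>2 \<le> (c1 * R\<^sup>2 * h / m)\<^sup>2" by simp
    qed
    also have "\<dots> = (c1 * R\<^sup>2 * h)\<^sup>2 / m" using m by (simp add: power_divide) (simp add: power2_eq_square)
    finally show "(\<Sum>j<m. (\<eta> j)\<^sup>2) \<le> (c1 * R\<^sup>2 * h)\<^sup>2 / m" .
  qed
qed

text \<open>The deterministic part. The selector is compared with \<open>x = g'(0) a + u\<close>, where \<open>\<Phi> u = \<eta>\<close>; the term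
  with \<open>C7\<close> in the error bounds \<open>\<parallel>u\<parallel>\<^sub>2\<close>, and \<open>C6 h\<close> in the radius bounds \<open>\<parallel>u\<parallel>\<^sub>1\<close>. As \<open>g'(0) \<le> c0\<close>, the l1 norm of
  \<open>x\<close> exceeds the radius at most by a factor depending on \<open>c0\<close>, which \<open>C5\<close> absorbs.\<close>

lemma recovery_error:
  fixes g g' :: "real \<Rightarrow> real" and c c0 c1 R :: real
  defines "C5 \<equiv> 2 * (1 + c0)\<^sup>2" and "C6 \<equiv> c1 * R\<^sup>2 * sqrt (3 / c)" and "C7 \<equiv> c1 * R\<^sup>2 / sqrt c"
  assumes const: "c > 0" "c0 > 0" "c1 > 0" "R > 0"
    and \<Phi>: "\<Phi> \<in> carrier_mat m d" and entries: "\<And>j i. j < m \<Longrightarrow> i < d \<Longrightarrow> \<bar>\<Phi> $$ (j, i)\<bar> = 1 / sqrt m"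
    and low: "leading_columns_bounded_below c \<Phi> m" and rip: "rip s (1/6) \<Phi>"
    and s: "0 < s" "s \<le> m" and d: "3 * m \<le> d" and \<sigma>: "\<sigma> > 0" and h: "0 < h" "h < sqrt (m / d)"
    and a: "a \<in> carrier_vec d" "l2_norm a = 1" "l1_norm a \<le> R"
    and deriv: "\<forall>t\<in>{-1..1}. (g has_real_derivative g' t) (at t within {-1..1})"
    and glip: "\<forall>t1\<in>{-1..1}. \<forall>t2\<in>{-1..1}. \<bar>g t1 - g t2\<bar> \<le> c0 * \<bar>t1 - t2\<bar>"
    and lip: "\<forall>t1\<in>{-1..1}. \<forall>t2\<in>{-1..1}. \<bar>g' t1 - g' t2\<bar> \<le> c1 * \<bar>t1 - t2\<bar>"
    and g0: "g' 0 > 0"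
    and D: "dantzig_selector \<Phi> (sqrt (2 * ln d)) (\<sigma> / h) D"
    and noise: "\<And>i. i < d \<Longrightarrow> \<bar>\<Sum>j<m. \<Phi> $$ (j, i) * z j\<bar> \<le> sqrt (2 * ln d) * \<sigma>"
  shows "D (observations (ridge g a) h \<Phi> z) \<in> carrier_vec d"
    and "l2_norm (D (observations (ridge g a) h \<Phi> z) - g' 0 \<cdot>\<^sub>v a) \<le> err C5 C6 C7 R s d \<sigma> h"
proof -
  have m: "m > 0" and dpos: "d > 0" "real d \<ge> 3" using s d by auto
  have "exp 1 \<le> real d" using exp_le dpos by linarith
  then have lnd: "1 \<le> ln (real d)" using dpos by (simp add: ln_ge_iff)
  obtain \<eta> where obs: "observations (ridge g a) h \<Phi> z = \<Phi> *\<^sub>v (g' 0 \<cdot>\<^sub>v a) + Matrix.vec m \<eta> + Matrix.vec m (\<lambda>j. z j / h)"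
    and \<eta>: "(\<Sum>j<m. (\<eta> j)\<^sup>2) \<le> (c1 * R\<^sup>2 * h)\<^sup>2 / m"
    by (rule linearized_observations[OF \<Phi> entries m dpos(1) h a deriv lip less_imp_le[OF const(3)]]) (assumption, assumption, rule that)
  obtain u where u: "u \<in> carrier_vec d" "\<Phi> *\<^sub>v u = Matrix.vec m \<eta>"
    and u2: "c * (l2_norm u)\<^sup>2 \<le> (\<Sum>j<m. (\<eta> j)\<^sup>2)" and u1: "(l1_norm u)\<^sup>2 \<le> 3 * real m * (l2_norm u)\<^sup>2"
    by (rule small_preimage[OF \<Phi> d const(1) low])
  have u2': "(l2_norm u)\<^sup>2 \<le> (c1 * R\<^sup>2 * h)\<^sup>2 / (c * m)"
    using order_trans[OF u2 \<eta>] const(1) m by (simp add: field_simps)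
  have K: "c1 * R\<^sup>2 * h \<ge> 0" using const h by simp
  have l2u: "l2_norm u \<le> C7 * (h / sqrt s)"
  proof -
    have "(l2_norm u)\<^sup>2 \<le> (c1 * R\<^sup>2 * h)\<^sup>2 / (c * s)"
      using s const by (intro order_trans[OF u2'] divide_left_mono mult_left_mono) auto
    also have "\<dots> = (C7 * (h / sqrt s))\<^sup>2" using const s by (simp add: C7_def power_divide power_mult_distrib)
    finally show ?thesis using const h by (intro power2_le_imp_le[of "l2_norm u"]) (auto simp: C7_def)
  qed
  have l1u: "l1_norm u \<le> C6 * h"
  proof -
    have "(l1_norm u)\<^sup>2 \<le> 3 * real m * ((c1 * R\<^sup>2 * h)\<^sup>2 / (c * m))"
      by (intro order_trans[OF u1] mult_left_mono u2') auto
    also have "\<dots> = (C6 * h)\<^sup>2" using const m by (simp add: C6_def power_divide power_mult_distrib)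
    finally show ?thesis using const h by (intro power2_le_imp_le[of "l1_norm u"]) (auto simp: C6_def)
  qed
  define x where "x = g' 0 \<cdot>\<^sub>v a + u"
  have x: "x \<in> carrier_vec d" using a u by (simp add: x_def)
  have "g' 0 \<le> c0" using deriv by (intro derivative_le_lipschitz[OF _ glip]) auto
  define Rt where "Rt = 2 * (R + 2 * C6 * h)"
  have C6: "C6 \<ge> 0" using const by (simp add: C6_def)
  have l1x: "l1_norm x \<le> (1 + c0) * Rt / 2"
  proof -
    have "l1_norm x \<le> g' 0 * l1_norm a + l1_norm u"
      unfolding x_def using l1_norm_add[of "g' 0 \<cdot>\<^sub>v a" d u] a u g0 by (simp add: l1_norm_smult)
    also have "\<dots> \<le> c0 * R + C6 * h" using \<open>g' 0 \<le> c0\<close> a(3) g0 const l1u by (intro add_mono mult_mono) auto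
    also have "\<dots> \<le> (1 + c0) * (R + 2 * C6 * h)"
    proof -
      have "0 \<le> C6 * h" "0 \<le> c0 * (2 * C6 * h)" using C6 h const by auto
      then show ?thesis using const by (simp add: algebra_simps)
    qed
    also have "\<dots> = (1 + c0) * Rt / 2" by (simp add: Rt_def field_simps)
    finally show ?thesis .
  qed
  let ?e = "Matrix.vec m (\<lambda>j. z j / h)"
  have obs': "observations (ridge g a) h \<Phi> z = \<Phi> *\<^sub>v x + ?e"
    unfolding obs x_def using a u by (simp add: mult_add_distrib_mat_vec[OF \<Phi>])
  have corr: "\<bar>(transpose_mat \<Phi> *\<^sub>v ?e) $ i\<bar> \<le> sqrt (2 * ln d) * (\<sigma> / h)" if i: "i < d" for i
  proof -
    have "(transpose_mat \<Phi> *\<^sub>v ?e) $ i = (\<Sum>j<m. \<Phi> $$ (j, i) * z j) / h"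
      using i \<Phi> by (simp add: scalar_prod_def atLeast0LessThan sum_divide_distrib)
    then show ?thesis using noise[OF i] h by (simp add: abs_divide divide_right_mono)
  qed
  have lt: "0 \<le> sqrt (2 * ln d) * (\<sigma> / h)" using lnd \<sigma> h by simp
  let ?w = "D (observations (ridge g a) h \<Phi> z)"
  have dant: "?w \<in> carrier_vec d" "(l2_norm (?w - x))\<^sup>2 \<le> 2 * real k * (sqrt (2 * ln d) * (\<sigma> / h))\<^sup>2 + 12 * (l1_norm x)\<^sup>2 / real k"
    if "0 < k" "k \<le> s" for k
    unfolding obs' using dantzig_error[OF \<Phi> rip_mono[OF rip that(2)] that(1) dpos(1) D lt x _ corr] by simp_all
  show w: "?w \<in> carrier_vec d" by (rule dant(1)[OF s(1)]) simp
  let ?F = "\<lambda>k. 2 * C5 * ln (real d) * (real k * (\<sigma>\<^sup>2 / h\<^sup>2) + Rt\<^sup>2 / real k)"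
  have each: "(l2_norm (?w - x))\<^sup>2 \<le> ?F k" if k: "0 < k" "k \<le> s" for k
  proof -
    have sq: "(sqrt (2 * ln d) * (\<sigma> / h))\<^sup>2 = 2 * ln d * (\<sigma>\<^sup>2 / h\<^sup>2)"
      using lnd by (simp add: power_mult_distrib power_divide)
    have C5: "2 \<le> C5" using const(2) by (simp add: C5_def power2_eq_square algebra_simps)
    have T0: "0 \<le> ln d * (real k * (\<sigma>\<^sup>2 / h\<^sup>2))" using lnd by simp
    have "2 * real k * (sqrt (2 * ln d) * (\<sigma> / h))\<^sup>2 = 4 * (ln d * (real k * (\<sigma>\<^sup>2 / h\<^sup>2)))" unfolding sq by simp
    also have "\<dots> \<le> 2 * C5 * (ln d * (real k * (\<sigma>\<^sup>2 / h\<^sup>2)))" using C5 T0 by (intro mult_right_mono) auto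
    finally have 1: "2 * real k * (sqrt (2 * ln d) * (\<sigma> / h))\<^sup>2 \<le> 2 * C5 * (ln d * (real k * (\<sigma>\<^sup>2 / h\<^sup>2)))" .
    have "12 * (l1_norm x)\<^sup>2 \<le> 12 * ((1 + c0) * Rt / 2)\<^sup>2" using l1x by (intro mult_left_mono power_mono) auto
    also have "\<dots> = 3 * (1 + c0)\<^sup>2 * Rt\<^sup>2" by (simp add: power_divide power_mult_distrib)
    also have "\<dots> \<le> 4 * (1 + c0)\<^sup>2 * Rt\<^sup>2" by (intro mult_right_mono) auto
    also have "\<dots> = 2 * C5 * 1 * Rt\<^sup>2" by (simp add: C5_def)
    also have "\<dots> \<le> 2 * C5 * ln d * Rt\<^sup>2" using lnd C5 by (intro mult_right_mono mult_left_mono) auto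
    finally have "12 * (l1_norm x)\<^sup>2 / real k \<le> 2 * C5 * ln d * Rt\<^sup>2 / real k" by (intro divide_right_mono) auto
    with 1 show ?thesis using dant(2)[OF k] by (simp add: algebra_simps)
  qed
  have "(l2_norm (?w - x))\<^sup>2 \<le> (MIN k\<in>{1..s}. ?F k)"
    using s each by (intro Min.boundedI) auto
  then have main: "l2_norm (?w - x) \<le> sqrt (MIN k\<in>{1..s}. ?F k)" by (rule real_le_rsqrt)
  have "x - g' 0 \<cdot>\<^sub>v a = u" using a u by (auto simp: x_def)
  then have "l2_norm (?w - g' 0 \<cdot>\<^sub>v a) \<le> l2_norm (?w - x) + l2_norm u"
    using l2_norm_diff_triangle[OF w x, of "g' 0 \<cdot>\<^sub>v a"] a by simp
  also have "\<dots> \<le> err C5 C6 C7 R s d \<sigma> h"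
    unfolding err_def using main l2u by (intro add_mono) (auto simp: Rt_def)
  finally show "l2_norm (?w - g' 0 \<cdot>\<^sub>v a) \<le> err C5 C6 C7 R s d \<sigma> h" .
qed

section \<open>Recovery with high probability\<close>

lemma ln6_squared_ge_3: "3 \<le> (ln (6::real))\<^sup>2"
proof -
  \<comment> \<open>From \<open>e < 2.72\<close>: \<open>e\<^sup>7 < 6\<^sup>4\<close>, hence \<open>ln 6 \<ge> 7/4\<close>, whose square exceeds \<open>3\<close>.\<close>
  have "exp (7::real) = exp 1 ^ 7" using exp_of_nat_mult[of 7 "1::real"] by simp
  also have "\<dots> \<le> (272/100) ^ 7" using e_less_272 by (intro power_mono) auto
  also have "\<dots> \<le> (6 :: real) ^ 4" by (simp add: power_divide)
  also have "\<dots> = exp (4 * ln 6)" using exp_of_nat_mult[of 4 "ln (6::real)"] by simp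
  finally have "7/4 \<le> ln (6::real)" by simp
  then have "(7/4)\<^sup>2 \<le> (ln (6::real))\<^sup>2" by (intro power_mono) auto
  then show ?thesis by (simp add: power_divide)
qed

text \<open>Fubini over the finitely many matrices. This avoids any measurability question
  for the selector: the good event is a finite union of rectangles \<open>{\<Phi>} \<times> Z \<Phi>\<close>.\<close>

lemma sample_space_prob_ge:
  assumes m: "m > 0" and \<sigma>: "\<sigma> > 0"
    and G: "measure_pmf.prob (bernoulli_matrix m d) G \<ge> 1 - p" and p: "p \<ge> 0" and q: "q \<ge> 0" and r: "p + q \<le> r"
    and Z: "\<And>\<Phi>. \<Phi> \<in> set_pmf (bernoulli_matrix m d) \<Longrightarrow> Z \<Phi> \<in> sets (noise m \<sigma>) \<and> measure (noise m \<sigma>) (Z \<Phi>) \<ge> 1 - q"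
    and P: "\<And>\<Phi> z. \<Phi> \<in> set_pmf (bernoulli_matrix m d) \<Longrightarrow> \<Phi> \<in> G \<Longrightarrow> z \<in> Z \<Phi> \<Longrightarrow> P (\<Phi>, z)"
  shows "holds_with_prob_ge (sample_space m d \<sigma>) (1 - r) P"
proof -
  let ?B = "bernoulli_matrix m d" and ?N = "noise m \<sigma>"
  interpret N: prob_space ?N by (rule prob_space_noise[OF \<sigma>])
  have S: "sample_space m d \<sigma> = measure_pmf ?B \<Otimes>\<^sub>M ?N" by (simp add: sample_space_def noise_def)
  define E where "E = (\<Union>\<Phi>\<in>set_pmf ?B \<inter> G. {\<Phi>} \<times> Z \<Phi>)"
  have E: "E \<in> sets (measure_pmf ?B \<Otimes>\<^sub>M ?N)"
    unfolding E_def using finite_set_bernoulli_matrix[OF m] Z by (intro sets.finite_UN) auto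
  have slice: "Pair \<Phi> -` E = (if \<Phi> \<in> set_pmf ?B \<inter> G then Z \<Phi> else {})" for \<Phi>
    by (auto simp: E_def)
  have "ennreal (1 - (p + q)) \<le> ennreal (measure_pmf.prob ?B G - q)" using G by (intro ennreal_leI) simp
  also have "\<dots> \<le> ennreal (1 - q) * emeasure ?B G"
  proof (cases "q \<le> 1")
    case True
    have "measure_pmf.prob ?B G - q \<le> (1 - q) * measure_pmf.prob ?B G"
      using q mult_left_mono[OF measure_pmf.prob_le_1[of ?B G] q] by (simp add: algebra_simps)
    then show ?thesis using True by (simp add: measure_pmf.emeasure_eq_measure ennreal_mult[symmetric] ennreal_leI)
  next
    case False
    then have "measure_pmf.prob ?B G - q \<le> 0" using measure_pmf.prob_le_1[of ?B G] by linarith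
    then show ?thesis by (simp add: ennreal_neg)
  qed
  also have "\<dots> = (\<integral>\<^sup>+\<Phi>. ennreal (1 - q) * indicator G \<Phi> \<partial>?B)" by (simp add: nn_integral_cmult)
  also have "\<dots> \<le> (\<integral>\<^sup>+\<Phi>. emeasure ?N (Pair \<Phi> -` E) \<partial>?B)"
  proof (rule nn_integral_mono_AE, rule AE_pmfI)
    fix \<Phi> assume \<Phi>: "\<Phi> \<in> set_pmf ?B"
    show "ennreal (1 - q) * indicator G \<Phi> \<le> emeasure ?N (Pair \<Phi> -` E)"
      unfolding slice using \<Phi> Z[OF \<Phi>] by (auto simp: indicator_def N.emeasure_eq_measure intro!: ennreal_leI)
  qed
  also have "\<dots> = emeasure (sample_space m d \<sigma>) E" unfolding S by (rule N.emeasure_pair_measure_alt[symmetric, OF E])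
  finally have le: "ennreal (1 - (p + q)) \<le> emeasure (sample_space m d \<sigma>) E" .
  have "prob_space (sample_space m d \<sigma>)"
  proof -
    interpret pair_prob_space "measure_pmf ?B" ?N ..
    show ?thesis unfolding S by (rule P.prob_space_axioms)
  qed
  then interpret PS: prob_space "sample_space m d \<sigma>" .
  have "1 - (p + q) \<le> PS.prob E"
    using le unfolding PS.emeasure_eq_measure by (subst (asm) ennreal_le_iff) auto
  then have "1 - r \<le> PS.prob E" using r by linarith
  moreover have "P \<omega>" if "\<omega> \<in> E" for \<omega> using that P by (auto simp: E_def)
  ultimately show ?thesis unfolding holds_with_prob_ge_def using E S by auto
qed

lemma holds_with_prob_ge_trivial: "p \<le> 0 \<Longrightarrow> holds_with_prob_ge M p P"
  unfolding holds_with_prob_ge_def by (intro bexI[of _ "{}"]) auto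

lemma failure_probability_tendsto_0:
  assumes "C1 > 0"
  shows "(\<lambda>m::nat. 2 * exp (- C1 * real m) + ((1/2) ^ m + (97/100) ^ m) + 1 / sqrt (ln (real m))) \<longlonglongrightarrow> 0"
proof -
  have "(\<lambda>m::nat. exp (- C1 * real m)) \<longlonglongrightarrow> 0" using assms by real_asymp
  moreover have "(\<lambda>m::nat. (1/2::real) ^ m) \<longlonglongrightarrow> 0" "(\<lambda>m::nat. (97/100::real) ^ m) \<longlonglongrightarrow> 0"
    by (intro LIMSEQ_power_zero; simp)+
  moreover have "(\<lambda>m::nat. 1 / sqrt (ln (real m))) \<longlonglongrightarrow> 0" by real_asymp
  ultimately have "(\<lambda>m::nat. 2 * exp (- C1 * real m) + ((1/2) ^ m + (97/100) ^ m) + 1 / sqrt (ln (real m))) \<longlonglongrightarrow> 2 * 0 + (0 + 0) + 0"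
    by (intro tendsto_intros) simp_all
  then show ?thesis by simp
qed

theorem theorem4p1:
  fixes C1 C2 :: real
  assumes "bernoulli_rip_constants C1 C2"
  shows "\<exists>\<rho> :: nat \<Rightarrow> real. \<rho> \<longlonglongrightarrow> 0 \<and>
    (\<forall>c0 c1 R :: real. c0 > 0 \<longrightarrow> c1 > 0 \<longrightarrow> R > 0 \<longrightarrow>
      (\<exists>C5 C6 C7 :: real. C5 > 0 \<and> C6 > 0 \<and> C7 > 0 \<and>
        (\<forall>(s :: nat) (m :: nat) (d :: nat) (\<sigma> :: real) (h :: real)
            (a :: real Matrix.vec) (g :: real \<Rightarrow> real) (g' :: real \<Rightarrow> real)
            (\<Delta> :: real Matrix.mat \<Rightarrow> real Matrix.vec \<Rightarrow> real Matrix.vec).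
          0 < s \<longrightarrow> s \<le> m \<longrightarrow> m \<le> d \<longrightarrow>
          real d \<ge> (ln 6)\<^sup>2 * real m \<longrightarrow>
          3 * real s \<le> C2 * real m / ln (real d / real m) \<longrightarrow>
          \<sigma> > 0 \<longrightarrow> 0 < h \<longrightarrow> h < sqrt (real m / real d) \<longrightarrow>
          a \<in> carrier_vec d \<longrightarrow> l2_norm a = 1 \<longrightarrow> l1_norm a \<le> R \<longrightarrow>
          (\<forall>t\<in>{-1..1}. (g has_real_derivative g' t) (at t within {-1..1})) \<longrightarrow>
          (\<forall>t1\<in>{-1..1}. \<forall>t2\<in>{-1..1}. \<bar>g t1 - g t2\<bar> \<le> c0 * \<bar>t1 - t2\<bar>) \<longrightarrow>
          (\<forall>t1\<in>{-1..1}. \<forall>t2\<in>{-1..1}. \<bar>g' t1 - g' t2\<bar> \<le> c1 * \<bar>t1 - t2\<bar>) \<longrightarrow>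
          g' 0 > 0 \<longrightarrow>
          (\<forall>\<Phi>\<in>carrier_mat m d. dantzig_selector \<Phi> (sqrt (2 * ln (real d))) (\<sigma> / h) (\<Delta> \<Phi>)) \<longrightarrow>
          holds_with_prob_ge (sample_space m d \<sigma>) (1 - \<rho> m)
            (\<lambda>(\<Phi>, z).
              let f = ridge g a;
                  w = \<Delta> \<Phi> (observations f h \<Phi> z);
                  a_hat = (1 / l2_norm w) \<cdot>\<^sub>v w;
                  g_hat = (\<lambda>t. f (t \<cdot>\<^sub>v a_hat));
                  f_hat = ridge g_hat a_hat;
                  e = err C5 C6 C7 R s d \<sigma> h
              in (w \<noteq> 0\<^sub>v d \<longrightarrow>
                    sup_dist d f f_hat \<le> 2 * c0 * l2_norm (a - a_hat)) \<and>
                 (g' 0 - e > 0 \<longrightarrow>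
                    w \<noteq> 0\<^sub>v d \<and>
                    2 * c0 * l2_norm (a - a_hat) \<le> 4 * c0 * e / (g' 0 - e))))))"
proof -
  from assms have C1: "C1 > 0" and rip: "\<And>m d. 0 < m \<Longrightarrow> m < d \<Longrightarrow> (ln 6)\<^sup>2 * real m \<le> real d \<Longrightarrow>
       measure_pmf.prob (bernoulli_matrix m d)
         {\<Phi>. \<forall>s>0. real s \<le> C2 * real m / ln (real d / real m) \<longrightarrow> rip s (1/6) \<Phi>}
       \<ge> 1 - 2 * exp (- C1 * real m)"
    unfolding bernoulli_rip_constants_def by blast+
  obtain c m0 where c: "c > 0" and low: "\<forall>m\<ge>m0. \<forall>d\<ge>3*m.
    measure_pmf.prob (bernoulli_matrix m d) {\<Phi>. \<not> leading_columns_bounded_below c \<Phi> m} \<le> (1/2) ^ m + (97/100) ^ m"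
    using bernoulli_leading_columns_bounded_below by blast
  define m1 where "m1 = max m0 2"
  define r where "r = (\<lambda>m::nat. 2 * exp (- C1 * real m) + ((1/2) ^ m + (97/100) ^ m) + 1 / sqrt (ln (real m)))"
  \<comment> \<open>For small \<open>m\<close> the claim is made void; the net arguments need \<open>m \<ge> m0\<close>.\<close>
  define \<rho> where "\<rho> m = (if m < m1 then 1 else r m)" for m
  have \<rho>_lim: "\<rho> \<longlonglongrightarrow> 0"
  proof (rule Lim_transform_eventually)
    show "r \<longlonglongrightarrow> 0" unfolding r_def by (rule failure_probability_tendsto_0[OF C1])
    show "eventually (\<lambda>m. r m = \<rho> m) sequentially"
      using eventually_ge_at_top[of m1] by eventually_elim (simp add: \<rho>_def)
  qed
  show ?thesis
  proof (intro exI[of _ \<rho>] conjI \<rho>_lim allI impI, goal_cases)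
    case (1 c0 c1 R)
    define C5 where "C5 = 2 * (1 + c0)\<^sup>2"
    define C6 where "C6 = c1 * R\<^sup>2 * sqrt (3 / c)"
    define C7 where "C7 = c1 * R\<^sup>2 / sqrt c"
    have pos: "C5 > 0" "C6 > 0" "C7 > 0" using 1 c by (auto simp: C5_def C6_def C7_def)
    note const = \<open>c0 > 0\<close> \<open>c1 > 0\<close> \<open>R > 0\<close>
    show ?case
    proof (rule exI[of _ C5], rule exI[of _ C6], rule exI[of _ C7], intro conjI allI impI pos, goal_cases)
      case (1 s m d \<sigma> h a g g' \<Delta>)
      note s = \<open>0 < s\<close> \<open>s \<le> m\<close> and h = \<open>0 < h\<close> \<open>h < sqrt (real m / real d)\<close>
      note a = \<open>a \<in> carrier_vec d\<close> \<open>l2_norm a = 1\<close> \<open>l1_norm a \<le> R\<close>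
      note \<sigma> = \<open>\<sigma> > 0\<close> and d6 = \<open>(ln 6)\<^sup>2 * real m \<le> real d\<close>
      have m: "m > 0" using s by simp
      have "3 * real m \<le> (ln 6)\<^sup>2 * real m" by (intro mult_right_mono ln6_squared_ge_3) simp
      then have d3: "3 * m \<le> d" using d6 by linarith
      show ?case
      proof (cases "m < m1")
        case True
        then show ?thesis by (intro holds_with_prob_ge_trivial) (simp add: \<rho>_def)
      next
        case False
        let ?B = "bernoulli_matrix m d"
        define A where "A = {\<Phi>. \<forall>s>0. real s \<le> C2 * real m / ln (real d / real m) \<longrightarrow> rip s (1/6) \<Phi>}"
        define G where "G = A \<inter> {\<Phi>. leading_columns_bounded_below c \<Phi> m}"
        define Z where "Z \<Phi> = {z \<in> space (noise m \<sigma>). \<forall>i<d. \<bar>\<Sum>j<m. \<Phi> $$ (j, i) * z j\<bar> \<le> sqrt (2 * ln (real d)) * \<sigma>}" for \<Phi>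
        define p where "p = 2 * exp (- C1 * real m) + ((1/2) ^ m + (97/100) ^ m)"
        define q where "q = 1 / sqrt (ln (real d))"
        have PG: "1 - p \<le> measure_pmf.prob ?B G"
        proof -
          have "measure_pmf.prob ?B A \<le> measure_pmf.prob ?B (G \<union> {\<Phi>. \<not> leading_columns_bounded_below c \<Phi> m})"
            by (intro measure_pmf.finite_measure_mono) (auto simp: G_def)
          also have "\<dots> \<le> measure_pmf.prob ?B G + measure_pmf.prob ?B {\<Phi>. \<not> leading_columns_bounded_below c \<Phi> m}"
            by (intro measure_Un_le) auto
          also have "measure_pmf.prob ?B {\<Phi>. \<not> leading_columns_bounded_below c \<Phi> m} \<le> (1/2) ^ m + (97/100) ^ m"
            using low False d3 by (simp add: m1_def)
          finally show ?thesis using rip[of m d] m d3 d6 unfolding A_def[symmetric] p_def by linarith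
        qed
        show ?thesis
        proof (rule sample_space_prob_ge[OF m \<sigma> PG])
          show "0 \<le> p" by (simp add: p_def)
          show "0 \<le> q" using m d3 by (simp add: q_def)
          have "m \<ge> 2" using False by (simp add: m1_def)
          then have "sqrt (ln (real m)) > 0" "sqrt (ln (real m)) \<le> sqrt (ln (real d))" using d3 by auto
          then have "q \<le> 1 / sqrt (ln (real m))" unfolding q_def by (intro divide_left_mono mult_pos_pos) auto
          then show "p + q \<le> \<rho> m" using False by (simp add: \<rho>_def r_def p_def)
        next
          fix \<Phi> assume \<Phi>: "\<Phi> \<in> set_pmf ?B"
          show "Z \<Phi> \<in> sets (noise m \<sigma>) \<and> measure (noise m \<sigma>) (Z \<Phi>) \<ge> 1 - q"
            unfolding Z_def q_def using m d3
            by (intro conjI noise_correlation_bound[OF \<sigma> m] bernoulli_matrix_entry(2)[OF m \<Phi>]) auto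
        next
          fix \<Phi> z assume \<Phi>: "\<Phi> \<in> set_pmf ?B" and G: "\<Phi> \<in> G" and z: "z \<in> Z \<Phi>"
          note carrier = bernoulli_matrix_entry(1)[OF m \<Phi>]
          let ?w = "\<Delta> \<Phi> (observations (ridge g a) h \<Phi> z)"
          let ?e = "err C5 C6 C7 R s d \<sigma> h"
          let ?b = "(1 / l2_norm ?w) \<cdot>\<^sub>v ?w"
          have "real s \<le> C2 * real m / ln (real d / real m)"
            using \<open>3 * real s \<le> C2 * real m / ln (real d / real m)\<close> by linarith
          then have rips: "rip s (1/6) \<Phi>" using G s(1) by (simp add: G_def A_def)
          have lows: "leading_columns_bounded_below c \<Phi> m" using G by (simp add: G_def)
          have sel: "dantzig_selector \<Phi> (sqrt (2 * ln (real d))) (\<sigma> / h) (\<Delta> \<Phi>)" using 1 carrier by blast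
          have noise: "\<bar>\<Sum>j<m. \<Phi> $$ (j, i) * z j\<bar> \<le> sqrt (2 * ln (real d)) * \<sigma>" if "i < d" for i
            using z that by (simp add: Z_def)
          have w: "?w \<in> carrier_vec d" and close: "l2_norm (?w - g' 0 \<cdot>\<^sub>v a) \<le> ?e"
            unfolding C5_def C6_def C7_def
            by (rule recovery_error[OF c const carrier bernoulli_matrix_entry(2)[OF m \<Phi>] lows rips s d3 \<sigma> h a 1(12) 1(13) 1(14) 1(15) sel noise]; assumption)+
          have b: "?b \<in> carrier_vec d" using w by simp
          show "case (\<Phi>, z) of (\<Phi>, z) \<Rightarrow>
              let f = ridge g a;
                  w = \<Delta> \<Phi> (observations f h \<Phi> z);
                  a_hat = (1 / l2_norm w) \<cdot>\<^sub>v w;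
                  g_hat = (\<lambda>t. f (t \<cdot>\<^sub>v a_hat));
                  f_hat = ridge g_hat a_hat;
                  e = err C5 C6 C7 R s d \<sigma> h
              in (w \<noteq> 0\<^sub>v d \<longrightarrow>
                    sup_dist d f f_hat \<le> 2 * c0 * l2_norm (a - a_hat)) \<and>
                 (g' 0 - e > 0 \<longrightarrow>
                    w \<noteq> 0\<^sub>v d \<and>
                    2 * c0 * l2_norm (a - a_hat) \<le> 4 * c0 * e / (g' 0 - e))"
            unfolding Let_def prod.case
          proof (intro conjI impI)
            assume "?w \<noteq> 0\<^sub>v d"
            then have "l2_norm ?w > 0" using l2_norm_eq_0[OF w] l2_norm_nonneg[of ?w] by linarith
            then have "l2_norm ?b = 1" by (simp add: l2_norm_smult)
            then show "sup_dist d (ridge g a) (ridge (\<lambda>t. ridge g a (t \<cdot>\<^sub>v ?b)) ?b) \<le> 2 * c0 * l2_norm (a - ?b)"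
              using const 1(13) by (intro sup_dist_ridge_le a b) auto
          next
            assume gap: "0 < g' 0 - ?e"
            show "?w \<noteq> 0\<^sub>v d" by (rule normalized_direction_error(1)[OF a(1,2) w close gap])
            have "2 * c0 * l2_norm (a - ?b) \<le> 2 * c0 * (2 * ?e / (g' 0 - ?e))"
              using const by (intro mult_left_mono normalized_direction_error(2)[OF a(1,2) w close gap]) auto
            then show "2 * c0 * l2_norm (a - ?b) \<le> 4 * c0 * ?e / (g' 0 - ?e)" by simp
          qed
        qed
      qed
    qed
  qed
qed

end
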